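(* Let $Y$ be a locally compact space with a Radon measure $\mu$, let $\langle\mathfrak V,\mathfrak Q;X,Y\rangle$ be a $(\Theta,\mathcal E,\mu)$-structure with $\mathfrak V=\langle\langle\mathfrak E,\tau\rangle,\pi,X,\{\nu_j:j\in J\}\rangle$, $\mathfrak Q=\langle\langle\mathfrak H,\gamma\rangle,\xi,X,\mathfrak Y\rangle$, and let $\langle\mathfrak V;\mathfrak Z,\mathsf H\rangle$ be $\mu$-related, where $\mathfrak Z=\langle\langle\mathfrak T,\delta\rangle,\zeta,X,\mathfrak K\rangle$ and $\mathsf H_x=\mathfrak H_x$ for all $x\in X$. Let $x\in X$ be such that its filter of neighbourhoods admits a countable basis. If $\Gamma(\xi)\bigstar\mathcal E(\Theta)\subseteq\Gamma(\zeta)$, then $$\mathsf I_\mu\Bigl(\bigl[\Gamma_\diamond^x(\xi)_{peq}\bigstar\Gamma^x_{\mathcal E(\Theta)}(\pi)\bigr]_{ui}\Bigr)\subseteq\Gamma_\diamond^x(\pi),$$ where $\mathsf I_\mu(H)(z)=\int H(z)(s)\,d\mu(s)$ for $z\in X$.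
   Context: Vector spaces are over $\mathbb C$; Hlcs means Hausdorff locally convex space. Bundles. A bundle of $\Omega$-spaces $\langle\langle\mathfrak E,\tau\rangle,\pi,X,\mathfrak N\rangle$ (Gierz) consists of topological spaces $\langle\mathfrak E,\tau\rangle$ and $X$, a continuous open surjection $\pi:\mathfrak E\to X$, a vector space structure on each stalk $\mathfrak E_x=\pi^{-1}(x)$ such that addition $\{(a,b):\pi(a)=\pi(b)\}\to\mathfrak E$ and scalar multiplication are continuous, and a set $\mathfrak N=\{\nu_j:j\in J\}$ of functions $\mathfrak E\to[0,\infty[$ whose restrictions to each $\mathfrak E_x$ form a directed family of seminorms generating the (Hausdorff) topology induced by $\tau$ on $\mathfrak E_x$. For $U\subseteq X$, $\prod^b_{x\in U}\mathfrak E_x$ is the set of $\sigma\in\prod_{x\in U}\mathfrak E_x$ with $\sup_{x\in U}\nu_j(\sigma(x))<\infty$ for all $j$; $\Gamma_U(\pi)$ (resp. $\Gamma_U^x(\pi)$) is the set of those continuous (resp. continuous at $x\in U$); $U$ is omitted if $U=X$. The tubes $\{\beta:\pi(\beta)\in U,\nu_j(\beta-\sigma(\pi(\beta)))<\varepsilon\}$ ($U$ open, $\sigma\in\Gamma_U(\pi)$, $\varepsilon>0$, $j\in J$) form a base of $\tau$. For a set $S$ of sections, $\Gamma_S^x(\pi)=\{H\in\Gamma^x(\pi):\exists F\in S,\ H(x)=F(x)\}$; $\Gamma^x_\diamond(\pi)=\Gamma^x_{\Gamma(\pi)}(\pi)$; similarly for $\xi,\zeta$. $\mathfrak L_1(Y,E,\mu)$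 ($E$ a Hlcs): scalarly essentially $\mu$-integrable maps $Y\to E$ whose (weak) integral belongs to $E$ (Bourbaki); $Meas(Y,E,\mu)$: $\mu$-measurable maps; $\int^\bullet$: essential upper integral. $\mathsf I_\mu(H)(x)=\int H(x)(s)\,d\mu(s)$ for $H\in\prod_x\mathfrak L_1(Y,\mathfrak E_x,\mu)$. $(\Theta,\mathcal E,\mu)$-structure. Let $\mathcal E\subseteq\Gamma(\pi)$, $\Theta\subseteq\prod_xBounded(\mathfrak E_x)$, $\mathsf D(B,\mathcal E)=\mathcal E\cap\prod_xB(x)$, $\mathcal B_B^x=\{v(x):v\in\mathsf D(B,\mathcal E)\}$, $S_x=\{\mathcal B_B^x:B\in\Theta\}$, $\mathcal E(\Theta)=\bigcup_B\mathsf D(B,\mathcal E)$; $\mathcal L_{S_x}(\mathfrak E_x)$: continuous linear endomorphisms with uniform convergence on members of $S_x$. $\langle\mathfrak V,\mathfrak Q;X,Y\rangle$ is a $(\Theta,\mathcal E,\mu)$-structure if all $\mathsf D(B,\mathcal E)\ne\emptyset$, $\bigcup_B\mathcal B_B^x$ is total in $\mathfrak E_x$ for all $x$, and $\mathfrak Q$ is a bundle of $\Omega$-spaces with $\mathfrak H_x\subseteq\mathfrak L_1(Y,\mathcal L_{S_x}(\mathfrak E_x),\mu)$ and directed family of seminorms $\sup_{(t,j,B)\in O}P^x_{(t,j,B)}$, $O$ finite $\subset Y\times J\times\Theta$, $P^x_{(t,j,B)}(F)=\sup_{v\in\mathsf D(B,\mathcal E)}\nu_j(F(t)v(x))$. For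 a set $A\subseteq\prod_x\mathfrak H_x$, $A_{peq}$ is the set of pointwise equicontinuous $F\in A$: for every $t\in Y$ and $j\in J$ there are $a>0$, $j_1\in J$ with $\nu_j(F(z)(t)v_z)\le a\,\nu_{j_1}(v_z)$ for all $z\in X$, $v_z\in\mathfrak E_z$. $(F\bigstar v)(x)(s)=F(x)(s)(v(x))$ for $F\in\prod_x\mathcal L(\mathfrak E_x)^Y$, $v\in\prod_x\mathfrak E_x$. For $\mathcal A\subseteq\prod^b_x\mathfrak T_x$, $[\mathcal A]_{ui}=\{H\in\mathcal A:\int^\bullet_Y\sup_{x}\nu_j(H(x)(s))\,d|\mu|(s)<\infty\ \forall j\}$. $\langle\mathfrak V;\mathfrak Z\rangle$ is $\mu$-related if $\mathfrak Z$ is a bundle of $\Omega$-spaces with $\mathfrak T_x\subseteq Meas(Y,\mathfrak E_x,\mu)\cap\mathfrak L_1(Y,\mathfrak E_x,\mu)$ and directed family of seminorms $f\mapsto\sup_{(s,j)\in O}\nu_j(f(s))$, $O$ finite $\subset Y\times J$; $\Gamma(\zeta)\subset[\prod_x^b\mathfrak T_x]_{ui}$; and $\mathsf I_\mu(\Gamma(\zeta))\subseteq\Gamma(\pi)$. $\langle\mathfrak V;\mathfrak Z,\mathsf H\rangle$ is $\mu$-related if moreover $\mathsf H_x\subseteq\mathcal L(\mathfrak E_x)^Y$ for all $x$ and $(\prod_x\mathsf H_x)\bigstar(\prod_x\mathfrak E_x)\subseteq\prod_x\mathfrak T_x$. *)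

theory Defs
  imports "HOL-Analysis.Analysis" "HOL-Algebra.Module"
begin

section \<open>Radon measures in the sense of Bourbaki\<close>

definition Cc :: "('y::topological_space \<Rightarrow> 'b::real_normed_vector) set" where
  "Cc = {f. continuous_on UNIV f \<and> compact (closure {y. f y \<noteq> 0})}"

text \<open>A (complex) Radon measure is a linear form on \<open>Cc\<close> that is continuous for the inductive
  limit topology; its values outside \<open>Cc\<close> are irrelevant.\<close>

definition radon_measure :: "(('y::topological_space \<Rightarrow> complex) \<Rightarrow> complex) \<Rightarrow> bool" where
  "radon_measure \<mu> \<longleftrightarrow>
     (\<forall>f\<in>Cc. \<forall>g\<in>Cc. \<mu> (\<lambda>y. f y + g y) = \<mu> f + \<mu> g) \<and>
     (\<forall>c. \<forall>f\<in>Cc. \<mu> (\<lambda>y. c * f y) = c * \<mu> f) \<and>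
     (\<forall>K. compact K \<longrightarrow>
        (\<exists>M. \<forall>f\<in>Cc. closure {y. f y \<noteq> 0} \<subseteq> K \<longrightarrow> norm (\<mu> f) \<le> M * (SUP y. norm (f y))))"

text \<open>The absolute value of \<open>\<mu>\<close>, on nonnegative elements of \<open>Cc\<close>.\<close>

definition rm_abs ::
  "(('y::topological_space \<Rightarrow> complex) \<Rightarrow> complex) \<Rightarrow> ('y \<Rightarrow> real) \<Rightarrow> ennreal" where
  "rm_abs \<mu> f = (SUP g\<in>{g\<in>Cc. \<forall>y. norm (g y) \<le> f y}. ennreal (norm (\<mu> g)))"

definition lower_semicont :: "('y::topological_space \<Rightarrow> ennreal) \<Rightarrow> bool" where
  "lower_semicont h \<longleftrightarrow> (\<forall>a. open {y. a < h y})"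

definition lsc_integral ::
  "(('y::topological_space \<Rightarrow> complex) \<Rightarrow> complex) \<Rightarrow> ('y \<Rightarrow> ennreal) \<Rightarrow> ennreal" where
  "lsc_integral \<mu> h =
     (SUP g\<in>{g\<in>Cc. \<forall>y. 0 \<le> g y \<and> ennreal (g y) \<le> h y}. rm_abs \<mu> g)"

definition upper_integral ::
  "(('y::topological_space \<Rightarrow> complex) \<Rightarrow> complex) \<Rightarrow> ('y \<Rightarrow> ennreal) \<Rightarrow> ennreal" where
  "upper_integral \<mu> f = (INF h\<in>{h. lower_semicont h \<and> (\<forall>y. f y \<le> h y)}. lsc_integral \<mu> h)"

definition ess_upper_integral ::
  "(('y::topological_space \<Rightarrow> complex) \<Rightarrow> complex) \<Rightarrow> ('y \<Rightarrow> ennreal) \<Rightarrow> ennreal" where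
  "ess_upper_integral \<mu> f = (SUP K\<in>{K. compact K}. upper_integral \<mu> (\<lambda>y. f y * indicator K y))"

definition rm_negligible ::
  "(('y::topological_space \<Rightarrow> complex) \<Rightarrow> complex) \<Rightarrow> 'y set \<Rightarrow> bool" where
  "rm_negligible \<mu> N \<longleftrightarrow> upper_integral \<mu> (indicator N) = 0"

definition locally_negligible ::
  "(('y::topological_space \<Rightarrow> complex) \<Rightarrow> complex) \<Rightarrow> 'y set \<Rightarrow> bool" where
  "locally_negligible \<mu> N \<longleftrightarrow> ess_upper_integral \<mu> (indicator N) = 0"

text \<open>The integrable functions are the closure of \<open>Cc\<close> for the seminorm
  \<open>f \<mapsto> upper_integral \<mu> \<bar>f\<bar>\<close>, and the integral is the continuous extension of \<open>\<mu>\<close>.\<close>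

definition has_rm_integral ::
  "(('y::topological_space \<Rightarrow> complex) \<Rightarrow> complex) \<Rightarrow> ('y \<Rightarrow> complex) \<Rightarrow> complex \<Rightarrow> bool" where
  "has_rm_integral \<mu> f I \<longleftrightarrow>
     (\<exists>g. (\<forall>n::nat. g n \<in> Cc) \<and>
          (\<lambda>n. upper_integral \<mu> (\<lambda>y. ennreal (norm (f y - g n y)))) \<longlonglongrightarrow> 0 \<and>
          (\<lambda>n. \<mu> (g n)) \<longlonglongrightarrow> I)"

definition has_ess_integral ::
  "(('y::topological_space \<Rightarrow> complex) \<Rightarrow> complex) \<Rightarrow> ('y \<Rightarrow> complex) \<Rightarrow> complex \<Rightarrow> bool" where
  "has_ess_integral \<mu> f I \<longleftrightarrow>
     (\<exists>f'. has_rm_integral \<mu> f' I \<and> locally_negligible \<mu> {y. f y \<noteq> f' y})"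

definition ess_integrable ::
  "(('y::topological_space \<Rightarrow> complex) \<Rightarrow> complex) \<Rightarrow> ('y \<Rightarrow> complex) \<Rightarrow> bool" where
  "ess_integrable \<mu> f \<longleftrightarrow> (\<exists>I. has_ess_integral \<mu> f I)"

definition ess_integral ::
  "(('y::topological_space \<Rightarrow> complex) \<Rightarrow> complex) \<Rightarrow> ('y \<Rightarrow> complex) \<Rightarrow> complex" where
  "ess_integral \<mu> f = (THE I. has_ess_integral \<mu> f I)"

text \<open>Measurability is Bourbaki's: up to negligible sets, compact sets are partitioned into countably
  many compact pieces (some possibly empty) on which the map is continuous.\<close>

definition Meas ::
  "'v topology \<Rightarrow> (('y::topological_space \<Rightarrow> complex) \<Rightarrow> complex) \<Rightarrow> ('y \<Rightarrow> 'v) set" where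
  "Meas T \<mu> = {f. (\<forall>y. f y \<in> topspace T) \<and>
     (\<forall>K. compact K \<longrightarrow>
        (\<exists>N C. N \<subseteq> K \<and> rm_negligible \<mu> N \<and>
               (\<forall>n::nat. compact (C n)) \<and> disjoint_family C \<and> K - N = (\<Union>n. C n) \<and>
               (\<forall>n. continuous_map (top_of_set (C n)) T f)))}"


section \<open>Locally convex spaces on carriers\<close>

text \<open>A complex topological vector space is given by a module \<open>M\<close> over \<open>complex_ring\<close> (whose
  unused multiplicative components are left undefined) together with a topology on its carrier.\<close>

definition complex_ring :: "complex ring" where
  "complex_ring = \<lparr>carrier = UNIV, monoid.mult = (*), one = 1, ring.zero = 0, add = (+)\<rparr>"

definition seminorm_on :: "(complex, 'v) module \<Rightarrow> ('v \<Rightarrow> real) \<Rightarrow> bool" where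
  "seminorm_on M p \<longleftrightarrow>
     (\<forall>v\<in>carrier M. 0 \<le> p v) \<and>
     (\<forall>v\<in>carrier M. \<forall>w\<in>carrier M. p (v \<oplus>\<^bsub>M\<^esub> w) \<le> p v + p w) \<and>
     (\<forall>c. \<forall>v\<in>carrier M. p (c \<odot>\<^bsub>M\<^esub> v) = norm c * p v)"

definition seminorm_topology :: "(complex, 'v) module \<Rightarrow> ('v \<Rightarrow> real) set \<Rightarrow> 'v topology" where
  "seminorm_topology M P = topology_generated_by
     (insert (carrier M)
        {{w \<in> carrier M. p (w \<ominus>\<^bsub>M\<^esub> v) < r} | p v r. p \<in> P \<and> v \<in> carrier M \<and> 0 < r})"

definition linear_between ::
  "(complex, 'v) module \<Rightarrow> (complex, 'w) module \<Rightarrow> ('v \<Rightarrow> 'w) \<Rightarrow> bool" where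
  "linear_between M N f \<longleftrightarrow>
     f \<in> carrier M \<rightarrow> carrier N \<and>
     (\<forall>v\<in>carrier M. \<forall>w\<in>carrier M. f (v \<oplus>\<^bsub>M\<^esub> w) = f v \<oplus>\<^bsub>N\<^esub> f w) \<and>
     (\<forall>c. \<forall>v\<in>carrier M. f (c \<odot>\<^bsub>M\<^esub> v) = c \<odot>\<^bsub>N\<^esub> f v)"

definition complex_module :: "(complex, complex) module" where
  "complex_module = ring.extend complex_ring \<lparr>smult = (*)\<rparr>"

definition dual :: "(complex, 'v) module \<Rightarrow> 'v topology \<Rightarrow> ('v \<Rightarrow> complex) set" where
  "dual M T = {\<omega>. linear_between M complex_module \<omega> \<and> continuous_map T euclidean \<omega>}"

definition bounded_in :: "(complex, 'v) module \<Rightarrow> 'v topology \<Rightarrow> 'v set \<Rightarrow> bool" where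
  "bounded_in M T B \<longleftrightarrow> B \<subseteq> carrier M \<and>
     (\<forall>U. openin T U \<and> \<zero>\<^bsub>M\<^esub> \<in> U \<longrightarrow>
        (\<exists>r>0. \<forall>c. r \<le> norm c \<longrightarrow> B \<subseteq> (\<lambda>u. c \<odot>\<^bsub>M\<^esub> u) ` U))"

definition lin_span :: "(complex, 'v) module \<Rightarrow> 'v set \<Rightarrow> 'v set" where
  "lin_span M A = \<Inter> {W. submodule W complex_ring M \<and> A \<subseteq> W}"

definition total_in :: "(complex, 'v) module \<Rightarrow> 'v topology \<Rightarrow> 'v set \<Rightarrow> bool" where
  "total_in M T A \<longleftrightarrow> A \<subseteq> carrier M \<and> T closure_of (lin_span M A) = carrier M"

text \<open>Continuous linear endomorphisms are made extensional, so that they are determined by their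
  values on the carrier.\<close>

definition endos :: "(complex, 'v) module \<Rightarrow> 'v topology \<Rightarrow> ('v \<Rightarrow> 'v) set" where
  "endos M T = {f \<in> extensional (carrier M). linear_between M M f \<and> continuous_map T T f}"

definition endo_module :: "(complex, 'v) module \<Rightarrow> 'v topology \<Rightarrow> (complex, 'v \<Rightarrow> 'v) module" where
  "endo_module M T = \<lparr>carrier = endos M T, monoid.mult = undefined, one = undefined,
     ring.zero = (\<lambda>v\<in>carrier M. \<zero>\<^bsub>M\<^esub>),
     add = (\<lambda>f g. \<lambda>v\<in>carrier M. f v \<oplus>\<^bsub>M\<^esub> g v),
     smult = (\<lambda>c f. \<lambda>v\<in>carrier M. c \<odot>\<^bsub>M\<^esub> f v)\<rparr>"

text \<open>Uniform convergence on the members of \<open>S\<close>, where \<open>P\<close> is a family of seminorms generating \<open>T\<close>.\<close>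

definition unif_conv_topology ::
  "(complex, 'v) module \<Rightarrow> 'v topology \<Rightarrow> ('v \<Rightarrow> real) set \<Rightarrow> 'v set set \<Rightarrow> ('v \<Rightarrow> 'v) topology" where
  "unif_conv_topology M T P S =
     seminorm_topology (endo_module M T) {\<lambda>f. SUP b\<in>A. p (f b) | p A. p \<in> P \<and> A \<in> S}"

text \<open>Scalarly essentially integrable maps whose weak integral, a priori a linear form on the dual,
  is given by an element of the space.\<close>

definition has_weak_integral ::
  "(complex, 'v) module \<Rightarrow> 'v topology \<Rightarrow> (('y::topological_space \<Rightarrow> complex) \<Rightarrow> complex) \<Rightarrow>
   ('y \<Rightarrow> 'v) \<Rightarrow> 'v \<Rightarrow> bool" where
  "has_weak_integral M T \<mu> f e \<longleftrightarrow>
     e \<in> carrier M \<and> (\<forall>\<omega>\<in>dual M T. \<omega> e = ess_integral \<mu> (\<lambda>s. \<omega> (f s)))"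

definition L1 ::
  "(complex, 'v) module \<Rightarrow> 'v topology \<Rightarrow> (('y::topological_space \<Rightarrow> complex) \<Rightarrow> complex) \<Rightarrow>
   ('y \<Rightarrow> 'v) set" where
  "L1 M T \<mu> = {f. (\<forall>s. f s \<in> carrier M) \<and>
     (\<forall>\<omega>\<in>dual M T. ess_integrable \<mu> (\<lambda>s. \<omega> (f s))) \<and>
     (\<exists>e. has_weak_integral M T \<mu> f e)}"

definition weak_integral ::
  "(complex, 'v) module \<Rightarrow> 'v topology \<Rightarrow> (('y::topological_space \<Rightarrow> complex) \<Rightarrow> complex) \<Rightarrow>
   ('y \<Rightarrow> 'v) \<Rightarrow> 'v" where
  "weak_integral M T \<mu> f = (THE e. has_weak_integral M T \<mu> f e)"


section \<open>Bundles of Omega-spaces\<close>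

text \<open>The base space is the whole type \<open>'x\<close>; the total space is the carrier of \<open>btop\<close>.
  The seminorms are \<open>bsem \<BB> j\<close> for \<open>j \<in> bidx \<BB>\<close>, and \<open>bzero \<BB> x\<close> is the origin of the stalk
  over \<open>x\<close>.\<close>

record ('e, 'x, 'j) bundle_data =
  btop :: "'e topology"
  bproj :: "'e \<Rightarrow> 'x"
  bzero :: "'x \<Rightarrow> 'e"
  badd :: "'e \<Rightarrow> 'e \<Rightarrow> 'e"
  bscale :: "complex \<Rightarrow> 'e \<Rightarrow> 'e"
  bidx :: "'j set"
  bsem :: "'j \<Rightarrow> 'e \<Rightarrow> real"

definition stalk :: "('e, 'x, 'j) bundle_data \<Rightarrow> 'x \<Rightarrow> 'e set" where
  "stalk \<BB> x = {e \<in> topspace (btop \<BB>). bproj \<BB> e = x}"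

definition stalk_module :: "('e, 'x, 'j) bundle_data \<Rightarrow> 'x \<Rightarrow> (complex, 'e) module" where
  "stalk_module \<BB> x = \<lparr>carrier = stalk \<BB> x, monoid.mult = undefined, one = undefined,
     ring.zero = bzero \<BB> x, add = badd \<BB>, smult = bscale \<BB>\<rparr>"

definition stalk_top :: "('e, 'x, 'j) bundle_data \<Rightarrow> 'x \<Rightarrow> 'e topology" where
  "stalk_top \<BB> x = subtopology (btop \<BB>) (stalk \<BB> x)"

definition bounded_sections :: "('e, 'x, 'j) bundle_data \<Rightarrow> 'x set \<Rightarrow> ('x \<Rightarrow> 'e) set" where
  "bounded_sections \<BB> U =
     {\<sigma> \<in> Pi\<^sub>E U (stalk \<BB>). \<forall>j\<in>bidx \<BB>. bdd_above ((\<lambda>x. bsem \<BB> j (\<sigma> x)) ` U)}"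

definition csections ::
  "('e, 'x::topological_space, 'j) bundle_data \<Rightarrow> 'x set \<Rightarrow> ('x \<Rightarrow> 'e) set" where
  "csections \<BB> U = {\<sigma> \<in> bounded_sections \<BB> U. continuous_map (top_of_set U) (btop \<BB>) \<sigma>}"

definition csections_at ::
  "('e, 'x::topological_space, 'j) bundle_data \<Rightarrow> 'x set \<Rightarrow> 'x \<Rightarrow> ('x \<Rightarrow> 'e) set" where
  "csections_at \<BB> U x =
     {\<sigma> \<in> bounded_sections \<BB> U. topcontinuous_at (top_of_set U) (btop \<BB>) \<sigma> x}"

abbreviation \<Gamma> :: "('e, 'x::topological_space, 'j) bundle_data \<Rightarrow> ('x \<Rightarrow> 'e) set" where
  "\<Gamma> \<BB> \<equiv> csections \<BB> UNIV"

definition \<Gamma>_through ::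
  "('e, 'x::topological_space, 'j) bundle_data \<Rightarrow> ('x \<Rightarrow> 'e) set \<Rightarrow> 'x \<Rightarrow> ('x \<Rightarrow> 'e) set" where
  "\<Gamma>_through \<BB> S x = {H \<in> csections_at \<BB> UNIV x. \<exists>F\<in>S. H x = F x}"

abbreviation \<Gamma>_diamond ::
  "('e, 'x::topological_space, 'j) bundle_data \<Rightarrow> 'x \<Rightarrow> ('x \<Rightarrow> 'e) set" where
  "\<Gamma>_diamond \<BB> x \<equiv> \<Gamma>_through \<BB> (\<Gamma> \<BB>) x"

definition tube ::
  "('e, 'x, 'j) bundle_data \<Rightarrow> 'x set \<Rightarrow> ('x \<Rightarrow> 'e) \<Rightarrow> real \<Rightarrow> 'j \<Rightarrow> 'e set" where
  "tube \<BB> U \<sigma> \<epsilon> j = {\<beta> \<in> topspace (btop \<BB>). bproj \<BB> \<beta> \<in> U \<and>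
     bsem \<BB> j (\<beta> \<ominus>\<^bsub>stalk_module \<BB> (bproj \<BB> \<beta>)\<^esub> \<sigma> (bproj \<BB> \<beta>)) < \<epsilon>}"

definition omega_bundle :: "('e, 'x::topological_space, 'j) bundle_data \<Rightarrow> bool" where
  "omega_bundle \<BB> \<longleftrightarrow>
     continuous_map (btop \<BB>) euclidean (bproj \<BB>) \<and>
     open_map (btop \<BB>) euclidean (bproj \<BB>) \<and>
     bproj \<BB> ` topspace (btop \<BB>) = UNIV \<and>
     (\<forall>x. Module.module complex_ring (stalk_module \<BB> x)) \<and>
     continuous_map
       (subtopology (prod_topology (btop \<BB>) (btop \<BB>)) {(a, b). bproj \<BB> a = bproj \<BB> b})
       (btop \<BB>) (\<lambda>(a, b). badd \<BB> a b) \<and>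
     continuous_map (prod_topology euclidean (btop \<BB>)) (btop \<BB>) (\<lambda>(c, a). bscale \<BB> c a) \<and>
     (\<forall>x. \<forall>j\<in>bidx \<BB>. seminorm_on (stalk_module \<BB> x) (bsem \<BB> j)) \<and>
     (\<forall>x. \<forall>i\<in>bidx \<BB>. \<forall>j\<in>bidx \<BB>. \<exists>k\<in>bidx \<BB>.
        \<forall>e\<in>stalk \<BB> x. bsem \<BB> i e \<le> bsem \<BB> k e \<and> bsem \<BB> j e \<le> bsem \<BB> k e) \<and>
     (\<forall>x. stalk_top \<BB> x = seminorm_topology (stalk_module \<BB> x) (bsem \<BB> ` bidx \<BB>)) \<and>
     (\<forall>x. Hausdorff_space (stalk_top \<BB> x)) \<and>
     openin (btop \<BB>) = arbitrary union_of
       (\<lambda>W. \<exists>U \<sigma> \<epsilon> j. open U \<and> \<sigma> \<in> csections \<BB> U \<and> 0 < \<epsilon> \<and> j \<in> bidx \<BB> \<and> W = tube \<BB> U \<sigma> \<epsilon> j)"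


section \<open>\<open>(\<Theta>, \<E>, \<mu>)\<close>-structures\<close>

definition DD :: "('x \<Rightarrow> 'e set) \<Rightarrow> ('x \<Rightarrow> 'e) set \<Rightarrow> ('x \<Rightarrow> 'e) set" where
  "DD B \<E> = \<E> \<inter> Pi UNIV B"

definition BB :: "('x \<Rightarrow> 'e) set \<Rightarrow> ('x \<Rightarrow> 'e set) \<Rightarrow> 'x \<Rightarrow> 'e set" where
  "BB \<E> B x = {v x | v. v \<in> DD B \<E>}"

definition SS :: "('x \<Rightarrow> 'e set) set \<Rightarrow> ('x \<Rightarrow> 'e) set \<Rightarrow> 'x \<Rightarrow> 'e set set" where
  "SS \<Theta> \<E> x = {BB \<E> B x | B. B \<in> \<Theta>}"

definition sections_of :: "('x \<Rightarrow> 'e) set \<Rightarrow> ('x \<Rightarrow> 'e set) set \<Rightarrow> ('x \<Rightarrow> 'e) set" where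
  "sections_of \<E> \<Theta> = (\<Union>B\<in>\<Theta>. DD B \<E>)"

abbreviation stalk_endos :: "('e, 'x, 'j) bundle_data \<Rightarrow> 'x \<Rightarrow> ('e \<Rightarrow> 'e) set" where
  "stalk_endos \<VV> x \<equiv> endos (stalk_module \<VV> x) (stalk_top \<VV> x)"

text \<open>The stalks of \<open>\<QQ>\<close> are sets of functions and carry the pointwise vector space operations. A
  finite supremum of seminorms is a \<open>Max\<close>, the empty one being \<open>0\<close>.\<close>

definition theta_structure ::
  "('e, 'x::topological_space, 'j) bundle_data \<Rightarrow>
   ('y::topological_space \<Rightarrow> 'e \<Rightarrow> 'e, 'x, ('y \<times> 'j \<times> ('x \<Rightarrow> 'e set)) set) bundle_data \<Rightarrow>
   ('x \<Rightarrow> 'e set) set \<Rightarrow> ('x \<Rightarrow> 'e) set \<Rightarrow> (('y \<Rightarrow> complex) \<Rightarrow> complex) \<Rightarrow> bool" where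
  "theta_structure \<VV> \<QQ> \<Theta> \<E> \<mu> \<longleftrightarrow>
     omega_bundle \<VV> \<and> omega_bundle \<QQ> \<and>
     \<E> \<subseteq> \<Gamma> \<VV> \<and>
     (\<forall>B\<in>\<Theta>. \<forall>x. bounded_in (stalk_module \<VV> x) (stalk_top \<VV> x) (B x)) \<and>
     (\<forall>B\<in>\<Theta>. DD B \<E> \<noteq> {}) \<and>
     (\<forall>x. total_in (stalk_module \<VV> x) (stalk_top \<VV> x) (\<Union>B\<in>\<Theta>. BB \<E> B x)) \<and>
     (\<forall>x. stalk \<QQ> x \<subseteq>
        L1 (endo_module (stalk_module \<VV> x) (stalk_top \<VV> x))
           (unif_conv_topology (stalk_module \<VV> x) (stalk_top \<VV> x) (bsem \<VV> ` bidx \<VV>) (SS \<Theta> \<E> x)) \<mu>) \<and>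
     (\<forall>x. \<forall>F\<in>stalk \<QQ> x. \<forall>G\<in>stalk \<QQ> x.
        badd \<QQ> F G = (\<lambda>t. \<lambda>e\<in>stalk \<VV> x. badd \<VV> (F t e) (G t e))) \<and>
     (\<forall>x c. \<forall>F\<in>stalk \<QQ> x. bscale \<QQ> c F = (\<lambda>t. \<lambda>e\<in>stalk \<VV> x. bscale \<VV> c (F t e))) \<and>
     bidx \<QQ> = {Q. finite Q \<and> Q \<subseteq> UNIV \<times> bidx \<VV> \<times> \<Theta>} \<and>
     (\<forall>Q\<in>bidx \<QQ>. \<forall>x. \<forall>F\<in>stalk \<QQ> x.
        bsem \<QQ> Q F = Max (insert 0 ((\<lambda>(t, j, B). SUP v\<in>DD B \<E>. bsem \<VV> j (F t (v x))) ` Q)))"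

definition peq ::
  "('e, 'x, 'j) bundle_data \<Rightarrow> ('x \<Rightarrow> 'y \<Rightarrow> 'e \<Rightarrow> 'e) set \<Rightarrow> ('x \<Rightarrow> 'y \<Rightarrow> 'e \<Rightarrow> 'e) set" where
  "peq \<VV> A = {F \<in> A. \<forall>t. \<forall>j\<in>bidx \<VV>. \<exists>a>0. \<exists>j1\<in>bidx \<VV>.
     \<forall>z. \<forall>v\<in>stalk \<VV> z. bsem \<VV> j (F z t v) \<le> a * bsem \<VV> j1 v}"


section \<open>\<open>\<mu>\<close>-related bundles\<close>

definition star :: "('x \<Rightarrow> 'y \<Rightarrow> 'e \<Rightarrow> 'e) \<Rightarrow> ('x \<Rightarrow> 'e) \<Rightarrow> 'x \<Rightarrow> 'y \<Rightarrow> 'e" where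
  "star F v = (\<lambda>x s. F x s (v x))"

definition star_set (infixl \<open>\<bigstar>\<close> 75) where
  "A \<bigstar> W = {star F v | F v. F \<in> A \<and> v \<in> W}"

definition ui ::
  "('e, 'x, 'j) bundle_data \<Rightarrow> (('y::topological_space \<Rightarrow> complex) \<Rightarrow> complex) \<Rightarrow>
   ('x \<Rightarrow> 'y \<Rightarrow> 'e) set \<Rightarrow> ('x \<Rightarrow> 'y \<Rightarrow> 'e) set" where
  "ui \<VV> \<mu> A = {H \<in> A. \<forall>j\<in>bidx \<VV>.
     ess_upper_integral \<mu> (\<lambda>s. SUP x. ennreal (bsem \<VV> j (H x s))) < \<infinity>}"

definition I_mu ::
  "('e, 'x, 'j) bundle_data \<Rightarrow> (('y::topological_space \<Rightarrow> complex) \<Rightarrow> complex) \<Rightarrow>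
   ('x \<Rightarrow> 'y \<Rightarrow> 'e) \<Rightarrow> 'x \<Rightarrow> 'e" where
  "I_mu \<VV> \<mu> H = (\<lambda>x. weak_integral (stalk_module \<VV> x) (stalk_top \<VV> x) \<mu> (H x))"

definition mu_related ::
  "('e, 'x::topological_space, 'j) bundle_data \<Rightarrow>
   ('y::topological_space \<Rightarrow> 'e, 'x, ('y \<times> 'j) set) bundle_data \<Rightarrow>
   (('y \<Rightarrow> complex) \<Rightarrow> complex) \<Rightarrow> bool" where
  "mu_related \<VV> \<ZZ> \<mu> \<longleftrightarrow>
     omega_bundle \<VV> \<and> omega_bundle \<ZZ> \<and>
     (\<forall>x. stalk \<ZZ> x \<subseteq>
        Meas (stalk_top \<VV> x) \<mu> \<inter> L1 (stalk_module \<VV> x) (stalk_top \<VV> x) \<mu>) \<and>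
     (\<forall>x. \<forall>f\<in>stalk \<ZZ> x. \<forall>g\<in>stalk \<ZZ> x. badd \<ZZ> f g = (\<lambda>s. badd \<VV> (f s) (g s))) \<and>
     (\<forall>x c. \<forall>f\<in>stalk \<ZZ> x. bscale \<ZZ> c f = (\<lambda>s. bscale \<VV> c (f s))) \<and>
     bidx \<ZZ> = {Q. finite Q \<and> Q \<subseteq> UNIV \<times> bidx \<VV>} \<and>
     (\<forall>Q\<in>bidx \<ZZ>. \<forall>x. \<forall>f\<in>stalk \<ZZ> x.
        bsem \<ZZ> Q f = Max (insert 0 ((\<lambda>(s, j). bsem \<VV> j (f s)) ` Q))) \<and>
     \<Gamma> \<ZZ> \<subseteq> ui \<VV> \<mu> (bounded_sections \<ZZ> UNIV) \<and>
     I_mu \<VV> \<mu> ` \<Gamma> \<ZZ> \<subseteq> \<Gamma> \<VV>"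

definition mu_related3 ::
  "('e, 'x::topological_space, 'j) bundle_data \<Rightarrow>
   ('y::topological_space \<Rightarrow> 'e, 'x, ('y \<times> 'j) set) bundle_data \<Rightarrow>
   ('x \<Rightarrow> ('y \<Rightarrow> 'e \<Rightarrow> 'e) set) \<Rightarrow> (('y \<Rightarrow> complex) \<Rightarrow> complex) \<Rightarrow> bool" where
  "mu_related3 \<VV> \<ZZ> \<H> \<mu> \<longleftrightarrow>
     mu_related \<VV> \<ZZ> \<mu> \<and>
     (\<forall>x. \<forall>F\<in>\<H> x. \<forall>t. F t \<in> stalk_endos \<VV> x) \<and>
     Pi UNIV \<H> \<bigstar> Pi UNIV (stalk \<VV>) \<subseteq> Pi UNIV (stalk \<ZZ>)"


definition countable_nhds_basis :: "'x::topological_space \<Rightarrow> bool" where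
  "countable_nhds_basis x \<longleftrightarrow>
     (\<exists>\<N>. countable \<N> \<and> (\<forall>N\<in>\<N>. eventually (\<lambda>y. y \<in> N) (nhds x)) \<and>
          (\<forall>P. eventually P (nhds x) \<longrightarrow> (\<exists>N\<in>\<N>. \<forall>y\<in>N. P y)))"

end

theory Submission
  imports Defs
begin

text \<open>Choose \<open>F\<^sub>0 \<in> \<Gamma>(\<xi>)\<close> and \<open>w \<in> \<E>(\<Theta>)\<close> through \<open>F(x)\<close> and \<open>v(x)\<close>. Then \<open>G = I\<^sub>\<mu>(F\<^sub>0 \<bigstar> w)\<close> is a
  continuous section with \<open>G(x) = I\<^sub>\<mu>(F \<bigstar> v)(x)\<close>, so it suffices that \<open>\<nu>\<^sub>j(I\<^sub>\<mu>(F \<bigstar> v)(z) - G(z))\<close>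
  tends to \<open>0\<close> as \<open>z\<close> tends to \<open>x\<close>. By the Hahn-Banach theorem this is at most the essential upper integral of
  \<open>s \<mapsto> \<nu>\<^sub>j(F(z)(s) v(z) - F\<^sub>0(z)(s) w(z))\<close>. The integrand tends to \<open>0\<close> for each \<open>s\<close>, by pointwise
  equicontinuity of \<open>F\<close> (for \<open>v - w\<close>) and continuity of \<open>F\<close> and \<open>F\<^sub>0\<close> at \<open>x\<close> (for \<open>F - F\<^sub>0\<close>), and
  it is dominated by a function of finite essential upper integral. As \<open>x\<close> has a countable
  neighbourhood basis, dominated convergence for sequences applies.\<close>

section \<open>Compactly supported functions\<close>

text \<open>The obstacle is the majorant. It is a supremum of seminorms over all points of the base,
  possibly uncountably many, so it need not be measurable, and \<open>\<mu>\<close> need not be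
  sigma-finite. Dominated convergence is therefore proved for upper integrals: finiteness of the
  essential upper integral concentrates the majorant on one compact set up to a small error, and on
  that set it serves as the weight of an outer measure. For this, compact sets must split every
  upper integral additively and upper integrals must be countably subadditive; both are derived from
  the linear form \<open>\<mu>\<close>. The integrands are compared through
  \<open>F (v - w) + (F - F0) w\<close>. In the first term the vector varies with the stalk, and
  only equicontinuity controls \<open>F\<close> on it uniformly. In the second term \<open>w\<close>
  belongs to some \<open>DD B \<E>\<close>, and the seminorms on the stalks of \<QQ> are suprema
  over exactly such families.\<close>

lemma CcI:
  fixes f :: "'y::t2_space \<Rightarrow> 'b::real_normed_vector"
  assumes "continuous_on UNIV f" "compact K" "\<And>y. f y \<noteq> 0 \<Longrightarrow> y \<in> K"
  shows "f \<in> Cc"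
proof -
  have "closure {y. f y \<noteq> 0} \<subseteq> K"
    using assms by (intro closure_minimal compact_imp_closed) auto
  then have "compact (closure {y. f y \<noteq> 0})"
    using assms(2) by (metis closed_closure closed_Int_compact inf.absorb_iff1)
  with assms(1) show ?thesis by (simp add: Cc_def)
qed

lemma Cc_continuous: "f \<in> Cc \<Longrightarrow> continuous_on UNIV f"
  by (simp add: Cc_def)

lemma Cc_support:
  assumes "f \<in> Cc"
  obtains K where "compact K" "\<And>y. f y \<noteq> 0 \<Longrightarrow> y \<in> K"
  using assms closure_subset[of "{y. f y \<noteq> 0}"] by (auto simp: Cc_def)

text \<open>Common source of the closure properties below: the union of the two supports is compact
  and carries \<open>h\<close>. The three value types are independent, which covers norms and
  truncations as well.\<close>

lemma Cc_combine:
  fixes f :: "'y::t2_space \<Rightarrow> 'a::real_normed_vector" and g :: "'y \<Rightarrow> 'b::real_normed_vector"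
    and h :: "'y \<Rightarrow> 'c::real_normed_vector"
  assumes "f \<in> Cc" "g \<in> Cc" "continuous_on UNIV h"
    and "\<And>y. f y = 0 \<Longrightarrow> g y = 0 \<Longrightarrow> h y = 0"
  shows "h \<in> Cc"
proof -
  obtain K L where "compact K" "\<And>y. f y \<noteq> 0 \<Longrightarrow> y \<in> K" "compact L" "\<And>y. g y \<noteq> 0 \<Longrightarrow> y \<in> L"
    using assms(1,2) by (metis Cc_support)
  then show ?thesis
    using assms(3,4) by (intro CcI[of h "K \<union> L"]) auto
qed

lemma Cc_zero: "(\<lambda>y::'y::t2_space. 0 :: 'b::real_normed_vector) \<in> Cc"
  by (rule CcI[of _ "{}"]) auto

lemma Cc_add:
  fixes f g :: "'y::t2_space \<Rightarrow> 'b::real_normed_vector"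
  shows "f \<in> Cc \<Longrightarrow> g \<in> Cc \<Longrightarrow> (\<lambda>y. f y + g y) \<in> Cc"
  by (rule Cc_combine[of f g]) (auto intro!: continuous_intros dest: Cc_continuous)

lemma Cc_diff:
  fixes f g :: "'y::t2_space \<Rightarrow> 'b::real_normed_vector"
  shows "f \<in> Cc \<Longrightarrow> g \<in> Cc \<Longrightarrow> (\<lambda>y. f y - g y) \<in> Cc"
  by (rule Cc_combine[of f g]) (auto intro!: continuous_intros dest: Cc_continuous)

lemma Cc_max:
  fixes f g :: "'y::t2_space \<Rightarrow> real"
  shows "f \<in> Cc \<Longrightarrow> g \<in> Cc \<Longrightarrow> (\<lambda>y. max (f y) (g y)) \<in> Cc"
  by (rule Cc_combine[of f g]) (auto intro!: continuous_intros dest: Cc_continuous)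

lemma Cc_cmult:
  fixes f :: "'y::t2_space \<Rightarrow> 'b::real_normed_algebra"
  shows "f \<in> Cc \<Longrightarrow> (\<lambda>y. c * f y) \<in> Cc"
  by (rule Cc_combine[of f f]) (auto intro!: continuous_intros dest: Cc_continuous)

lemma Cc_norm:
  fixes f :: "'y::t2_space \<Rightarrow> 'b::real_normed_vector"
  shows "f \<in> Cc \<Longrightarrow> (\<lambda>y. norm (f y)) \<in> Cc"
  by (rule Cc_combine[of f f]) (auto intro!: continuous_intros dest: Cc_continuous)

lemma Cc_sum:
  fixes f :: "'i \<Rightarrow> 'y::t2_space \<Rightarrow> 'b::real_normed_vector"
  assumes "\<And>i. i \<in> I \<Longrightarrow> f i \<in> Cc"
  shows "(\<lambda>y. \<Sum>i\<in>I. f i y) \<in> Cc"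
  using assms by (induction I rule: infinite_finite_induct) (auto simp: Cc_zero Cc_add)

text \<open>Locally compact Hausdorff spaces are completely regular. The function separates
  \<open>y\<close> from the complement of \<open>W \<inter> U\<close>, where \<open>U\<close> lies
  in a compact set, so it vanishes off \<open>W\<close> and has compact support at once.\<close>

lemma Cc_bump:
  fixes y :: "'y::t2_space"
  assumes "locally_compact_space (euclidean :: 'y topology)" "open W" "y \<in> W"
  obtains f :: "'y \<Rightarrow> real"
  where "f \<in> Cc" "\<And>z. 0 \<le> f z" "\<And>z. f z \<le> 1" "f y = 1" "\<And>z. z \<notin> W \<Longrightarrow> f z = 0"
proof -
  obtain U K where U: "open U" "compact K" "y \<in> U" "U \<subseteq> K"
    using assms(1) unfolding locally_compact_space_def
    by (metis UNIV_I compactin_euclidean_iff open_openin topspace_euclidean)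
  have "completely_regular_space (euclidean :: 'y topology)"
    using assms(1) by (intro locally_compact_regular_imp_completely_regular_space disjI1) (simp_all add: Hausdorff_space_def disjnt_def separation_t2)
  moreover have "closedin euclidean (- (W \<inter> U))"
    using assms(2) U(1) by (simp only: closed_closedin[symmetric] closed_Compl open_Int)
  moreover have "y \<in> topspace euclidean - (- (W \<inter> U))"
    using assms(3) U(3) by auto
  ultimately obtain q :: "'y \<Rightarrow> real" where q: "continuous_map euclidean (top_of_set {0..1}) q" "q y = 0"
      "q ` (- (W \<inter> U)) \<subseteq> {1}"
    unfolding completely_regular_space_def by meson
  have cont: "continuous_on UNIV q" and rng: "\<And>z. q z \<in> {0..1}"
    using q(1) by (auto simp: continuous_map_in_subtopology image_subset_iff)
  show ?thesis
  proof (rule that[of "\<lambda>z. 1 - q z"])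
    show "(\<lambda>z. 1 - q z) \<in> Cc"
    proof (rule CcI[of _ K])
      show "y \<in> K" if "1 - q y \<noteq> 0" for y
        using that q(3) U(4) by (cases "y \<in> U") (auto simp: image_subset_iff)
    qed (use cont U in \<open>auto intro!: continuous_intros\<close>)
  qed (use q rng in \<open>auto simp: image_subset_iff\<close>)
qed

section \<open>The absolute value of a Radon measure\<close>

locale radon =
  fixes \<mu> :: "('y::t2_space \<Rightarrow> complex) \<Rightarrow> complex"
  assumes locally_compact: "locally_compact_space (euclidean :: 'y topology)"
    and radon_measure: "radon_measure \<mu>"
begin

lemma mu_add: "f \<in> Cc \<Longrightarrow> g \<in> Cc \<Longrightarrow> \<mu> (\<lambda>y. f y + g y) = \<mu> f + \<mu> g"
  using radon_measure by (simp add: radon_measure_def)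

lemma mu_cmult: "f \<in> Cc \<Longrightarrow> \<mu> (\<lambda>y. c * f y) = c * \<mu> f"
  using radon_measure by (simp add: radon_measure_def)

lemma mu_zero: "\<mu> (\<lambda>y. 0) = 0"
  using mu_cmult[OF Cc_zero, of 0] by simp

lemma mu_diff: "f \<in> Cc \<Longrightarrow> g \<in> Cc \<Longrightarrow> \<mu> (\<lambda>y. f y - g y) = \<mu> f - \<mu> g"
  using mu_add[of f "\<lambda>y. (-1) * g y"] mu_cmult[of g "-1"] Cc_cmult[of g "-1"] by simp

lemma rm_abs_ge:
  assumes "g \<in> Cc" "\<And>y. norm (g y) \<le> u y"
  shows "ennreal (norm (\<mu> g)) \<le> rm_abs \<mu> u"
  unfolding rm_abs_def using assms by (intro SUP_upper) auto

lemma rm_abs_mono: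
  assumes "\<And>y. u y \<le> v y"
  shows "rm_abs \<mu> u \<le> rm_abs \<mu> v"
  unfolding rm_abs_def using assms by (intro SUP_subset_mono) (auto intro: order_trans)

lemma rm_abs_zero: "rm_abs \<mu> (\<lambda>y. 0) = 0"
proof -
  have "{g::'y \<Rightarrow> complex. g \<in> Cc \<and> (\<forall>y. norm (g y) \<le> 0)} = {\<lambda>y. 0}"
    using Cc_zero by auto
  then show ?thesis by (simp add: rm_abs_def mu_zero)
qed

lemma rm_abs_bounded:
  assumes "compact K"
  obtains M where "0 \<le> M"
    "\<And>u C. 0 \<le> C \<Longrightarrow> (\<And>y. u y \<le> C) \<Longrightarrow> (\<And>y. y \<notin> K \<Longrightarrow> u y \<le> 0) \<Longrightarrow> rm_abs \<mu> u \<le> ennreal (M * C)"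
proof -
  obtain M where M: "\<And>f. f \<in> Cc \<Longrightarrow> closure {y. f y \<noteq> 0} \<subseteq> K \<Longrightarrow> norm (\<mu> f) \<le> M * (SUP y. norm (f y))"
    using conjunct2[OF conjunct2[OF radon_measure[unfolded radon_measure_def]]] assms by meson
  \<comment> \<open>The constant \<open>M\<close> may be negative, for instance when only the zero
    function is supported in \<open>K\<close>; \<open>max M 0\<close> makes the bound monotone in
    the supremum.\<close>
  show ?thesis
  proof (rule that[of "max M 0"])
    fix u :: "'y \<Rightarrow> real" and C :: real
    assume C: "0 \<le> C" "\<And>y. u y \<le> C" "\<And>y. y \<notin> K \<Longrightarrow> u y \<le> 0"
    show "rm_abs \<mu> u \<le> ennreal (max M 0 * C)"
      unfolding rm_abs_def
    proof (rule SUP_least, clarify)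
      fix g :: "'y \<Rightarrow> complex" assume g: "g \<in> Cc" "\<forall>y. norm (g y) \<le> u y"
      have "closure {y. g y \<noteq> 0} \<subseteq> K"
      proof (rule closure_minimal)
        show "{y. g y \<noteq> 0} \<subseteq> K"
          using g(2) C(3) by (metis (mono_tags, lifting) mem_Collect_eq norm_le_zero_iff order_trans subsetI)
        show "closed K" using assms by (rule compact_imp_closed)
      qed
      then have "norm (\<mu> g) \<le> M * (SUP y. norm (g y))" using M g(1) by blast
      also have "\<dots> \<le> max M 0 * (SUP y. norm (g y))"
      proof (rule mult_right_mono)
        have "norm (g undefined) \<le> (SUP y. norm (g y))"
          using g(2) C(2) by (intro cSUP_upper bdd_aboveI2[of _ _ C]) (auto intro: order_trans)
        then show "0 \<le> (SUP y. norm (g y))" by (meson norm_ge_zero order_trans)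
      qed simp
      also have "\<dots> \<le> max M 0 * C"
        using g(2) C(2) by (intro mult_left_mono cSUP_least) (auto intro: order_trans)
      finally show "ennreal (norm (\<mu> g)) \<le> ennreal (max M 0 * C)" by (rule ennreal_leI)
    qed
  qed simp
qed

text \<open>Scalars \<open>a\<close> and \<open>b\<close> rotate \<open>\<mu> f\<close> and
  \<open>\<mu> g\<close> onto the nonnegative reals, so that the norms add instead of cancelling,
  while \<open>a * f + b * g\<close> is still dominated by \<open>u + v\<close>.\<close>

lemma rm_abs_superadditive:
  assumes "\<And>y. 0 \<le> u y" "\<And>y. 0 \<le> v y"
  shows "rm_abs \<mu> u + rm_abs \<mu> v \<le> rm_abs \<mu> (\<lambda>y. u y + v y)"
proof -
  let ?S = "\<lambda>u. {g::'y \<Rightarrow> complex. g \<in> Cc \<and> (\<forall>y. norm (g y) \<le> u y)}"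
  have ne: "?S u \<noteq> {}" "?S v \<noteq> {}" using assms Cc_zero by auto
  have "rm_abs \<mu> u + rm_abs \<mu> v
      = (SUP f\<in>?S u. SUP g\<in>?S v. ennreal (norm (\<mu> f)) + ennreal (norm (\<mu> g)))"
    unfolding rm_abs_def
    by (subst ennreal_SUP_add_left[OF ne(1), symmetric], subst ennreal_SUP_add_right[OF ne(2)]) (rule refl)
  also have "\<dots> \<le> rm_abs \<mu> (\<lambda>y. u y + v y)"
  proof (intro SUP_least, clarify)
    fix f g :: "'y \<Rightarrow> complex"
    assume f: "f \<in> Cc" "\<forall>y. norm (f y) \<le> u y" and g: "g \<in> Cc" "\<forall>y. norm (g y) \<le> v y"
    \<comment> \<open>The bound is \<open>norm c \<le> 1\<close> rather than equality because
      \<open>z = 0\<close> is served by \<open>c = 0\<close>.\<close>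
    have unit: "\<exists>c. norm c \<le> 1 \<and> c * z = complex_of_real (norm z)" for z :: complex
    proof (cases "z = 0")
      case False
      then show ?thesis
        by (intro exI[of _ "cnj z / norm z"])
           (auto simp: norm_divide complex_norm_square[symmetric] power2_eq_square mult.commute)
    qed (auto intro: exI[of _ 0])
    obtain a b where a: "norm a \<le> 1" "a * \<mu> f = complex_of_real (norm (\<mu> f))"
      and b: "norm b \<le> 1" "b * \<mu> g = complex_of_real (norm (\<mu> g))"
      using unit by metis
    have Cc: "(\<lambda>y. a * f y) \<in> Cc" "(\<lambda>y. b * g y) \<in> Cc" using f g by (auto intro: Cc_cmult)
    have eq: "\<mu> (\<lambda>y. a * f y + b * g y) = complex_of_real (norm (\<mu> f) + norm (\<mu> g))"
      using mu_add[OF Cc] f g a b by (simp add: mu_cmult)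
    have "norm (\<mu> (\<lambda>y. a * f y + b * g y)) = norm (\<mu> f) + norm (\<mu> g)"
      unfolding eq norm_of_real by simp
    moreover have "ennreal (norm (\<mu> (\<lambda>y. a * f y + b * g y))) \<le> rm_abs \<mu> (\<lambda>y. u y + v y)"
    proof (intro rm_abs_ge Cc_add Cc)
      fix y
      have "norm (a * f y + b * g y) \<le> norm a * norm (f y) + norm b * norm (g y)"
        by (metis norm_mult norm_triangle_ineq)
      also have "\<dots> \<le> 1 * norm (f y) + 1 * norm (g y)"
        using a b by (intro add_mono mult_right_mono) auto
      also have "\<dots> \<le> u y + v y" using f g by (simp add: add_mono)
      finally show "norm (a * f y + b * g y) \<le> u y + v y" .
    qed
    ultimately show "ennreal (norm (\<mu> f)) + ennreal (norm (\<mu> g)) \<le> rm_abs \<mu> (\<lambda>y. u y + v y)"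
      by (simp flip: ennreal_plus)
  qed
  finally show ?thesis .
qed

text \<open>Riesz decomposition: a function dominated by \<open>u + v\<close> is cut in the
  proportion of \<open>u\<close> to \<open>v\<close> into one part dominated by \<open>u\<close> and
  one dominated by \<open>v\<close>.\<close>

lemma rm_abs_subadditive:
  assumes "u \<in> Cc" "v \<in> Cc" and u0: "\<And>y. 0 \<le> u y" and v0: "\<And>y. 0 \<le> v y"
  shows "rm_abs \<mu> (\<lambda>y. u y + v y) \<le> rm_abs \<mu> u + rm_abs \<mu> v"
  unfolding rm_abs_def[of \<mu> "\<lambda>y. u y + v y"]
proof (rule SUP_least, clarify)
  fix g :: "'y \<Rightarrow> complex" assume g: "g \<in> Cc" "\<forall>y. norm (g y) \<le> u y + v y"
  \<comment> \<open>Division by zero yields 0, so \<open>h\<close> vanishes where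
    \<open>u + v\<close> does.\<close>
  define h where "h y = g y * of_real (u y / (u y + v y))" for y
  have h_le: "norm (h y) \<le> u y" for y
  proof (cases "u y + v y = 0")
    case False
    then have "norm (h y) = norm (g y) * (u y / (u y + v y))"
      using u0 v0 by (simp add: h_def norm_mult norm_divide del: of_real_divide of_real_add)
    also have "\<dots> \<le> (u y + v y) * (u y / (u y + v y))"
      using g(2) u0 v0 by (intro mult_right_mono) auto
    finally show ?thesis using False by simp
  qed (use u0 in \<open>simp add: h_def del: of_real_add\<close>)
  have gh_le: "norm (g y - h y) \<le> v y" for y
  proof (cases "u y + v y = 0")
    case True
    then have "g y = 0" using g(2) by (metis norm_le_zero_iff)
    then show ?thesis using v0 by (simp add: h_def)
  next
    case False
    then have "u y / (u y + v y) = 1 - v y / (u y + v y)"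
      by (simp add: field_simps)
    then have "g y - h y = g y * of_real (v y / (u y + v y))"
      unfolding h_def by (simp add: right_diff_distrib del: of_real_divide of_real_add)
    then have "norm (g y - h y) = norm (g y) * (v y / (u y + v y))"
      using u0 v0 by (simp add: norm_mult norm_divide del: of_real_divide of_real_add)
    also have "\<dots> \<le> (u y + v y) * (v y / (u y + v y))"
      using g(2) u0 v0 by (intro mult_right_mono) auto
    finally show ?thesis using False by simp
  qed
  have isC: "isCont u y" "isCont v y" "isCont g y" for y
    using assms(1,2) g(1) by (auto dest!: Cc_continuous simp: continuous_on_eq_continuous_at)
  \<comment> \<open>The quotient has no limit in general at a zero of \<open>u + v\<close>; there
    continuity comes from \<open>norm (h y) \<le> u y\<close>, because \<open>u\<close> tends to
    0.\<close>
  have "isCont h y" for y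
  proof (cases "u y + v y = 0")
    case True
    then have "u y = 0" using u0[of y] v0[of y] by linarith
    then have u_lim: "u \<midarrow>y\<rightarrow> 0" using isC(1)[of y] by (simp add: isCont_def)
    have "h \<midarrow>y\<rightarrow> 0"
      by (rule Lim_null_comparison[OF _ u_lim]) (simp add: h_le)
    then show ?thesis using True by (simp add: isCont_def h_def del: of_real_add)
  next
    case False
    then show ?thesis unfolding h_def[abs_def] using isC by (intro continuous_intros) auto
  qed
  then have h: "h \<in> Cc"
    by (intro Cc_combine[OF g(1) g(1)]) (simp_all add: continuous_on_eq_continuous_at, simp add: h_def)
  have "ennreal (norm (\<mu> g)) = ennreal (norm (\<mu> h + \<mu> (\<lambda>y. g y - h y)))"
    using mu_diff[OF g(1) h] by simp
  also have "\<dots> \<le> ennreal (norm (\<mu> h)) + ennreal (norm (\<mu> (\<lambda>y. g y - h y)))"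
    by (simp flip: ennreal_plus add: norm_triangle_ineq)
  also have "\<dots> \<le> rm_abs \<mu> u + rm_abs \<mu> v"
    using h g h_le gh_le by (intro add_mono rm_abs_ge Cc_diff) auto
  finally show "ennreal (norm (\<mu> g)) \<le> rm_abs \<mu> u + rm_abs \<mu> v" .
qed

lemma rm_abs_sum:
  assumes "finite I" "\<And>i. i \<in> I \<Longrightarrow> u i \<in> Cc" "\<And>i y. i \<in> I \<Longrightarrow> 0 \<le> u i y"
  shows "rm_abs \<mu> (\<lambda>y. \<Sum>i\<in>I. u i y) \<le> (\<Sum>i\<in>I. rm_abs \<mu> (u i))"
  using assms
proof (induction I rule: finite_induct)
  case (insert i I)
  have "rm_abs \<mu> (\<lambda>y. u i y + (\<Sum>i\<in>I. u i y)) \<le> rm_abs \<mu> (u i) + rm_abs \<mu> (\<lambda>y. \<Sum>i\<in>I. u i y)"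
    using insert by (intro rm_abs_subadditive Cc_sum sum_nonneg) auto
  also have "\<dots> \<le> rm_abs \<mu> (u i) + (\<Sum>i\<in>I. rm_abs \<mu> (u i))"
    using insert by (intro add_left_mono) auto
  finally show ?case using insert by simp
qed (simp add: rm_abs_zero)

section \<open>Upper integrals\<close>

text \<open>For \<open>a < h y\<close> the set where \<open>h\<close> exceeds \<open>a\<close> is an
  open neighbourhood of \<open>y\<close>, and \<open>a\<close> times a bump function inside it stays
  below \<open>h\<close>. A sequence is needed because \<open>h y\<close> may be infinite or not
  attained.\<close>

lemma lower_semicont_minorants:
  assumes "lower_semicont h"
  obtains f :: "nat \<Rightarrow> 'y \<Rightarrow> real" where "\<And>k. f k \<in> Cc" "\<And>k z. 0 \<le> f k z"
    "\<And>k z. ennreal (f k z) \<le> h z" "(\<lambda>k. ennreal (f k y)) \<longlonglongrightarrow> h y"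
proof (cases "h y = 0")
  case True
  then show ?thesis using Cc_zero by (intro that[of "\<lambda>k z. 0"]) auto
next
  case False
  then have "0 < h y" by (simp add: zero_less_iff_neq_zero)
  then obtain a where a: "\<And>k. a k < h y" "a \<longlonglongrightarrow> h y"
    using approx_from_below_dense_linorder by blast
  have "\<exists>f::'y \<Rightarrow> real. f \<in> Cc \<and> (\<forall>z. 0 \<le> f z) \<and> (\<forall>z. ennreal (f z) \<le> h z) \<and> ennreal (f y) = a k" for k
  proof -
    have "a k < \<infinity>" using a(1)[of k] by (rule less_le_trans) simp
    then obtain r where r: "0 \<le> r" "a k = ennreal r" by (cases "a k") auto
    have "open {z. a k < h z}" using assms by (simp add: lower_semicont_def)
    then obtain f where f: "f \<in> Cc" "\<And>z. 0 \<le> f z" "\<And>z. f z \<le> (1::real)" "f y = 1"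
        "\<And>z. \<not> a k < h z \<Longrightarrow> f z = 0"
      using Cc_bump[OF locally_compact, of "{z. a k < h z}" y] a(1) by auto
    have "ennreal (r * f z) \<le> h z" for z
    proof (cases "a k < h z")
      case True
      have "r * f z \<le> r" using f(3)[of z] r(1) by (simp add: mult_left_le)
      then show ?thesis using True r(2) by (metis ennreal_leI order_trans less_imp_le)
    qed (simp add: f(5))
    then show ?thesis using f r by (intro exI[of _ "\<lambda>z. r * f z"]) (auto intro: Cc_cmult)
  qed
  then obtain f where "\<And>k. f k \<in> Cc" "\<And>k z. 0 \<le> f k z" "\<And>k z. ennreal (f k z) \<le> h z"
     "\<And>k. ennreal (f k y) = a k" by metis
  then show ?thesis using a(2) by (intro that[of f]) auto
qed

text \<open>A finite partial sum already exceeds \<open>a\<close>. Its finitely many terms converge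
  simultaneously, so one index \<open>k\<close> serves all of them.\<close>

lemma lower_semicont_suminf_minorant:
  assumes "\<And>n. lower_semicont (h n)" "a < (\<Sum>n. h n y)"
  obtains N and f :: "nat \<Rightarrow> 'y \<Rightarrow> real" where "\<And>n. f n \<in> Cc" "\<And>n z. 0 \<le> f n z"
    "\<And>n z. ennreal (f n z) \<le> h n z" "a < ennreal (\<Sum>n<N. f n y)"
proof -
  obtain N where N: "a < (\<Sum>n<N. h n y)"
    using assms(2) by (auto simp: suminf_eq_SUP less_SUP_iff)
  have "\<forall>n. \<exists>f :: nat \<Rightarrow> 'y \<Rightarrow> real. (\<forall>k. f k \<in> Cc) \<and> (\<forall>k z. 0 \<le> f k z) \<and>
    (\<forall>k z. ennreal (f k z) \<le> h n z) \<and> (\<lambda>k. ennreal (f k y)) \<longlonglongrightarrow> h n y"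
    using lower_semicont_minorants[OF assms(1)] by metis
  then obtain f :: "nat \<Rightarrow> nat \<Rightarrow> 'y \<Rightarrow> real" where f: "\<And>n k. f n k \<in> Cc" "\<And>n k z. 0 \<le> f n k z"
    "\<And>n k z. ennreal (f n k z) \<le> h n z" "\<And>n. (\<lambda>k. ennreal (f n k y)) \<longlonglongrightarrow> h n y"
    by metis
  have "(\<lambda>k. \<Sum>n<N. ennreal (f n k y)) \<longlonglongrightarrow> (\<Sum>n<N. h n y)"
    by (intro tendsto_sum f)
  then have "eventually (\<lambda>k. a < (\<Sum>n<N. ennreal (f n k y))) sequentially"
    using N by (rule order_tendstoD)
  then obtain k where "a < (\<Sum>n<N. ennreal (f n k y))"
    by (auto simp: eventually_sequentially)
  then show ?thesis using f by (intro that[of "\<lambda>n. f n k" N]) (auto simp: sum_ennreal)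
qed

lemma lower_semicont_suminf:
  assumes "\<And>n. lower_semicont (h n :: 'y \<Rightarrow> ennreal)"
  shows "lower_semicont (\<lambda>y. \<Sum>n. h n y)"
  unfolding lower_semicont_def
proof (intro allI, subst open_subopen, clarify)
  fix a y assume "a < (\<Sum>n. h n y)"
  from lower_semicont_suminf_minorant[where h = h, OF assms this]
  obtain N and f :: "nat \<Rightarrow> 'y \<Rightarrow> real" where f: "\<And>n. f n \<in> Cc" "\<And>n z. 0 \<le> f n z"
    "\<And>n z. ennreal (f n z) \<le> h n z" "a < ennreal (\<Sum>n<N. f n y)"
    by metis
  have "continuous_on UNIV (\<lambda>z. ennreal (\<Sum>n<N. f n z))"
    using f(1) by (intro continuous_on_ennreal continuous_on_sum Cc_continuous)
  then have "open {z. a < ennreal (\<Sum>n<N. f n z)}"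
    by (intro open_Collect_less continuous_on_const)
  moreover have "a < (\<Sum>n. h n z)" if "a < ennreal (\<Sum>n<N. f n z)" for z
  proof -
    have "ennreal (\<Sum>n<N. f n z) = (\<Sum>n<N. ennreal (f n z))" using f(2) by (simp add: sum_ennreal)
    also have "\<dots> \<le> (\<Sum>n<N. h n z)" by (intro sum_mono f(3))
    also have "\<dots> \<le> (\<Sum>n. h n z)" by (intro sum_le_suminf) auto
    finally show ?thesis using that by simp
  qed
  ultimately show "\<exists>T. open T \<and> y \<in> T \<and> T \<subseteq> {y. a < (\<Sum>n. h n y)}"
    using f(4) by (intro exI[of _ "{z. a < ennreal (\<Sum>n<N. f n z)}"]) auto
qed

lemma lsc_integral_ge:
  assumes "u \<in> Cc" "\<And>y. 0 \<le> u y" "\<And>y. ennreal (u y) \<le> h y"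
  shows "rm_abs \<mu> u \<le> lsc_integral \<mu> h"
  unfolding lsc_integral_def using assms by (intro SUP_upper) auto

lemma lsc_integral_Cc: "lsc_integral \<mu> (\<lambda>y. ennreal (u y)) \<le> rm_abs \<mu> u" if "\<And>y. 0 \<le> u y"
  unfolding lsc_integral_def using that by (intro SUP_least rm_abs_mono) auto

text \<open>A Dini argument. On the compact set where \<open>u \<ge> e\<close>, finitely many
  partial sums of continuous minorants cover \<open>u - e\<close>; what remains of \<open>u\<close>
  is at most \<open>e\<close> and lives on the support of \<open>u\<close>, so it costs at most
  \<open>M * e\<close>.\<close>

lemma lsc_integral_suminf:
  assumes lsc: "\<And>n. lower_semicont (h n)"
  shows "lsc_integral \<mu> (\<lambda>y. \<Sum>n. h n y) \<le> (\<Sum>n. lsc_integral \<mu> (h n))"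
  unfolding lsc_integral_def[of \<mu> "\<lambda>y. \<Sum>n. h n y"]
proof (rule SUP_least, clarify)
  fix u :: "'y \<Rightarrow> real" assume u: "u \<in> Cc" "\<forall>y. 0 \<le> u y \<and> ennreal (u y) \<le> (\<Sum>n. h n y)"
  obtain L where L: "compact L" "\<And>y. u y \<noteq> 0 \<Longrightarrow> y \<in> L" using Cc_support[OF u(1)] by blast
  obtain M where M: "0 \<le> M" "\<And>u C. 0 \<le> C \<Longrightarrow> (\<And>y. u y \<le> C) \<Longrightarrow> (\<And>y. y \<notin> L \<Longrightarrow> u y \<le> 0)
      \<Longrightarrow> rm_abs \<mu> u \<le> ennreal (M * C)"
    using rm_abs_bounded[OF L(1)] by blast
  have u_cont: "continuous_on UNIV u" using u(1) by (rule Cc_continuous)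
  have approx: "rm_abs \<mu> u \<le> (\<Sum>n. lsc_integral \<mu> (h n)) + ennreal (M * e)" if e: "0 < e" for e
  proof -
    let ?K = "{y. e \<le> u y}"
    have "closed ?K" by (intro closed_Collect_le continuous_on_const u_cont)
    moreover have "?K \<subseteq> L" using L(2) e by fastforce
    ultimately have "compact ?K" using L(1) by (metis closed_Int_compact inf.absorb_iff1)
    have "\<exists>N f. (\<forall>n. f n \<in> Cc \<and> (\<forall>z. 0 \<le> f n z \<and> ennreal (f n z) \<le> h n z)) \<and>
       u y - e < (\<Sum>n<N. f n y)" if "y \<in> ?K" for y
    proof -
      have "ennreal (u y - e) < ennreal (u y)"
        using that e by (intro ennreal_lessI) auto
      also have "\<dots> \<le> (\<Sum>n. h n y)" using u(2) by auto
      finally have less: "ennreal (u y - e) < (\<Sum>n. h n y)" .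
      from lower_semicont_suminf_minorant[where h = h, OF lsc less]
      obtain N and f :: "nat \<Rightarrow> 'y \<Rightarrow> real" where f: "\<And>n. f n \<in> Cc" "\<And>n z. 0 \<le> f n z"
        "\<And>n z. ennreal (f n z) \<le> h n z" "ennreal (u y - e) < ennreal (\<Sum>n<N. f n y)"
        by metis
      have "u y - e < (\<Sum>n<N. f n y)"
        using f(4) that by (subst (asm) ennreal_less_iff) auto
      with f show ?thesis by blast
    qed
    then obtain N f where Nf': "\<And>y. y \<in> ?K \<Longrightarrow> (\<forall>n. f y n \<in> Cc \<and> (\<forall>z. 0 \<le> f y n z \<and> ennreal (f y n z) \<le> h n z)) \<and>
       u y - e < (\<Sum>n<N y. f y n y)"
      by metis
    then have Nf: "\<And>y n. y \<in> ?K \<Longrightarrow> f y n \<in> Cc"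
      "\<And>y n z. y \<in> ?K \<Longrightarrow> 0 \<le> f y n z"
      "\<And>y n z. y \<in> ?K \<Longrightarrow> ennreal (f y n z) \<le> h n z"
      "\<And>y. y \<in> ?K \<Longrightarrow> u y - e < (\<Sum>n<N y. f y n y)"
      by blast+
    have op: "open {z. u z - e < (\<Sum>n<N y. f y n z)}" if "y \<in> ?K" for y
      using that Nf(1) u_cont by (intro open_Collect_less continuous_on_diff continuous_on_const continuous_on_sum) (auto intro: Cc_continuous)
    have cover: "?K \<subseteq> (\<Union>y\<in>?K. {z. u z - e < (\<Sum>n<N y. f y n z)})"
      using Nf(4) by auto
    obtain F where F: "F \<subseteq> ?K" "finite F" "?K \<subseteq> (\<Union>y\<in>F. {z. u z - e < (\<Sum>n<N y. f y n z)})"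
      by (rule compactE_image[OF \<open>compact ?K\<close> op cover])
    \<comment> \<open>The inserted 0 covers an empty cover \<open>F\<close>.\<close>
    define P where "P = Max (insert 0 (N ` F))"
    have P: "N y \<le> P" if "y \<in> F" for y
      unfolding P_def using F(2) that by (intro Max_ge) auto
    \<comment> \<open>For each \<open>n\<close> the minorants belonging to the different centres are
      merged by a maximum, which stays below \<open>h n\<close>; their sum would not.\<close>
    have "\<exists>w. w \<in> Cc \<and> (\<forall>z. 0 \<le> w z \<and> ennreal (w z) \<le> h n z \<and> (\<forall>y\<in>F. f y n z \<le> w z))" for n
      using F(2,1)
    proof (induction F rule: finite_induct)
      case empty
      then show ?case using Cc_zero by (intro exI[of _ "\<lambda>z. 0"]) auto
    next
      case (insert y F)
      then obtain w where w: "w \<in> Cc" "\<forall>z. 0 \<le> w z \<and> ennreal (w z) \<le> h n z \<and> (\<forall>y\<in>F. f y n z \<le> w z)"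
        by blast
      have y: "y \<in> ?K" using insert.prems by auto
      have "ennreal (max (f y n z) (w z)) \<le> h n z" for z
        using w(2) Nf(3)[OF y] by (cases "f y n z \<le> w z") (auto simp: max_def)
      moreover have "(\<lambda>z. max (f y n z) (w z)) \<in> Cc" using Nf(1)[OF y] w(1) by (rule Cc_max)
      ultimately show ?case using w(2)
        by (intro exI[of _ "\<lambda>z. max (f y n z) (w z)"]) (auto simp: le_max_iff_disj)
    qed
    then obtain w where w: "\<And>n. w n \<in> Cc" "\<And>n z. 0 \<le> w n z" "\<And>n z. ennreal (w n z) \<le> h n z"
       "\<And>n z y. y \<in> F \<Longrightarrow> f y n z \<le> w n z" by metis
    have le: "max (u z - e) 0 \<le> (\<Sum>n<P. w n z)" for z
    proof (cases "z \<in> ?K")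
      case True
      then obtain y where y: "y \<in> F" "u z - e < (\<Sum>n<N y. f y n z)" using F(3) by auto
      have "(\<Sum>n<N y. f y n z) \<le> (\<Sum>n<N y. w n z)" using w(4)[OF y(1)] by (intro sum_mono)
      also have "\<dots> \<le> (\<Sum>n<P. w n z)" using w(2) P[OF y(1)] by (intro sum_mono2) auto
      finally show ?thesis using y(2) sum_nonneg[of "{..<P}" "\<lambda>n. w n z"] w(2) by auto
    qed (use w(2) in \<open>auto intro!: sum_nonneg\<close>)
    have Cc1: "(\<lambda>z. max (u z - e) 0) \<in> Cc"
      using u_cont e by (intro Cc_combine[OF u(1) u(1)]) (auto intro!: continuous_intros)
    have Cc2: "(\<lambda>z. min (u z) e) \<in> Cc"
      using u_cont e by (intro Cc_combine[OF u(1) u(1)]) (auto intro!: continuous_intros)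
    \<comment> \<open>Cutting \<open>u\<close> at height \<open>e\<close>: the upper part is
      controlled by the cover, the lower part by continuity of \<open>\<mu>\<close> on functions
      supported in \<open>L\<close>.\<close>
    have "u = (\<lambda>z. max (u z - e) 0 + min (u z) e)" by (auto simp: max_def min_def)
    then have "rm_abs \<mu> u = rm_abs \<mu> (\<lambda>z. max (u z - e) 0 + min (u z) e)" by simp
    also have "\<dots> \<le> rm_abs \<mu> (\<lambda>z. max (u z - e) 0) + rm_abs \<mu> (\<lambda>z. min (u z) e)"
      using u(2) e by (intro rm_abs_subadditive Cc1 Cc2) auto
    also have "\<dots> \<le> (\<Sum>n. lsc_integral \<mu> (h n)) + ennreal (M * e)"
    proof (rule add_mono)
      have "rm_abs \<mu> (\<lambda>z. max (u z - e) 0) \<le> rm_abs \<mu> (\<lambda>z. \<Sum>n<P. w n z)"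
        by (rule rm_abs_mono) (rule le)
      also have "\<dots> \<le> (\<Sum>n<P. rm_abs \<mu> (w n))" using w by (intro rm_abs_sum) auto
      also have "\<dots> \<le> (\<Sum>n<P. lsc_integral \<mu> (h n))" using w by (intro sum_mono lsc_integral_ge)
      also have "\<dots> \<le> (\<Sum>n. lsc_integral \<mu> (h n))" by (intro sum_le_suminf) auto
      finally show "rm_abs \<mu> (\<lambda>z. max (u z - e) 0) \<le> (\<Sum>n. lsc_integral \<mu> (h n))" .
      show "rm_abs \<mu> (\<lambda>z. min (u z) e) \<le> ennreal (M * e)"
      proof (rule M(2))
        show "min (u y) e \<le> 0" if "y \<notin> L" for y using L(2)[of y] that by (cases "u y = 0") auto
      qed (use e in auto)
    qed
    finally show ?thesis .
  qed
  show "rm_abs \<mu> u \<le> (\<Sum>n. lsc_integral \<mu> (h n))"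
  proof (rule ennreal_le_epsilon)
    fix e :: real assume "0 < e"
    \<comment> \<open>Dividing by \<open>M + 1\<close> instead of \<open>M\<close> allows
      \<open>M = 0\<close>.\<close>
    have "M * (e / (M + 1)) \<le> e" using \<open>0 < e\<close> M(1) by (simp add: field_simps)
    then show "rm_abs \<mu> u \<le> (\<Sum>n. lsc_integral \<mu> (h n)) + ennreal e"
      using approx[of "e / (M + 1)"] \<open>0 < e\<close> M(1) add_left_mono[OF ennreal_leI]
      by (force intro: order_trans)
  qed
qed

section \<open>Countable subadditivity of the upper integral of arbitrary functions\<close>

lemma upper_integral_le:
  assumes "lower_semicont h" "\<And>y. f y \<le> h y"
  shows "upper_integral \<mu> f \<le> lsc_integral \<mu> h"
  unfolding upper_integral_def using assms by (intro INF_lower) auto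

lemma upper_integral_mono:
  assumes "\<And>y. f y \<le> g y"
  shows "upper_integral \<mu> f \<le> upper_integral \<mu> g"
  unfolding upper_integral_def using assms by (intro INF_superset_mono) (auto intro: order_trans)

lemma lower_semicont_Cc: "lower_semicont (\<lambda>y::'y. ennreal (u y))" if "u \<in> Cc"
  unfolding lower_semicont_def using that
  by (intro allI open_Collect_less continuous_on_const continuous_on_ennreal Cc_continuous)

lemma upper_integral_Cc_le:
  assumes "u \<in> Cc" "\<And>y. 0 \<le> u y" "\<And>y. f y \<le> ennreal (u y)"
  shows "upper_integral \<mu> f \<le> rm_abs \<mu> u"
  using upper_integral_le[OF lower_semicont_Cc[OF assms(1)]] lsc_integral_Cc[of u] assms(2,3)
  by (meson order_trans)

lemma upper_integral_Cc_ge: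
  assumes "u \<in> Cc" "\<And>y. 0 \<le> u y" "\<And>y. ennreal (u y) \<le> f y"
  shows "rm_abs \<mu> u \<le> upper_integral \<mu> f"
  unfolding upper_integral_def using assms
  by (intro INF_greatest lsc_integral_ge) (auto intro: order_trans)

lemma upper_integral_zero: "upper_integral \<mu> (\<lambda>y. 0) = 0"
  using upper_integral_Cc_le[OF Cc_zero, of "\<lambda>y. 0"] by (simp add: rm_abs_zero)

text \<open>The terms get nearly optimal lower semicontinuous majorants with errors adding up to
  \<open>e\<close>; the sum of these majorants is lower semicontinuous, hence admissible for the
  series.\<close>

lemma upper_integral_suminf:
  "upper_integral \<mu> (\<lambda>y. \<Sum>n. f n y) \<le> (\<Sum>n. upper_integral \<mu> (f n))"
proof (rule ennreal_le_epsilon)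
  fix e :: real
  assume fin: "(\<Sum>n. upper_integral \<mu> (f n)) < top_class.top" and e: "0 < e"
  have "\<exists>h. lower_semicont h \<and> (\<forall>y. f n y \<le> h y) \<and>
      lsc_integral \<mu> h \<le> upper_integral \<mu> (f n) + ennreal (e * (1/2) ^ Suc n)" for n
  proof -
    have "upper_integral \<mu> (f n) \<noteq> \<infinity>"
      using ennreal_suminf_lessD[OF fin, of n] by auto
    then obtain h where "h \<in> {h. lower_semicont h \<and> (\<forall>y. f n y \<le> h y)}"
      "lsc_integral \<mu> h < upper_integral \<mu> (f n) + ennreal (e * (1/2) ^ Suc n)"
      using INF_approx_ennreal[OF _ upper_integral_def, of "e * (1/2) ^ Suc n" \<mu> "f n"] e by auto
    then show ?thesis by (auto intro: less_imp_le)
  qed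
  then obtain h where h: "\<And>n. lower_semicont (h n)" "\<And>n y. f n y \<le> h n y"
    "\<And>n. lsc_integral \<mu> (h n) \<le> upper_integral \<mu> (f n) + ennreal (e * (1/2) ^ Suc n)"
    by metis
  have "(\<lambda>n. e * (1/2) ^ Suc n) sums (e * 1)"
    by (intro sums_mult power_half_series)
  then have geo: "(\<Sum>n. ennreal (e * (1/2) ^ Suc n)) = ennreal e"
    using e by (intro sums_unique[symmetric]) simp
  have "upper_integral \<mu> (\<lambda>y. \<Sum>n. f n y) \<le> lsc_integral \<mu> (\<lambda>y. \<Sum>n. h n y)"
    using h(1,2) by (intro upper_integral_le lower_semicont_suminf suminf_le) auto
  also have "\<dots> \<le> (\<Sum>n. lsc_integral \<mu> (h n))"
    using h(1) by (rule lsc_integral_suminf)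
  also have "\<dots> \<le> (\<Sum>n. upper_integral \<mu> (f n) + ennreal (e * (1/2) ^ Suc n))"
    using h(3) by (intro suminf_le) auto
  also have "\<dots> = (\<Sum>n. upper_integral \<mu> (f n)) + ennreal e"
    by (subst suminf_add[symmetric]) (auto simp: geo simp del: power_Suc)
  finally show "upper_integral \<mu> (\<lambda>y. \<Sum>n. f n y) \<le> (\<Sum>n. upper_integral \<mu> (f n)) + ennreal e" .
qed

lemma upper_integral_add:
  "upper_integral \<mu> (\<lambda>y. f y + g y) \<le> upper_integral \<mu> f + upper_integral \<mu> g"
proof -
  define F where "F n = (if n = 0 then f else if n = 1 then g else (\<lambda>y. 0))" for n :: nat
  have two: "(\<Sum>n. a n) = a 0 + a 1" if "\<And>n. 2 \<le> n \<Longrightarrow> a n = 0" for a :: "nat \<Rightarrow> ennreal"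
    by (subst suminf_finite[of "{0, 1}"]) (use that in auto)
  have "upper_integral \<mu> (\<lambda>y. \<Sum>n. F n y) \<le> (\<Sum>n. upper_integral \<mu> (F n))"
    by (rule upper_integral_suminf)
  moreover have "(\<lambda>y. \<Sum>n. F n y) = (\<lambda>y. f y + g y)"
    by (rule ext, subst two) (auto simp: F_def)
  moreover have "(\<Sum>n. upper_integral \<mu> (F n)) = upper_integral \<mu> f + upper_integral \<mu> g"
    by (subst two) (auto simp: F_def upper_integral_zero)
  ultimately show ?thesis by simp
qed

text \<open>The function may be infinite on \<open>N\<close>, but it is dominated by the series of
  infinitely many copies of the indicator of \<open>N\<close>, each of upper integral 0.\<close>

lemma upper_integral_negligible:
  assumes "rm_negligible \<mu> N"
  shows "upper_integral \<mu> (\<lambda>y. f y * indicator N y) = 0"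
proof -
  have "upper_integral \<mu> (\<lambda>y. f y * indicator N y) \<le> upper_integral \<mu> (\<lambda>y. \<Sum>n::nat. indicator N y)"
  proof (rule upper_integral_mono)
    fix y
    have "(\<Sum>n::nat. 1 :: ennreal) = top_class.top"
      by (simp add: suminf_eq_SUP ennreal_SUP_of_nat_eq_top)
    then show "f y * indicator N y \<le> (\<Sum>n::nat. indicator N y)" by (cases "y \<in> N") auto
  qed
  also have "\<dots> \<le> (\<Sum>n::nat. upper_integral \<mu> (indicator N))"
    using upper_integral_suminf[of "\<lambda>n. indicator N"] .
  also have "\<dots> = 0" using assms by (simp add: rm_negligible_def)
  finally show ?thesis by simp
qed

text \<open>Quantitative form of the fact that compact sets have finite outer measure; it provides
  the threshold below which values on \<open>K\<close> are harmless in dominated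
  convergence.\<close>

lemma upper_integral_compact_small:
  assumes "compact K" "0 < e"
  obtains c where "0 < c" "upper_integral \<mu> (\<lambda>y. ennreal c * indicator K y) \<le> ennreal e"
proof -
  have "\<exists>f :: 'y \<Rightarrow> real. f \<in> Cc \<and> (\<forall>z. 0 \<le> f z) \<and> f y = 1" for y
    using Cc_bump[OF locally_compact open_UNIV UNIV_I, of y] by metis
  then obtain f :: "'y \<Rightarrow> 'y \<Rightarrow> real" where f: "\<And>y. f y \<in> Cc" "\<And>y z. 0 \<le> f y z" "\<And>y. f y y = 1"
    by metis
  have op: "open {z. 1/2 < f y z}" for y
    using f(1) by (intro open_Collect_less continuous_on_const Cc_continuous)
  have cover: "K \<subseteq> (\<Union>y\<in>K. {z. 1/2 < f y z})" using f(3) by auto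
  obtain F where F: "finite F" "K \<subseteq> (\<Union>y\<in>F. {z. 1/2 < f y z})"
    by (rule compactE_image[OF assms(1) op cover])
  \<comment> \<open>The covering sets are those where a bump exceeds 1/2; the factor 2 lifts the sum
    to at least 1 on \<open>K\<close>.\<close>
  define u where "u z = 2 * (\<Sum>y\<in>F. f y z)" for z
  have u: "u \<in> Cc" "\<And>z. 0 \<le> u z"
    unfolding u_def[abs_def] using f by (auto intro!: Cc_cmult Cc_sum mult_nonneg_nonneg sum_nonneg)
  have u1: "1 \<le> u z" if z: "z \<in> K" for z
  proof -
    obtain y where "y \<in> F" "1/2 < f y z" using F z by auto
    moreover from this have "f y z \<le> (\<Sum>y\<in>F. f y z)"
      using f(2) F(1) by (intro member_le_sum) auto
    ultimately show ?thesis by (simp add: u_def)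
  qed
  obtain L where L: "compact L" "\<And>y. u y \<noteq> 0 \<Longrightarrow> y \<in> L" using Cc_support[OF u(1)] by blast
  obtain M where M: "0 \<le> M" "\<And>u C. 0 \<le> C \<Longrightarrow> (\<And>y. u y \<le> C) \<Longrightarrow> (\<And>y. y \<notin> L \<Longrightarrow> u y \<le> 0)
      \<Longrightarrow> rm_abs \<mu> u \<le> ennreal (M * C)"
    using rm_abs_bounded[OF L(1)] by blast
  define c where "c = e / (M + 1)"
  have c: "0 < c" "M * c \<le> e" using assms(2) M(1) by (auto simp: c_def field_simps)
  \<comment> \<open>Truncation keeps the value \<open>c\<close> on \<open>K\<close> and bounds
    \<open>w\<close> by \<open>c\<close> everywhere, while the support stays in \<open>L\<close>, on
    which \<open>M\<close> depends.\<close>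
  define w where "w z = min (c * u z) c" for z
  have w: "w \<in> Cc"
    unfolding w_def[abs_def] using Cc_continuous[OF u(1)] c(1)
    by (intro Cc_combine[OF u(1) u(1)]) (auto intro!: continuous_intros)
  have "upper_integral \<mu> (\<lambda>y. ennreal c * indicator K y) \<le> rm_abs \<mu> w"
  proof (rule upper_integral_Cc_le[OF w])
    fix y
    show "0 \<le> w y" using u(2) c(1) by (simp add: w_def)
    show "ennreal c * indicator K y \<le> ennreal (w y)"
      using u1[of y] c(1) by (cases "y \<in> K") (auto simp: w_def intro!: ennreal_leI)
  qed
  also have "\<dots> \<le> ennreal (M * c)"
  proof (rule M(2))
    show "w y \<le> 0" if "y \<notin> L" for y
      using L(2)[of y] that c(1) by (cases "u y = 0") (auto simp: w_def)
  qed (use c in \<open>auto simp: w_def\<close>)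
  also have "\<dots> \<le> ennreal e" using c by (intro ennreal_leI)
  finally show ?thesis using c that by blast
qed

text \<open>The Caratheodory condition for \<open>K\<close>, tested on an arbitrary
  \<open>f\<close>. As \<open>K\<close> is closed, a majorant \<open>h\<close> restricted to the
  complement of \<open>K\<close> is still lower semicontinuous. A minorant \<open>u\<close> of that
  restriction vanishes on \<open>K\<close>, so \<open>h - u\<close> still dominates \<open>f\<close>
  there; superadditivity then joins minorants of \<open>h - u\<close> with \<open>u\<close> below
  \<open>h\<close>.\<close>

lemma upper_integral_split:
  assumes "compact K"
  shows "upper_integral \<mu> (\<lambda>y. f y * indicator K y) + upper_integral \<mu> (\<lambda>y. f y * indicator (- K) y)
    \<le> upper_integral \<mu> f"
  unfolding upper_integral_def[of \<mu> f]
proof (rule INF_greatest, clarify)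
  fix h assume h: "lower_semicont h" "\<forall>y. f y \<le> h y"
  have "closed K" using assms by (rule compact_imp_closed)
  let ?h' = "\<lambda>y. h y * indicator (- K) y"
  have lsc': "lower_semicont ?h'"
    unfolding lower_semicont_def
  proof
    fix a
    have "{y. a < h y * indicator (- K) y} = {y. a < h y} \<inter> (- K)"
      by (auto simp: indicator_def)
    then show "open {y. a < h y * indicator (- K) y}"
      using h(1) \<open>closed K\<close> by (auto simp: lower_semicont_def)
  qed
  have step: "upper_integral \<mu> (\<lambda>y. f y * indicator K y) + rm_abs \<mu> u \<le> lsc_integral \<mu> h"
    if u: "u \<in> Cc" "\<And>y. 0 \<le> u y" "\<And>y. ennreal (u y) \<le> ?h' y" for u
  proof -
    have u_le: "ennreal (u y) \<le> h y" for y
      using u(3)[of y] by (cases "y \<in> K") auto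
    have u_K: "u y = 0" if "y \<in> K" for y
      using u(3)[of y] u(2)[of y] that by (simp add: ennreal_eq_0_iff)
    \<comment> \<open>A value \<open>b\<close> strictly between \<open>a + u\<close> and
      \<open>h\<close> separates the condition into an open one on \<open>u\<close> and an open one
      on \<open>h\<close>.\<close>
    have lsc: "lower_semicont (\<lambda>y. h y - ennreal (u y))"
      unfolding lower_semicont_def
    proof (intro allI, subst open_subopen, clarify)
      fix a y assume "a < h y - ennreal (u y)"
      then have "a + ennreal (u y) < h y" by (simp add: less_diff_eq_ennreal)
      then obtain b where b: "a + ennreal (u y) < b" "b < h y" using dense by blast
      have "continuous_on UNIV (\<lambda>z. a + ennreal (u z))"
        using u(1) by (intro continuous_on_add_ennreal continuous_on_const continuous_on_ennreal Cc_continuous)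
      then have "open {z. a + ennreal (u z) < b}" by (intro open_Collect_less continuous_on_const)
      moreover have "open {z. b < h z}" using h(1) by (simp add: lower_semicont_def)
      moreover have "{z. a + ennreal (u z) < b} \<inter> {z. b < h z} \<subseteq> {z. a < h z - ennreal (u z)}"
        by (auto simp: less_diff_eq_ennreal)
      ultimately show "\<exists>T. open T \<and> y \<in> T \<and> T \<subseteq> {z. a < h z - ennreal (u z)}"
        using b by (intro exI[of _ "{z. a + ennreal (u z) < b} \<inter> {z. b < h z}"]) auto
    qed
    have "upper_integral \<mu> (\<lambda>y. f y * indicator K y) \<le> lsc_integral \<mu> (\<lambda>y. h y - ennreal (u y))"
    proof (rule upper_integral_le[OF lsc])
      show "f y * indicator K y \<le> h y - ennreal (u y)" for y
        using h(2) u_K by (cases "y \<in> K") auto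
    qed
    then have "upper_integral \<mu> (\<lambda>y. f y * indicator K y) + rm_abs \<mu> u
        \<le> lsc_integral \<mu> (\<lambda>y. h y - ennreal (u y)) + rm_abs \<mu> u"
      by (rule add_right_mono)
    also have "\<dots> = (SUP g\<in>{g\<in>Cc. \<forall>y. 0 \<le> g y \<and> ennreal (g y) \<le> h y - ennreal (u y)}. rm_abs \<mu> g + rm_abs \<mu> u)"
    proof -
      have "{g\<in>Cc. \<forall>y. 0 \<le> g y \<and> ennreal (g y) \<le> h y - ennreal (u y)} \<noteq> {}"
        using Cc_zero by (auto intro!: exI[of _ "\<lambda>y. 0"])
      then show ?thesis unfolding lsc_integral_def by (rule ennreal_SUP_add_left[symmetric])
    qed
    also have "\<dots> \<le> lsc_integral \<mu> h"
    proof (rule SUP_least, clarify)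
      fix g assume g: "g \<in> Cc" "\<forall>y. 0 \<le> g y \<and> ennreal (g y) \<le> h y - ennreal (u y)"
      have "rm_abs \<mu> g + rm_abs \<mu> u \<le> rm_abs \<mu> (\<lambda>y. g y + u y)"
        using g u by (intro rm_abs_superadditive) auto
      also have "\<dots> \<le> lsc_integral \<mu> h"
      proof (intro lsc_integral_ge Cc_add g u)
        fix y
        show "0 \<le> g y + u y" using g u by auto
        have "ennreal (g y) + ennreal (u y) \<le> (h y - ennreal (u y)) + ennreal (u y)"
          using g by (intro add_right_mono) auto
        \<comment> \<open>Subtraction in \<open>ennreal\<close> is truncated; it is exact here
          because \<open>u\<close> is below \<open>h\<close>.\<close>
        also have "\<dots> = h y" using u_le by (simp add: diff_add_cancel_ennreal)
        finally show "ennreal (g y + u y) \<le> h y" using g u by (simp add: ennreal_plus)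
      qed
      finally show "rm_abs \<mu> g + rm_abs \<mu> u \<le> lsc_integral \<mu> h" .
    qed
    finally show ?thesis .
  qed
  let ?S = "{g\<in>Cc. \<forall>y. 0 \<le> g y \<and> ennreal (g y) \<le> ?h' y}"
  have ne: "?S \<noteq> {}" using Cc_zero by (auto intro!: exI[of _ "\<lambda>y. 0"])
  have "upper_integral \<mu> (\<lambda>y. f y * indicator (- K) y) \<le> lsc_integral \<mu> ?h'"
    using h(2) by (intro upper_integral_le[OF lsc'] mult_right_mono) auto
  then have "upper_integral \<mu> (\<lambda>y. f y * indicator K y) + upper_integral \<mu> (\<lambda>y. f y * indicator (- K) y)
      \<le> upper_integral \<mu> (\<lambda>y. f y * indicator K y) + lsc_integral \<mu> ?h'"
    by (rule add_left_mono)
  also have "\<dots> = (SUP u\<in>?S. upper_integral \<mu> (\<lambda>y. f y * indicator K y) + rm_abs \<mu> u)"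
    unfolding lsc_integral_def by (rule ennreal_SUP_add_right[OF ne])
  also have "\<dots> \<le> lsc_integral \<mu> h"
    by (rule SUP_least) (auto intro: step)
  finally show "upper_integral \<mu> (\<lambda>y. f y * indicator K y) + upper_integral \<mu> (\<lambda>y. f y * indicator (- K) y)
    \<le> lsc_integral \<mu> h" .
qed

end

context radon
begin

section \<open>Essential upper integrals\<close>

lemma ess_upper_integral_ge:
  "compact K \<Longrightarrow> upper_integral \<mu> (\<lambda>y. f y * indicator K y) \<le> ess_upper_integral \<mu> f"
  unfolding ess_upper_integral_def by (intro SUP_upper) auto

lemma ess_upper_integral_mono:
  assumes "\<And>y. f y \<le> g y"
  shows "ess_upper_integral \<mu> f \<le> ess_upper_integral \<mu> g"
  unfolding ess_upper_integral_def using assms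
  by (intro SUP_mono) (auto intro!: upper_integral_mono mult_right_mono)

lemma ess_upper_integral_le_upper_integral: "ess_upper_integral \<mu> f \<le> upper_integral \<mu> f"
  unfolding ess_upper_integral_def
  by (intro SUP_least upper_integral_mono) (auto simp: indicator_def)

lemma ess_upper_integral_add:
  "ess_upper_integral \<mu> (\<lambda>y. f y + g y) \<le> ess_upper_integral \<mu> f + ess_upper_integral \<mu> g"
  unfolding ess_upper_integral_def[of \<mu> "\<lambda>y. f y + g y"]
proof (rule SUP_least, clarify)
  fix K :: "'y set" assume K: "compact K"
  have "upper_integral \<mu> (\<lambda>y. f y * indicator K y + g y * indicator K y)
     \<le> upper_integral \<mu> (\<lambda>y. f y * indicator K y) + upper_integral \<mu> (\<lambda>y. g y * indicator K y)"
    by (rule upper_integral_add)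
  also have "\<dots> \<le> ess_upper_integral \<mu> f + ess_upper_integral \<mu> g"
    using K by (intro add_mono ess_upper_integral_ge)
  finally show "upper_integral \<mu> (\<lambda>y. (f y + g y) * indicator K y)
      \<le> ess_upper_integral \<mu> f + ess_upper_integral \<mu> g"
    by (simp add: distrib_right)
qed

lemma ess_upper_integral_zero: "ess_upper_integral \<mu> (\<lambda>y. 0) = 0"
  using ess_upper_integral_le_upper_integral[of "\<lambda>y. 0"] by (simp add: upper_integral_zero)

lemma locally_negligible_Int_compact:
  assumes "locally_negligible \<mu> N" "compact K"
  shows "rm_negligible \<mu> (N \<inter> K)"
proof -
  have "(\<lambda>y. indicator N y * indicator K y :: ennreal) = indicator (N \<inter> K)"
    by (auto simp: indicator_def)
  then show ?thesis
    using ess_upper_integral_ge[OF assms(2), of "indicator N"] assms(1)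
    by (simp add: locally_negligible_def rm_negligible_def)
qed

lemma locally_negligible_subset_Un:
  assumes "locally_negligible \<mu> M" "locally_negligible \<mu> N" "L \<subseteq> M \<union> N"
  shows "locally_negligible \<mu> L"
proof -
  have "ess_upper_integral \<mu> (indicator L) \<le> ess_upper_integral \<mu> (\<lambda>y. indicator M y + indicator N y)"
    using assms(3) by (intro ess_upper_integral_mono) (auto simp: indicator_def)
  also have "\<dots> \<le> ess_upper_integral \<mu> (indicator M) + ess_upper_integral \<mu> (indicator N)"
    by (rule ess_upper_integral_add)
  finally show ?thesis using assms(1,2) by (simp add: locally_negligible_def)
qed

text \<open>Each approximant \<open>g n\<close> has compact support \<open>K\<close>, so only the
  part of the exceptional set inside \<open>K\<close> matters. That part is negligible, hence
  \<open>f'\<close> may be exchanged for \<open>f\<close> on \<open>K\<close>, and the integral over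
  one compact set is below the essential upper integral.\<close>

lemma norm_has_ess_integral_le:
  assumes "has_ess_integral \<mu> f I"
  shows "ennreal (norm I) \<le> ess_upper_integral \<mu> (\<lambda>s. ennreal (norm (f s)))"
proof -
  obtain f' where f': "has_rm_integral \<mu> f' I" and neg: "locally_negligible \<mu> {y. f y \<noteq> f' y}"
    using assms unfolding has_ess_integral_def by blast
  obtain g where g: "\<And>n::nat. g n \<in> Cc"
      "(\<lambda>n. upper_integral \<mu> (\<lambda>y. ennreal (norm (f' y - g n y)))) \<longlonglongrightarrow> 0"
      "(\<lambda>n. \<mu> (g n)) \<longlonglongrightarrow> I"
    using f' unfolding has_rm_integral_def by auto
  let ?E = "ess_upper_integral \<mu> (\<lambda>s. ennreal (norm (f s)))"
  let ?N = "{y. f y \<noteq> f' y}"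
  have "ennreal (norm (\<mu> (g n))) \<le> upper_integral \<mu> (\<lambda>y. ennreal (norm (f' y - g n y))) + ?E" for n
  proof -
    obtain K where K: "compact K" "\<And>y. g n y \<noteq> 0 \<Longrightarrow> y \<in> K" using Cc_support[OF g(1)] by blast
    have "ennreal (norm (\<mu> (g n))) \<le> rm_abs \<mu> (\<lambda>y. norm (g n y))"
      by (intro rm_abs_ge g) simp
    also have "\<dots> \<le> upper_integral \<mu> (\<lambda>y. ennreal (norm (g n y)))"
      by (intro upper_integral_Cc_ge Cc_norm g) auto
    also have "\<dots> \<le> upper_integral \<mu> (\<lambda>y. ennreal (norm (f' y - g n y)) +
        (ennreal (norm (f y)) * indicator K y + ennreal (norm (f' y)) * indicator (?N \<inter> K) y))"
    proof (rule upper_integral_mono)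
      fix y
      have tri: "ennreal (norm (g n y)) \<le> ennreal (norm (f' y - g n y)) + ennreal (norm (f' y))"
        using norm_triangle_ineq4[of "f' y" "f' y - g n y"]
        by (simp flip: ennreal_plus add: ennreal_leI add.commute)
      show "ennreal (norm (g n y)) \<le> ennreal (norm (f' y - g n y)) +
        (ennreal (norm (f y)) * indicator K y + ennreal (norm (f' y)) * indicator (?N \<inter> K) y)"
      proof (cases "y \<in> K")
        case True
        with tri show ?thesis by (cases "y \<in> ?N") (auto simp: add_increasing2 intro: order_trans add_left_mono)
      next
        case False
        then have "g n y = 0" using K(2) by blast
        then show ?thesis by simp
      qed
    qed
    also have "\<dots> \<le> upper_integral \<mu> (\<lambda>y. ennreal (norm (f' y - g n y))) +
        (upper_integral \<mu> (\<lambda>y. ennreal (norm (f y)) * indicator K y) +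
         upper_integral \<mu> (\<lambda>y. ennreal (norm (f' y)) * indicator (?N \<inter> K) y))"
      by (intro order_trans[OF upper_integral_add] add_left_mono upper_integral_add)
    also have "\<dots> \<le> upper_integral \<mu> (\<lambda>y. ennreal (norm (f' y - g n y))) + (?E + 0)"
      using upper_integral_negligible[OF locally_negligible_Int_compact[OF neg K(1)]]
      by (intro add_left_mono add_mono ess_upper_integral_ge K) auto
    finally show ?thesis by simp
  qed
  moreover have "(\<lambda>n. ennreal (norm (\<mu> (g n)))) \<longlonglongrightarrow> ennreal (norm I)"
    by (intro tendsto_ennrealI tendsto_norm g)
  moreover have "(\<lambda>n. upper_integral \<mu> (\<lambda>y. ennreal (norm (f' y - g n y))) + ?E) \<longlonglongrightarrow> 0 + ?E"
    by (intro tendsto_add g tendsto_const)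
  ultimately show ?thesis using LIMSEQ_le by fastforce
qed

section \<open>Differences and uniqueness of the scalar integral\<close>

lemma has_rm_integral_diff:
  assumes "has_rm_integral \<mu> f I" "has_rm_integral \<mu> g J"
  shows "has_rm_integral \<mu> (\<lambda>y. f y - g y) (I - J)"
proof -
  obtain a where a: "\<And>n::nat. a n \<in> Cc" "(\<lambda>n. upper_integral \<mu> (\<lambda>y. ennreal (norm (f y - a n y)))) \<longlonglongrightarrow> 0"
      "(\<lambda>n. \<mu> (a n)) \<longlonglongrightarrow> I"
    using assms(1) unfolding has_rm_integral_def by auto
  obtain b where b: "\<And>n::nat. b n \<in> Cc" "(\<lambda>n. upper_integral \<mu> (\<lambda>y. ennreal (norm (g y - b n y)))) \<longlonglongrightarrow> 0"
      "(\<lambda>n. \<mu> (b n)) \<longlonglongrightarrow> J"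
    using assms(2) unfolding has_rm_integral_def by auto
  have "(\<lambda>n. upper_integral \<mu> (\<lambda>y. ennreal (norm (f y - g y - (a n y - b n y))))) \<longlonglongrightarrow> 0"
  proof (rule tendsto_sandwich[OF _ _ tendsto_const])
    show "(\<lambda>n. upper_integral \<mu> (\<lambda>y. ennreal (norm (f y - a n y))) +
        upper_integral \<mu> (\<lambda>y. ennreal (norm (g y - b n y)))) \<longlonglongrightarrow> 0"
      using tendsto_add[OF a(2) b(2)] by simp
    have "upper_integral \<mu> (\<lambda>y. ennreal (norm (f y - g y - (a n y - b n y))))
       \<le> upper_integral \<mu> (\<lambda>y. ennreal (norm (f y - a n y))) +
         upper_integral \<mu> (\<lambda>y. ennreal (norm (g y - b n y)))" for n
    proof (rule order_trans[OF upper_integral_mono upper_integral_add])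
      fix y
      have "norm (f y - g y - (a n y - b n y)) \<le> norm (f y - a n y) + norm (g y - b n y)"
        using norm_triangle_ineq4[of "f y - a n y" "g y - b n y"] by (simp add: algebra_simps)
      then show "ennreal (norm (f y - g y - (a n y - b n y)))
          \<le> ennreal (norm (f y - a n y)) + ennreal (norm (g y - b n y))"
        by (simp flip: ennreal_plus add: ennreal_leI)
    qed
    then show "\<forall>\<^sub>F n in sequentially. upper_integral \<mu> (\<lambda>y. ennreal (norm (f y - g y - (a n y - b n y))))
       \<le> upper_integral \<mu> (\<lambda>y. ennreal (norm (f y - a n y))) +
         upper_integral \<mu> (\<lambda>y. ennreal (norm (g y - b n y)))"
      by simp
  qed simp
  moreover have "(\<lambda>n. \<mu> (\<lambda>y. a n y - b n y)) \<longlonglongrightarrow> I - J"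
    using tendsto_diff[OF a(3) b(3)] a(1) b(1) by (simp add: mu_diff)
  ultimately show ?thesis
    unfolding has_rm_integral_def using a(1) b(1)
    by (intro exI[of _ "\<lambda>n y. a n y - b n y"]) (auto intro: Cc_diff)
qed

lemma has_ess_integral_diff:
  assumes "has_ess_integral \<mu> f I" "has_ess_integral \<mu> g J"
  shows "has_ess_integral \<mu> (\<lambda>y. f y - g y) (I - J)"
proof -
  obtain f' g' where *: "has_rm_integral \<mu> f' I" "locally_negligible \<mu> {y. f y \<noteq> f' y}"
    "has_rm_integral \<mu> g' J" "locally_negligible \<mu> {y. g y \<noteq> g' y}"
    using assms unfolding has_ess_integral_def by blast
  then show ?thesis
    unfolding has_ess_integral_def
    by (intro exI[of _ "\<lambda>y. f' y - g' y"] conjI has_rm_integral_diff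
        locally_negligible_subset_Un[OF *(2) *(4)]) auto
qed

text \<open>Two values of the integral differ by an integral of the zero function, which the norm
  estimate forces to be 0.\<close>

lemma ess_integral_eqI:
  assumes "has_ess_integral \<mu> f I"
  shows "ess_integral \<mu> f = I"
  unfolding ess_integral_def
proof (rule the_equality)
  fix J assume "has_ess_integral \<mu> f J"
  then have "has_ess_integral \<mu> (\<lambda>y. 0) (J - I)"
    using has_ess_integral_diff[OF _ assms] by fastforce
  from norm_has_ess_integral_le[OF this] show "J = I"
    by (simp add: ess_upper_integral_zero)
qed (rule assms)

lemma norm_ess_integral_le:
  assumes "ess_integrable \<mu> f"
  shows "ennreal (norm (ess_integral \<mu> f)) \<le> ess_upper_integral \<mu> (\<lambda>s. ennreal (norm (f s)))"
  using assms norm_has_ess_integral_le ess_integral_eqI unfolding ess_integrable_def by metis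

lemma ess_integral_diff:
  assumes "ess_integrable \<mu> f" "ess_integrable \<mu> g"
  shows "ess_integral \<mu> (\<lambda>s. f s - g s) = ess_integral \<mu> f - ess_integral \<mu> g"
  using assms has_ess_integral_diff ess_integral_eqI unfolding ess_integrable_def by metis

section \<open>Dominated convergence\<close>

text \<open>The majorant \<open>g\<close> need not be measurable: for every \<open>g\<close>, compact sets are Caratheodory
  measurable for the outer measure that sends \<open>A\<close> to the upper integral of \<open>g\<close> over \<open>A\<close>.\<close>

lemma outer_measure_upper_integral:
  "outer_measure_space (Pow UNIV) (\<lambda>A. upper_integral \<mu> (\<lambda>y. g y * indicator A y))"
proof -
  have "upper_integral \<mu> (\<lambda>y. g y * indicator A y) \<le> upper_integral \<mu> (\<lambda>y. g y * indicator B y)"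
    if "A \<subseteq> B" for A B
    using that by (intro upper_integral_mono mult_left_mono) (auto simp: indicator_def)
  moreover have "upper_integral \<mu> (\<lambda>y. g y * indicator (\<Union>n. A n) y)
      \<le> (\<Sum>n. upper_integral \<mu> (\<lambda>y. g y * indicator (A n) y))" if "disjoint_family A" for A :: "nat \<Rightarrow> 'y set"
  proof -
    have "(\<lambda>y. g y * indicator (\<Union>n. A n) y) = (\<lambda>y. \<Sum>n. g y * indicator (A n) y)"
      using suminf_indicator[OF that] by (auto simp: ennreal_suminf_cmult)
    then show ?thesis using upper_integral_suminf[of "\<lambda>n y. g y * indicator (A n) y"] by simp
  qed
  ultimately show ?thesis
    by (auto simp: outer_measure_space_def positive_def increasing_def countably_subadditive_def
        upper_integral_zero)
qed

text \<open>Caratheodory's measure for this outer measure, with a sigma-algebra that depends on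
  \<open>g\<close>. It is introduced for its continuity from above along decreasing
  sequences.\<close>

definition weighted :: "('y \<Rightarrow> ennreal) \<Rightarrow> 'y measure" where
  "weighted g = measure_of UNIV
     (lambda_system UNIV (Pow UNIV) (\<lambda>A. upper_integral \<mu> (\<lambda>y. g y * indicator A y)))
     (\<lambda>A. upper_integral \<mu> (\<lambda>y. g y * indicator A y))"

lemma measure_space_weighted:
  "measure_space UNIV (lambda_system UNIV (Pow UNIV) (\<lambda>A. upper_integral \<mu> (\<lambda>y. g y * indicator A y)))
     (\<lambda>A. upper_integral \<mu> (\<lambda>y. g y * indicator A y))"
  using sigma_algebra.caratheodory_lemma[OF sigma_algebra_Pow outer_measure_upper_integral] .

lemma sets_weighted:
  "sets (weighted g) = lambda_system UNIV (Pow UNIV) (\<lambda>A. upper_integral \<mu> (\<lambda>y. g y * indicator A y))"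
  using measure_space_weighted[of g] unfolding weighted_def measure_space_def
  by (intro sigma_algebra.sets_measure_of_eq) simp

lemma emeasure_weighted:
  assumes "A \<in> sets (weighted g)"
  shows "emeasure (weighted g) A = upper_integral \<mu> (\<lambda>y. g y * indicator A y)"
  using measure_space_weighted[of g] assms[unfolded sets_weighted]
  unfolding measure_space_def weighted_def by (intro emeasure_measure_of_sigma) simp_all

text \<open>The opposite inequality is subadditivity, so a one-sided test suffices.\<close>

lemma sets_weightedI:
  assumes "\<And>B. upper_integral \<mu> (\<lambda>y. g y * indicator (A \<inter> B) y) +
      upper_integral \<mu> (\<lambda>y. g y * indicator (- A \<inter> B) y) \<le> upper_integral \<mu> (\<lambda>y. g y * indicator B y)"
  shows "A \<in> sets (weighted g)"
proof -
  have "upper_integral \<mu> (\<lambda>y. g y * indicator B y) \<le> upper_integral \<mu> (\<lambda>y. g y * indicator (A \<inter> B) y) +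
      upper_integral \<mu> (\<lambda>y. g y * indicator (- A \<inter> B) y)" for B
    by (rule order_trans[OF upper_integral_mono upper_integral_add]) (auto simp: indicator_def)
  then show ?thesis
    using assms by (auto simp: sets_weighted lambda_system_def Compl_eq_Diff_UNIV intro: antisym)
qed

text \<open>The test sets \<open>B\<close> are arbitrary, which is why the splitting inequality was
  proved for functions without any regularity.\<close>

lemma compact_in_weighted:
  assumes "compact K"
  shows "K \<in> sets (weighted g)"
proof (rule sets_weightedI)
  fix B
  have "(\<lambda>y. g y * indicator B y * indicator K y) = (\<lambda>y. g y * indicator (K \<inter> B) y)"
    "(\<lambda>y. g y * indicator B y * indicator (- K) y) = (\<lambda>y. g y * indicator (- K \<inter> B) y)"
    by (auto simp: indicator_def)
  then show "upper_integral \<mu> (\<lambda>y. g y * indicator (K \<inter> B) y) +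
      upper_integral \<mu> (\<lambda>y. g y * indicator (- K \<inter> B) y) \<le> upper_integral \<mu> (\<lambda>y. g y * indicator B y)"
    using upper_integral_split[OF assms, of "\<lambda>y. g y * indicator B y"] by simp
qed

lemma negligible_in_weighted:
  assumes "rm_negligible \<mu> N" "M \<subseteq> N"
  shows "M \<in> sets (weighted g)"
proof (rule sets_weightedI)
  fix B
  have "upper_integral \<mu> (\<lambda>y. g y * indicator (M \<inter> B) y) \<le> upper_integral \<mu> (\<lambda>y. g y * indicator N y)"
    using assms(2) by (intro upper_integral_mono mult_left_mono) (auto simp: indicator_def)
  then have "upper_integral \<mu> (\<lambda>y. g y * indicator (M \<inter> B) y) = 0"
    using upper_integral_negligible[OF assms(1), of g] by simp
  moreover have "upper_integral \<mu> (\<lambda>y. g y * indicator (- M \<inter> B) y) \<le> upper_integral \<mu> (\<lambda>y. g y * indicator B y)"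
    by (intro upper_integral_mono mult_left_mono) (auto simp: indicator_def)
  ultimately show "upper_integral \<mu> (\<lambda>y. g y * indicator (M \<inter> B) y) +
      upper_integral \<mu> (\<lambda>y. g y * indicator (- M \<inter> B) y) \<le> upper_integral \<mu> (\<lambda>y. g y * indicator B y)"
    by simp
qed

text \<open>On each compact piece of the Bourbaki partition \<open>f\<close> is continuous, and the
  non-strict inequality makes the level set compact; the leftover lies in a negligible set.\<close>

lemma Meas_superlevel_in_weighted:
  assumes "f \<in> Meas euclidean \<mu>" "compact K"
  shows "{y\<in>K. c \<le> (f y :: real)} \<in> sets (weighted g)"
proof -
  obtain N C where N: "N \<subseteq> K" "rm_negligible \<mu> N" "\<forall>n::nat. compact (C n)" "K - N = (\<Union>n. C n)"
      "\<forall>n. continuous_map (top_of_set (C n)) euclidean f"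
    using assms unfolding Meas_def by auto
  have "compact {y\<in>C n. c \<le> f y}" for n
  proof -
    have "continuous_on (C n) f" using N(5) by auto
    moreover have "closed (C n)" using N(3) by (blast intro: compact_imp_closed)
    ultimately have "closed {y\<in>C n. c \<le> f y}"
      using continuous_closed_preimage[of "C n" f "{c..}"] by (simp add: vimage_def Int_def)
    then have "compact (C n \<inter> {y\<in>C n. c \<le> f y})" using N(3) by (intro compact_Int_closed) auto
    then show ?thesis by (simp add: Int_def)
  qed
  then have "(\<Union>n. {y\<in>C n. c \<le> f y}) \<in> sets (weighted g)"
    by (intro sets.countable_UN image_subsetI compact_in_weighted)
  moreover have "N \<inter> {y\<in>K. c \<le> f y} \<in> sets (weighted g)"
    using N(2) by (intro negligible_in_weighted) auto
  ultimately have "(\<Union>n. {y\<in>C n. c \<le> f y}) \<union> (N \<inter> {y\<in>K. c \<le> f y}) \<in> sets (weighted g)"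
    by (rule sets.Un)
  moreover have "(\<Union>n. {y\<in>C n. c \<le> f y}) \<union> (N \<inter> {y\<in>K. c \<le> f y}) = {y\<in>K. c \<le> f y}"
    using N(1,4) by blast
  ultimately show ?thesis by simp
qed

text \<open>\<open>K\<close> nearly attains the supremum over compact sets. For any compact
  \<open>L\<close> the integral over \<open>K \<union> L\<close> splits along \<open>K\<close>, so
  the part of \<open>L\<close> outside \<open>K\<close> can only account for the missing
  \<open>e\<close>. Cancelling the part over \<open>K\<close> is where finiteness enters.\<close>

lemma ess_upper_integral_outside_compact:
  assumes fin: "ess_upper_integral \<mu> g < \<infinity>" and e: "0 < e"
  obtains K where "compact K" "ess_upper_integral \<mu> (\<lambda>y. g y * indicator (- K) y) \<le> ennreal e"
proof -
  have ne: "{K::'y set. compact K} \<noteq> {}" using compact_empty by blast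
  obtain K where K: "compact K" "ess_upper_integral \<mu> g < upper_integral \<mu> (\<lambda>y. g y * indicator K y) + ennreal e"
    using SUP_approx_ennreal[OF e ne ess_upper_integral_def, of \<mu> g] fin[THEN less_imp_neq] by auto
  have finK: "upper_integral \<mu> (\<lambda>y. g y * indicator K y) < \<infinity>"
    using ess_upper_integral_ge[OF K(1)] fin by (rule order_le_less_trans)
  have "ess_upper_integral \<mu> (\<lambda>y. g y * indicator (- K) y) \<le> ennreal e"
    unfolding ess_upper_integral_def[of \<mu> "\<lambda>y. g y * indicator (- K) y"]
  proof (rule SUP_least, clarify)
    fix L :: "'y set" assume L: "compact L"
    let ?f = "\<lambda>y. g y * indicator (K \<union> L) y"
    have "(\<lambda>y. ?f y * indicator K y) = (\<lambda>y. g y * indicator K y)"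
      "(\<lambda>y. ?f y * indicator (- K) y) = (\<lambda>y. g y * indicator (- K) y * indicator L y)"
      by (auto simp: indicator_def)
    then have "upper_integral \<mu> (\<lambda>y. g y * indicator K y) + upper_integral \<mu> (\<lambda>y. g y * indicator (- K) y * indicator L y)
        \<le> upper_integral \<mu> ?f"
      using upper_integral_split[OF K(1), of ?f] by simp
    also have "\<dots> \<le> ess_upper_integral \<mu> g"
      using K(1) L by (intro ess_upper_integral_ge compact_Un)
    also have "\<dots> \<le> upper_integral \<mu> (\<lambda>y. g y * indicator K y) + ennreal e"
      using K(2) by simp
    finally show "upper_integral \<mu> (\<lambda>y. g y * indicator (- K) y * indicator L y) \<le> ennreal e"
      using finK by (auto simp: ennreal_add_left_cancel_le)
  qed
  with K(1) show ?thesis by (rule that)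
qed

text \<open>Three regions: off \<open>K\<close> the majorant has small integral; on \<open>K\<close>
  outside \<open>A n\<close> the function is at most the small constant \<open>c\<close>; on
  \<open>A n\<close> the majorant is integrated over a set whose weighted measure tends to
  0.\<close>

lemma ess_upper_integral_dominated_convergence:
  fixes f :: "nat \<Rightarrow> 'y \<Rightarrow> real"
  assumes meas: "\<And>n. f n \<in> Meas euclidean \<mu>"
    and dom: "\<And>n s. ennreal (f n s) \<le> g s" and fin: "ess_upper_integral \<mu> g < \<infinity>"
    and lim: "\<And>s. (\<lambda>n. f n s) \<longlonglongrightarrow> 0" and e: "0 < e"
  shows "eventually (\<lambda>n. ess_upper_integral \<mu> (\<lambda>s. ennreal (f n s)) < ennreal e) sequentially"
proof -
  obtain K where K: "compact K" "ess_upper_integral \<mu> (\<lambda>y. g y * indicator (- K) y) \<le> ennreal (e/4)"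
    using ess_upper_integral_outside_compact[OF fin, of "e/4"] e by auto
  obtain c where c: "0 < c" "upper_integral \<mu> (\<lambda>y. ennreal c * indicator K y) \<le> ennreal (e/4)"
    using upper_integral_compact_small[OF K(1), of "e/4"] e by auto
  \<comment> \<open>Collecting all later indices makes the sequence decreasing, and pointwise
    convergence empties its intersection.\<close>
  define A where "A n = (\<Union>m\<in>{n..}. {y\<in>K. c \<le> f m y})" for n
  have A: "A n \<in> sets (weighted g)" for n
    unfolding A_def using meas K(1)
    by (intro sets.countable_UN') (auto intro: Meas_superlevel_in_weighted)
  have dec: "decseq A" unfolding A_def by (intro decseq_SucI UN_mono) auto
  have "(\<Inter>n. A n) = {}"
  proof (rule equals0I)
    fix y assume y: "y \<in> (\<Inter>n. A n)"
    obtain n where n: "\<And>m. n \<le> m \<Longrightarrow> f m y < c"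
      using order_tendstoD(2)[OF lim c(1), of y] unfolding eventually_sequentially by blast
    have "y \<in> A n" using y by blast
    then show False using n unfolding A_def by fastforce
  qed
  moreover have "emeasure (weighted g) (A n) \<noteq> \<infinity>" for n
  proof -
    have "emeasure (weighted g) (A n) = upper_integral \<mu> (\<lambda>y. g y * indicator (A n) y)"
      using A by (rule emeasure_weighted)
    also have "\<dots> \<le> upper_integral \<mu> (\<lambda>y. g y * indicator K y)"
      by (intro upper_integral_mono mult_left_mono) (auto simp: A_def indicator_def)
    also have "\<dots> \<le> ess_upper_integral \<mu> g" by (rule ess_upper_integral_ge[OF K(1)])
    finally show ?thesis using fin by (auto simp: top_unique)
  qed
  ultimately have "(\<lambda>n. emeasure (weighted g) (A n)) \<longlonglongrightarrow> 0"
    using Lim_emeasure_decseq[of A "weighted g"] A dec by (simp add: image_subset_iff)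
  then have "eventually (\<lambda>n. emeasure (weighted g) (A n) < ennreal (e/4)) sequentially"
    using e by (intro order_tendstoD(2)) auto
  then show ?thesis
  proof eventually_elim
    case (elim n)
    have "ess_upper_integral \<mu> (\<lambda>s. ennreal (f n s)) \<le> ess_upper_integral \<mu> (\<lambda>s. g s * indicator (- K) s +
        (g s * indicator (A n) s + ennreal c * indicator K s))"
    proof (rule ess_upper_integral_mono)
      fix s
      consider "s \<notin> K" | "s \<in> K" "s \<in> A n" | "s \<in> K" "s \<notin> A n" by blast
      then show "ennreal (f n s) \<le> g s * indicator (- K) s +
        (g s * indicator (A n) s + ennreal c * indicator K s)"
      proof cases
        case 3
        then have "f n s \<le> c" unfolding A_def by force
        then show ?thesis using 3 by (simp add: ennreal_leI)
      qed (use dom[of n s] in \<open>auto intro: order_trans simp: add_increasing2\<close>)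
    qed
    also have "\<dots> \<le> ess_upper_integral \<mu> (\<lambda>s. g s * indicator (- K) s) +
        (ess_upper_integral \<mu> (\<lambda>s. g s * indicator (A n) s) + ess_upper_integral \<mu> (\<lambda>s. ennreal c * indicator K s))"
      by (intro order_trans[OF ess_upper_integral_add] add_left_mono ess_upper_integral_add)
    also have "\<dots> \<le> ennreal (e/4) + (ennreal (e/4) + ennreal (e/4))"
      using c(2) elim emeasure_weighted[OF A, of n]
      by (intro add_mono K(2) order_trans[OF ess_upper_integral_le_upper_integral]) auto
    also have "\<dots> = ennreal (e/4 + (e/4 + e/4))" using e by (simp flip: ennreal_plus)
    also have "\<dots> < ennreal e" using e by (intro ennreal_lessI) auto
    finally show ?case .
  qed
qed

end

lemma Meas_compose:
  assumes "f \<in> Meas T \<mu>" "continuous_map T T' q"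
  shows "(\<lambda>s. q (f s)) \<in> Meas T' \<mu>"
proof -
  have "q (f s) \<in> topspace T'" for s
    using assms continuous_map_image_subset_topspace unfolding Meas_def by fast
  moreover have "continuous_map X T f \<Longrightarrow> continuous_map X T' (\<lambda>s. q (f s))" for X
    using continuous_map_compose[OF _ assms(2), of X f] by (simp add: comp_def)
  ultimately show ?thesis
    using assms(1) unfolding Meas_def by (simp, meson)
qed

section \<open>The Hahn-Banach theorem for seminorms on carriers\<close>

lemma complex_module_simps [simp]:
  "carrier complex_module = UNIV" "add complex_module = (+)" "smult complex_module = (*)"
  by (simp_all add: complex_module_def complex_ring_def ring.defs)

locale complex_space = Module.module complex_ring M for M :: "(complex, 'v) module" (structure)
begin

lemma scale_closed [simp, intro]: "x \<in> carrier M \<Longrightarrow> c \<odot> x \<in> carrier M"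
  using smult_closed[of c x] by (simp add: complex_ring_def)

lemma scale_add_left: "x \<in> carrier M \<Longrightarrow> (a + b) \<odot> x = a \<odot> x \<oplus> b \<odot> x"
  using smult_l_distr[of a b x] by (simp add: complex_ring_def)

lemma scale_add_right: "x \<in> carrier M \<Longrightarrow> y \<in> carrier M \<Longrightarrow> c \<odot> (x \<oplus> y) = c \<odot> x \<oplus> c \<odot> y"
  using smult_r_distr[of c x y] by (simp add: complex_ring_def)

lemma scale_scale: "x \<in> carrier M \<Longrightarrow> a \<odot> (b \<odot> x) = (a * b) \<odot> x"
  using smult_assoc1[of a b x] by (simp add: complex_ring_def)

lemma scale_one [simp]: "x \<in> carrier M \<Longrightarrow> 1 \<odot> x = x"
  using smult_one[of x] by (simp add: complex_ring_def)

lemma scale_zero_left [simp]: "x \<in> carrier M \<Longrightarrow> 0 \<odot> x = \<zero>"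
  using smult_l_null[of x] by (simp add: complex_ring_def)

lemma scale_zero_right [simp]: "c \<odot> \<zero> = \<zero>"
  using smult_r_null[of c] by (simp add: complex_ring_def)

lemma uminus_eq_scale: "x \<in> carrier M \<Longrightarrow> \<ominus> x = (-1) \<odot> x"
  using scale_add_left[of x "-1" 1] by (intro M.minus_equality) auto

lemma minus_eq_scale: "y \<in> carrier M \<Longrightarrow> x \<ominus> y = x \<oplus> (-1) \<odot> y"
  by (simp add: a_minus_def uminus_eq_scale)

definition sublinear :: "('v \<Rightarrow> real) \<Rightarrow> bool" where
  "sublinear q \<longleftrightarrow> (\<forall>x\<in>carrier M. \<forall>y\<in>carrier M. q (x \<oplus> y) \<le> q x + q y) \<and>
     (\<forall>t\<ge>0. \<forall>x\<in>carrier M. q (of_real t \<odot> x) = t * q x)"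

text \<open>Homogeneity as an inequality suffices: applied to \<open>inverse t\<close> it gives the
  reverse inequality.\<close>

lemma sublinearI:
  assumes add: "\<And>x y. x \<in> carrier M \<Longrightarrow> y \<in> carrier M \<Longrightarrow> q (x \<oplus> y) \<le> q x + q y"
    and zero: "q \<zero> = 0"
    and scale: "\<And>t x. 0 < t \<Longrightarrow> x \<in> carrier M \<Longrightarrow> q (of_real t \<odot> x) \<le> t * q x"
  shows "sublinear q"
proof -
  have "q (of_real t \<odot> x) = t * q x" if "0 \<le> t" "x \<in> carrier M" for t x
  proof (cases "t = 0")
    case False
    then have t: "0 < t" using that by simp
    have "q (of_real (inverse t) \<odot> (of_real t \<odot> x)) \<le> inverse t * q (of_real t \<odot> x)"
      using t that by (intro scale) auto
    moreover have "of_real (inverse t) \<odot> (of_real t \<odot> x) = x"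
      using t that by (simp add: scale_scale del: of_real_inverse flip: of_real_mult)
    ultimately have "t * q x \<le> q (of_real t \<odot> x)"
      using t by (simp add: field_simps)
    with scale[OF t that(2)] show ?thesis by simp
  qed (use that zero in simp)
  then show ?thesis using add by (simp add: sublinear_def)
qed

lemma sublinear_add: "sublinear q \<Longrightarrow> x \<in> carrier M \<Longrightarrow> y \<in> carrier M \<Longrightarrow> q (x \<oplus> y) \<le> q x + q y"
  by (simp add: sublinear_def)

lemma sublinear_scale: "sublinear q \<Longrightarrow> 0 \<le> t \<Longrightarrow> x \<in> carrier M \<Longrightarrow> q (of_real t \<odot> x) = t * q x"
  by (simp add: sublinear_def)

lemma sublinear_zero: "sublinear q \<Longrightarrow> q \<zero> = 0"
  using sublinear_scale[of q 0 \<zero>] by simp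

lemma sublinear_minus: "sublinear q \<Longrightarrow> x \<in> carrier M \<Longrightarrow> - q (\<ominus> x) \<le> q x"
  using sublinear_add[of q x "\<ominus> x"] sublinear_zero[of q] by (simp add: M.r_neg)

text \<open>The infimum of \<open>q (x + t y) - t q y\<close> over \<open>t \<ge> 0\<close>; the
  values \<open>t = 0\<close> and \<open>t = 1\<close> give the two bounds. The value off the
  carrier is fixed at 0 because the order used with Zorn's lemma compares functions on the whole
  type, where free values there would leave chains without lower bounds.\<close>

lemma sublinear_shift:
  assumes q: "sublinear q" and y: "y \<in> carrier M"
  obtains r where "sublinear r" "\<And>x. x \<in> carrier M \<Longrightarrow> r x \<le> q x"
    "\<And>x. x \<in> carrier M \<Longrightarrow> r x \<le> q (x \<oplus> y) - q y" "\<And>x. x \<notin> carrier M \<Longrightarrow> r x = 0"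
proof -
  define d where "d t x = q (x \<oplus> of_real t \<odot> y) - t * q y" for t x
  define r where "r x = (if x \<in> carrier M then INF t\<in>{0..}. d t x else 0)" for x
  have ge: "- q (\<ominus> x) \<le> d t x" if "x \<in> carrier M" "0 \<le> t" for t x
  proof -
    have "t * q y = q ((x \<oplus> of_real t \<odot> y) \<oplus> \<ominus> x)"
      using that y sublinear_scale[OF q that(2) y] by (simp add: M.a_ac M.r_neg2 M.r_neg1)
    also have "\<dots> \<le> q (x \<oplus> of_real t \<odot> y) + q (\<ominus> x)"
      using that y by (intro sublinear_add[OF q]) auto
    finally show ?thesis by (simp add: d_def)
  qed
  then have bdd: "bdd_below ((\<lambda>t. d t x) ` {0..})" if "x \<in> carrier M" for x
    using that by (intro bdd_belowI2[of _ "- q (\<ominus> x)"]) auto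
  have le: "r x \<le> d t x" if "x \<in> carrier M" "0 \<le> t" for t x
    using that cINF_lower[OF bdd[OF that(1)], of t] by (simp add: r_def)
  have greatest: "a \<le> r x" if "x \<in> carrier M" "\<And>t. 0 \<le> t \<Longrightarrow> a \<le> d t x" for a x
    using that unfolding r_def by (auto intro: cINF_greatest)
  have "sublinear r"
  proof (rule sublinearI)
    fix x z assume xz: "x \<in> carrier M" "z \<in> carrier M"
    \<comment> \<open>Separate parameters for the two summands: a shift by \<open>s + t\<close> is
      distributed over them, and the two infima are then taken one after the other.\<close>
    have *: "r (x \<oplus> z) \<le> d s x + d t z" if st: "0 \<le> s" "0 \<le> t" for s t
    proof -
      have "r (x \<oplus> z) \<le> d (s + t) (x \<oplus> z)" using xz st by (intro le) auto
      also have "(x \<oplus> z) \<oplus> of_real (s + t) \<odot> y = (x \<oplus> of_real s \<odot> y) \<oplus> (z \<oplus> of_real t \<odot> y)"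
        using xz y by (simp add: scale_add_left M.a_ac)
      then have "d (s + t) (x \<oplus> z) \<le> d s x + d t z"
        using sublinear_add[OF q, of "x \<oplus> of_real s \<odot> y" "z \<oplus> of_real t \<odot> y"] xz y
        by (simp add: d_def algebra_simps)
      finally show ?thesis .
    qed
    have "r (x \<oplus> z) - d t z \<le> r x" if "0 \<le> t" for t
      using *[OF _ that] by (intro greatest xz) (simp add: algebra_simps)
    then have "r (x \<oplus> z) - r x \<le> r z" by (intro greatest xz) (simp add: algebra_simps)
    then show "r (x \<oplus> z) \<le> r x + r z" by simp
  next
    have "d t \<zero> = 0" if "0 \<le> t" for t
      using y that by (simp add: d_def sublinear_scale[OF q])
    then show "r \<zero> = 0" using le[of \<zero> 0] greatest[of \<zero> 0] by (auto intro: antisym)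
  next
    fix t x assume t: "0 < (t::real)" and x: "x \<in> carrier M"
    have "inverse t * r (of_real t \<odot> x) \<le> r x"
    proof (rule greatest[OF x])
      fix s :: real assume s: "0 \<le> s"
      have "r (of_real t \<odot> x) \<le> d (t * s) (of_real t \<odot> x)" using t s x by (intro le) auto
      also have "of_real t \<odot> x \<oplus> of_real (t * s) \<odot> y = of_real t \<odot> (x \<oplus> of_real s \<odot> y)"
        using x y by (simp add: scale_add_right scale_scale)
      then have "d (t * s) (of_real t \<odot> x) = t * d s x"
        using x y t by (simp add: d_def sublinear_scale[OF q] algebra_simps)
      finally show "inverse t * r (of_real t \<odot> x) \<le> d s x" using t by (simp add: field_simps)
    qed
    then show "r (of_real t \<odot> x) \<le> t * r x" using t by (simp add: field_simps)
  qed
  moreover have "r x \<le> q x" if "x \<in> carrier M" for x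
    using le[OF that, of 0] that y by (simp add: d_def)
  moreover have "r x \<le> q (x \<oplus> y) - q y" if "x \<in> carrier M" for x
    using le[OF that, of 1] that y by (simp add: d_def)
  ultimately show ?thesis by (intro that[of r]) (auto simp: r_def)
qed

text \<open>A pointwise minimal sublinear functional is additive, so no extension step is needed.\<close>

lemma sublinear_dominates_additive:
  assumes p: "sublinear p"
  obtains f where "sublinear f" "\<And>x. x \<in> carrier M \<Longrightarrow> f x \<le> p x"
    "\<And>x y. x \<in> carrier M \<Longrightarrow> y \<in> carrier M \<Longrightarrow> f (x \<oplus> y) = f x + f y"
proof -
  define A where "A = {q. sublinear q \<and> (\<forall>x\<in>carrier M. q x \<le> p x) \<and> (\<forall>x. x \<notin> carrier M \<longrightarrow> q x = 0)}"
  \<comment> \<open>The order is reversed, so that a maximal element from Zorn's lemma is a minimal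
    functional.\<close>
  define P where "P a b \<longleftrightarrow> (\<forall>x::'v. b x \<le> (a x :: real))" for a b
  have "partial_order_on A (relation_of P A)"
    by (rule partial_order_on_relation_ofI) (auto simp: P_def fun_eq_iff intro: order_trans antisym)
  moreover have "\<exists>u\<in>A. \<forall>a\<in>C. P a u" if chain: "C \<in> Chains (relation_of P A)" for C
  proof (cases "C = {}")
    case True
    \<comment> \<open>The functional \<open>p\<close> may be nonzero off the carrier and thus lie
      outside \<open>A\<close>; its shift by the zero vector is normalised.\<close>
    obtain r where r: "sublinear r" "\<And>x. x \<in> carrier M \<Longrightarrow> r x \<le> p x" "\<And>x. x \<notin> carrier M \<Longrightarrow> r x = 0"
      using sublinear_shift[OF p M.zero_closed] by metis
    then have "r \<in> A" by (auto simp: A_def)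
    then show ?thesis using True by auto
  next
    case False
    have CA: "q \<in> A" if "q \<in> C" for q
      using chain that unfolding Chains_def relation_of_def by auto
    have tot: "P a b \<or> P b a" if "a \<in> C" "b \<in> C" for a b
      using chain that unfolding Chains_def relation_of_def by auto
    define u where "u x = (INF q\<in>C. q x)" for x
    have bdd: "bdd_below ((\<lambda>q. q x) ` C)" for x
    proof (cases "x \<in> carrier M")
      case True
      show ?thesis
      proof (rule bdd_belowI2)
        fix q assume "q \<in> C"
        then have "sublinear q" "q (\<ominus> x) \<le> p (\<ominus> x)" using CA True by (auto simp: A_def)
        then show "- p (\<ominus> x) \<le> q x" using sublinear_minus[of q x] True by linarith
      qed
    next
      case False
      then have "q x = 0" if "q \<in> C" for q using CA[OF that] by (simp add: A_def)
      then show ?thesis by (intro bdd_belowI2[of _ 0]) (metis order_refl)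
    qed
    have le: "u x \<le> q x" if "q \<in> C" for q x
      unfolding u_def using bdd that by (rule cINF_lower)
    have greatest: "a \<le> u x" if "\<And>q. q \<in> C \<Longrightarrow> a \<le> q x" for a x
      unfolding u_def using False that by (rule cINF_greatest)
    have const: "u x = 0" if "\<And>q. q \<in> C \<Longrightarrow> q x = 0" for x
    proof (rule antisym)
      show "u x \<le> 0" using False le[of _ x] that by (metis all_not_in_conv)
      show "0 \<le> u x" using that by (intro greatest) (metis order_refl)
    qed
    have "sublinear u"
    proof (rule sublinearI)
      fix x y assume xy: "x \<in> carrier M" "y \<in> carrier M"
      have *: "u (x \<oplus> y) \<le> a x + b y" if ab: "a \<in> C" "b \<in> C" for a b
      proof -
        \<comment> \<open>In a chain the smaller of \<open>a\<close> and \<open>b\<close> lies below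
          both, so a single functional handles both arguments.\<close>
        obtain c where c: "c \<in> C" "c x \<le> a x" "c y \<le> b y"
          using tot[OF ab] ab unfolding P_def by blast
        have "u (x \<oplus> y) \<le> c (x \<oplus> y)" using le c(1) .
        also have "\<dots> \<le> c x + c y" using CA[OF c(1)] xy by (auto simp: A_def intro: sublinear_add)
        finally show ?thesis using c by linarith
      qed
      have "u (x \<oplus> y) - b y \<le> u x" if "b \<in> C" for b
        using *[OF _ that] by (intro greatest) (simp add: algebra_simps)
      then have "u (x \<oplus> y) - u x \<le> u y" by (intro greatest) (simp add: algebra_simps)
      then show "u (x \<oplus> y) \<le> u x + u y" by simp
    next
      have "q \<zero> = 0" if "q \<in> C" for q using CA[OF that] by (auto simp: A_def sublinear_zero)
      then show "u \<zero> = 0" by (rule const)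
    next
      fix t x assume t: "0 < (t::real)" and x: "x \<in> carrier M"
      have "inverse t * u (of_real t \<odot> x) \<le> u x"
      proof (rule greatest)
        fix q assume q: "q \<in> C"
        have "u (of_real t \<odot> x) \<le> q (of_real t \<odot> x)" using le q .
        also have "\<dots> = t * q x" using CA[OF q] t x by (auto simp: A_def sublinear_scale)
        finally show "inverse t * u (of_real t \<odot> x) \<le> q x" using t by (simp add: field_simps)
      qed
      then show "u (of_real t \<odot> x) \<le> t * u x" using t by (simp add: field_simps)
    qed
    moreover have "u x \<le> p x" if "x \<in> carrier M" for x
      using False le[of _ x] CA that unfolding A_def by (blast intro: order_trans)
    moreover have "u x = 0" if "x \<notin> carrier M" for x
    proof -
      have "q x = 0" if "q \<in> C" for q using CA[OF that] \<open>x \<notin> carrier M\<close> by (auto simp: A_def)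
      then show ?thesis by (rule const)
    qed
    ultimately have "u \<in> A" by (auto simp: A_def)
    then show ?thesis using le by (auto simp: P_def)
  qed
  ultimately obtain f where f: "f \<in> A" "\<And>a. a \<in> A \<Longrightarrow> P f a \<Longrightarrow> a = f"
    using predicate_Zorn[of A P] by blast
  have sub: "sublinear f" using f(1) by (simp add: A_def)
  have "f (x \<oplus> y) = f x + f y" if xy: "x \<in> carrier M" "y \<in> carrier M" for x y
  proof -
    \<comment> \<open>By minimality the shift by \<open>y\<close> equals \<open>f\<close>, which
      turns its second bound into \<open>f x \<le> f (x + y) - f y\<close>, the reverse of
      subadditivity.\<close>
    obtain r where r: "sublinear r" "\<And>x. x \<in> carrier M \<Longrightarrow> r x \<le> f x"
      "\<And>x. x \<in> carrier M \<Longrightarrow> r x \<le> f (x \<oplus> y) - f y" "\<And>x. x \<notin> carrier M \<Longrightarrow> r x = 0"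
      using sublinear_shift[OF sub xy(2)] by metis
    have "r \<in> A" using r f(1) by (fastforce simp: A_def intro: order_trans)
    moreover have "P f r" unfolding P_def
    proof
      show "r z \<le> f z" for z using r(2,4) f(1) by (cases "z \<in> carrier M") (auto simp: A_def)
    qed
    ultimately have "r = f" by (rule f(2))
    then show ?thesis using r(3)[OF xy(1)] sublinear_add[OF sub xy] by simp
  qed
  then show ?thesis using f(1) by (intro that[of f]) (auto simp: A_def)
qed

lemma seminorm_sublinear: "seminorm_on M p \<Longrightarrow> sublinear p"
  by (auto simp: seminorm_on_def sublinear_def)

text \<open>Shifting \<open>p\<close> by \<open>e\<close> before passing to an additive functional
  forces the value at \<open>\<ominus> e\<close> to be at most \<open>- p e\<close>; additivity
  turns this into \<open>f e \<ge> p e\<close>.\<close>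

lemma Hahn_Banach_seminorm:
  assumes p: "seminorm_on M p" and e: "e \<in> carrier M"
  obtains \<omega> where "linear_between M complex_module \<omega>" "\<And>v. v \<in> carrier M \<Longrightarrow> norm (\<omega> v) \<le> p v"
    "p e \<le> norm (\<omega> e)"
proof -
  obtain r where r: "sublinear r" "\<And>x. x \<in> carrier M \<Longrightarrow> r x \<le> p x"
      "\<And>x. x \<in> carrier M \<Longrightarrow> r x \<le> p (x \<oplus> e) - p e"
    using sublinear_shift[OF seminorm_sublinear[OF p] e] by metis
  obtain f where f: "sublinear f" "\<And>x. x \<in> carrier M \<Longrightarrow> f x \<le> r x"
    and add: "\<And>x y. x \<in> carrier M \<Longrightarrow> y \<in> carrier M \<Longrightarrow> f (x \<oplus> y) = f x + f y"
    using sublinear_dominates_additive[OF r(1)] by metis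
  have neg: "f (\<ominus> x) = - f x" if "x \<in> carrier M" for x
    using add[OF that, of "\<ominus> x"] that sublinear_zero[OF f(1)] by (simp add: M.r_neg)
  have real: "f (of_real t \<odot> x) = t * f x" if x: "x \<in> carrier M" for t x
  proof (cases "0 \<le> t")
    case False
    have "of_real t \<odot> x = \<ominus> (of_real (- t) \<odot> x)" using x by (simp add: uminus_eq_scale scale_scale)
    then show ?thesis using neg[of "of_real (- t) \<odot> x"] sublinear_scale[OF f(1) _ x, of "- t"] False x by simp
  qed (use x sublinear_scale[OF f(1)] in auto)
  have comb: "f (c \<odot> x) = Re c * f x + Im c * f (\<i> \<odot> x)" if x: "x \<in> carrier M" for c x
  proof -
    have "c \<odot> x = of_real (Re c) \<odot> x \<oplus> of_real (Im c) \<odot> (\<i> \<odot> x)"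
      using x scale_add_left[of x "of_real (Re c)" "of_real (Im c) * \<i>"] complex_eq[of c]
      by (simp add: scale_scale mult.commute)
    then show ?thesis using x by (simp add: add real)
  qed
  \<comment> \<open>The complex linear functional with real part \<open>f\<close>.\<close>
  define \<omega> where "\<omega> v = Complex (f v) (- f (\<i> \<odot> v))" for v
  have om_scale: "\<omega> (c \<odot> v) = c * \<omega> v" if v: "v \<in> carrier M" for c v
    using comb[OF v, of c] comb[OF v, of "\<i> * c"] v
    by (simp add: \<omega>_def scale_scale complex_eq_iff algebra_simps)
  have om_add: "\<omega> (v \<oplus> w) = \<omega> v + \<omega> w" if "v \<in> carrier M" "w \<in> carrier M" for v w
    using that by (simp add: \<omega>_def add scale_add_right complex_eq_iff)
  have "linear_between M complex_module \<omega>"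
    unfolding linear_between_def
    using om_scale om_add by simp
  moreover have "norm (\<omega> v) \<le> p v" if v: "v \<in> carrier M" for v
  proof (cases "\<omega> v = 0")
    case True
    then show ?thesis using p v by (simp add: seminorm_on_def)
  next
    case False
    \<comment> \<open>A unimodular factor that rotates \<open>\<omega> v\<close> onto the positive
      reals: the norm becomes the real part \<open>f\<close> at \<open>c v\<close>, and
      \<open>p\<close> does not see the rotation.\<close>
    define c where "c = cnj (\<omega> v) / norm (\<omega> v)"
    have c: "norm c = 1" "c * \<omega> v = of_real (norm (\<omega> v))"
      using False by (auto simp: c_def norm_divide complex_norm_square[symmetric] power2_eq_square mult.commute)
    have "norm (\<omega> v) = Re (\<omega> (c \<odot> v))" using om_scale[OF v] c(2) by simp
    also have "\<dots> = f (c \<odot> v)" by (simp add: \<omega>_def)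
    also have "\<dots> \<le> p (c \<odot> v)" using f(2)[of "c \<odot> v"] r(2)[of "c \<odot> v"] v by auto
    also have "\<dots> = p v" using p v c(1) by (simp add: seminorm_on_def)
    finally show ?thesis .
  qed
  moreover have "p e \<le> norm (\<omega> e)"
  proof -
    have "f (\<ominus> e) \<le> p \<zero> - p e"
      using f(2)[of "\<ominus> e"] r(3)[of "\<ominus> e"] e by (simp add: M.l_neg)
    then have "p e \<le> Re (\<omega> e)"
      using neg[OF e] sublinear_zero[OF seminorm_sublinear[OF p]] by (simp add: \<omega>_def)
    then show ?thesis using complex_Re_le_cmod[of "\<omega> e"] by linarith
  qed
  ultimately show ?thesis by (rule that)
qed

section \<open>Seminorm topologies\<close>

lemma seminorm_zero: "seminorm_on M p \<Longrightarrow> p \<zero> = 0"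
  by (intro sublinear_zero seminorm_sublinear)

lemma seminorm_uminus: "seminorm_on M p \<Longrightarrow> x \<in> carrier M \<Longrightarrow> p (\<ominus> x) = p x"
  by (simp add: uminus_eq_scale seminorm_on_def)

lemma seminorm_minus_commute:
  assumes "seminorm_on M p" "x \<in> carrier M" "y \<in> carrier M"
  shows "p (x \<ominus> y) = p (y \<ominus> x)"
proof -
  have "\<ominus> (x \<ominus> y) = y \<ominus> x" using assms by (simp add: M.minus_add M.minus_eq M.a_comm)
  then show ?thesis using seminorm_uminus[OF assms(1), of "x \<ominus> y"] assms by simp
qed

lemma seminorm_triangle_sub:
  assumes "seminorm_on M p" "x \<in> carrier M" "y \<in> carrier M"
  shows "p x \<le> p (x \<ominus> y) + p y"
proof -
  have "x = (x \<ominus> y) \<oplus> y" using assms by (simp add: M.minus_eq M.a_assoc M.l_neg)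
  then show ?thesis using assms unfolding seminorm_on_def by (metis M.minus_closed)
qed

lemma seminorm_triangle_minus:
  assumes "seminorm_on M p" "x \<in> carrier M" "y \<in> carrier M" "z \<in> carrier M"
  shows "p (x \<ominus> z) \<le> p (x \<ominus> y) + p (y \<ominus> z)"
proof -
  have "x \<ominus> z = (x \<ominus> y) \<oplus> (y \<ominus> z)"
    using assms by (simp add: M.minus_eq M.a_assoc M.r_neg1)
  then show ?thesis using assms by (simp add: seminorm_on_def)
qed

lemma seminorm_dist_le:
  assumes "seminorm_on M p" "x \<in> carrier M" "y \<in> carrier M"
  shows "dist (p x) (p y) \<le> p (x \<ominus> y)"
  using seminorm_triangle_sub[OF assms] seminorm_triangle_sub[OF assms(1,3,2)]
    seminorm_minus_commute[OF assms] by (auto simp: dist_real_def)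

lemma topspace_seminorm_topology: "topspace (seminorm_topology M P) = carrier M"
  unfolding seminorm_topology_def topology_generated_by_topspace by auto

lemma openin_seminorm_ball:
  assumes "p \<in> P" "v \<in> carrier M" "0 < r"
  shows "openin (seminorm_topology M P) {w \<in> carrier M. p (w \<ominus> v) < r}"
  unfolding seminorm_topology_def using assms by (intro topology_generated_by_Basis) auto

text \<open>Maps that are 1-Lipschitz for one of the generating seminorms; this covers the seminorms
  themselves and the functionals they dominate.\<close>

lemma continuous_map_seminorm_topology:
  fixes f :: "'v \<Rightarrow> 'b::metric_space"
  assumes p: "p \<in> P" "seminorm_on M p"
    and f: "\<And>v w. v \<in> carrier M \<Longrightarrow> w \<in> carrier M \<Longrightarrow> dist (f v) (f w) \<le> p (v \<ominus> w)"
  shows "continuous_map (seminorm_topology M P) euclidean f"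
  unfolding continuous_map_def topspace_seminorm_topology
proof (intro conjI allI impI)
  fix U :: "'b set" assume "openin euclidean U"
  then have U: "open U" by simp
  show "openin (seminorm_topology M P) {v \<in> carrier M. f v \<in> U}"
  proof (subst openin_subopen, clarify)
    fix v assume v: "v \<in> carrier M" "f v \<in> U"
    then obtain r where r: "0 < r" "\<And>b. dist b (f v) < r \<Longrightarrow> b \<in> U"
      using U unfolding open_dist by blast
    have "{w \<in> carrier M. p (w \<ominus> v) < r} \<subseteq> {v \<in> carrier M. f v \<in> U}"
      using f[OF _ v(1)] r(2) by force
    moreover have "v \<in> {w \<in> carrier M. p (w \<ominus> v) < r}"
      using v r(1) seminorm_zero[OF p(2)] by (simp add: M.minus_eq M.r_neg)
    ultimately show "\<exists>T. openin (seminorm_topology M P) T \<and> v \<in> T \<and> T \<subseteq> {v \<in> carrier M. f v \<in> U}"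
      using openin_seminorm_ball[OF p(1) v(1) r(1)] by blast
  qed
qed simp

text \<open>Induction over the generation of the topology reduces the claim to subbasic balls, where
  the triangle inequality gives both points the same distance to every centre.\<close>

lemma seminorm_topology_indistinguishable:
  assumes P: "\<And>p. p \<in> P \<Longrightarrow> seminorm_on M p" and vw: "v \<in> carrier M" "w \<in> carrier M"
    and eq: "\<forall>p\<in>P. p (v \<ominus> w) = 0" and U: "openin (seminorm_topology M P) U"
  shows "v \<in> U \<longleftrightarrow> w \<in> U"
proof -
  have "generate_topology_on (insert (carrier M)
        {{w \<in> carrier M. p (w \<ominus> v) < r} | p v r. p \<in> P \<and> v \<in> carrier M \<and> 0 < r}) U"
    using U by (simp add: seminorm_topology_def openin_topology_generated_by_iff)
  then show ?thesis
  proof induction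
    case (Basis s)
    have sem_eq: "p (v \<ominus> a) = p (w \<ominus> a)" if "p \<in> P" "a \<in> carrier M" for p a
      using seminorm_triangle_minus[OF P[OF that(1)] vw that(2)]
        seminorm_triangle_minus[OF P[OF that(1)] vw(2,1) that(2)]
        bspec[OF eq that(1)] seminorm_minus_commute[OF P[OF that(1)] vw] by linarith
    have "v \<in> {u \<in> carrier M. p (u \<ominus> a) < r} \<longleftrightarrow> w \<in> {u \<in> carrier M. p (u \<ominus> a) < r}"
      if "p \<in> P" "a \<in> carrier M" for p a r
      using vw sem_eq[OF that] by simp
    then show ?case using Basis vw by blast
  qed auto
qed

lemma seminorm_separating:
  assumes P: "\<And>p. p \<in> P \<Longrightarrow> seminorm_on M p" and vw: "v \<in> carrier M" "w \<in> carrier M"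
    and eq: "\<forall>p\<in>P. p (v \<ominus> w) = 0" and "Hausdorff_space (seminorm_topology M P)"
  shows "v = w"
proof (rule ccontr)
  assume "v \<noteq> w"
  then obtain U V where "openin (seminorm_topology M P) U" "v \<in> U" "w \<in> V" "disjnt U V"
    using assms(5) vw unfolding Hausdorff_space_def topspace_seminorm_topology by blast
  then show False
    using seminorm_topology_indistinguishable[OF P vw eq, of U]
    by (auto simp: disjnt_def)
qed

lemma dual_minus:
  assumes "\<omega> \<in> dual M T" "x \<in> carrier M" "y \<in> carrier M"
  shows "\<omega> (x \<ominus> y) = \<omega> x - \<omega> y"
proof -
  have "\<omega> (x \<oplus> (-1) \<odot> y) = \<omega> x + (-1) * \<omega> y"
    using assms by (simp add: dual_def linear_between_def)
  then show ?thesis using assms by (simp add: M.minus_eq uminus_eq_scale)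
qed

section \<open>Weak integrals\<close>

text \<open>Phrased with explicit values \<open>d\<close> and \<open>e\<close> because uniqueness of
  the weak integral is obtained from it below, with \<open>f\<close> in both places.\<close>

lemma L1_minus:
  assumes "radon \<mu>" "f \<in> L1 M T \<mu>" "g \<in> L1 M T \<mu>" "has_weak_integral M T \<mu> f d" "has_weak_integral M T \<mu> g e"
  shows "(\<lambda>s. f s \<ominus> g s) \<in> L1 M T \<mu>" "has_weak_integral M T \<mu> (\<lambda>s. f s \<ominus> g s) (d \<ominus> e)"
proof -
  interpret radon \<mu> by fact
  have car: "f s \<in> carrier M" "g s \<in> carrier M" for s using assms(2,3) by (auto simp: L1_def)
  have de: "d \<in> carrier M" "e \<in> carrier M" using assms(4,5) by (auto simp: has_weak_integral_def)
  have *: "ess_integrable \<mu> (\<lambda>s. \<omega> (f s))" "ess_integrable \<mu> (\<lambda>s. \<omega> (g s))"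
    "(\<lambda>s. \<omega> (f s \<ominus> g s)) = (\<lambda>s. \<omega> (f s) - \<omega> (g s))" if "\<omega> \<in> dual M T" for \<omega>
    using assms(2,3) that car by (auto simp: L1_def dual_minus)
  show w: "has_weak_integral M T \<mu> (\<lambda>s. f s \<ominus> g s) (d \<ominus> e)"
    using assms(4,5) de * by (auto simp: has_weak_integral_def ess_integral_diff dual_minus)
  have "ess_integrable \<mu> (\<lambda>s. \<omega> (f s \<ominus> g s))" if "\<omega> \<in> dual M T" for \<omega>
    using *[OF that] has_ess_integral_diff unfolding ess_integrable_def by metis
  with w show "(\<lambda>s. f s \<ominus> g s) \<in> L1 M T \<mu>" using car by (auto simp: L1_def)
qed

text \<open>A functional dominated by \<open>p\<close> that attains \<open>p e\<close> at
  \<open>e\<close> reduces the claim to the scalar estimate. It is continuous because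
  \<open>p\<close> belongs to the generating family.\<close>

lemma seminorm_weak_integral_le:
  assumes "radon \<mu>" and T: "T = seminorm_topology M P" and p: "p \<in> P" "seminorm_on M p"
    and f: "f \<in> L1 M T \<mu>" and e: "has_weak_integral M T \<mu> f e"
  shows "ennreal (p e) \<le> ess_upper_integral \<mu> (\<lambda>s. ennreal (p (f s)))"
proof -
  interpret radon \<mu> by fact
  have car: "f s \<in> carrier M" for s using f by (auto simp: L1_def)
  have "e \<in> carrier M" using e by (simp add: has_weak_integral_def)
  then obtain \<omega> where \<omega>: "linear_between M complex_module \<omega>" "\<And>v. v \<in> carrier M \<Longrightarrow> norm (\<omega> v) \<le> p v"
      "p e \<le> norm (\<omega> e)"
    using Hahn_Banach_seminorm[OF p(2)] by metis
  have "dist (\<omega> v) (\<omega> w) \<le> p (v \<ominus> w)" if "v \<in> carrier M" "w \<in> carrier M" for v w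
  proof -
    have "\<omega> (v \<oplus> (-1) \<odot> w) = \<omega> v + (-1) * \<omega> w"
      using \<omega>(1) that by (simp add: linear_between_def)
    then have "\<omega> (v \<ominus> w) = \<omega> v - \<omega> w" using that by (simp add: M.minus_eq uminus_eq_scale)
    then show ?thesis using \<omega>(2)[of "v \<ominus> w"] that by (simp add: dist_norm)
  qed
  then have dual: "\<omega> \<in> dual M T"
    unfolding dual_def T using \<omega>(1) continuous_map_seminorm_topology[OF p] by blast
  have "ennreal (p e) \<le> ennreal (norm (\<omega> e))" using \<omega>(3) by (rule ennreal_leI)
  also have "\<omega> e = ess_integral \<mu> (\<lambda>s. \<omega> (f s))" using e dual by (simp add: has_weak_integral_def)
  also have "ennreal (norm \<dots>) \<le> ess_upper_integral \<mu> (\<lambda>s. ennreal (norm (\<omega> (f s))))"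
    using f dual by (intro norm_ess_integral_le) (simp add: L1_def)
  also have "\<dots> \<le> ess_upper_integral \<mu> (\<lambda>s. ennreal (p (f s)))"
    using \<omega>(2)[OF car] by (intro ess_upper_integral_mono ennreal_leI)
  finally show ?thesis .
qed

text \<open>Makes the description in \<open>weak_integral\<close> definite: the difference of two
  candidates is a weak integral of zero, so all seminorms vanish on it, and the Hausdorff property
  separates points.\<close>

lemma has_weak_integral_weak_integral:
  assumes "radon \<mu>" and T: "T = seminorm_topology M P" and P: "\<And>p. p \<in> P \<Longrightarrow> seminorm_on M p"
    and H: "Hausdorff_space T" and f: "f \<in> L1 M T \<mu>"
  shows "has_weak_integral M T \<mu> f (weak_integral M T \<mu> f)"
proof -
  interpret radon \<mu> by fact
  have car: "f s \<in> carrier M" for s using f by (auto simp: L1_def)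
  obtain e where e: "has_weak_integral M T \<mu> f e" using f by (auto simp: L1_def)
  have "d = e" if d: "has_weak_integral M T \<mu> f d" for d
  proof (rule seminorm_separating[where P = P])
    show "d \<in> carrier M" "e \<in> carrier M" using d e by (auto simp: has_weak_integral_def)
    show "Hausdorff_space (seminorm_topology M P)" using H T by simp
    show "\<forall>p\<in>P. p (d \<ominus> e) = 0"
    proof
      fix p assume p: "p \<in> P"
      have "ennreal (p (d \<ominus> e)) \<le> ess_upper_integral \<mu> (\<lambda>s. ennreal (p (f s \<ominus> f s)))"
        using L1_minus[OF assms(1) f f d e] by (rule seminorm_weak_integral_le[OF assms(1) T p P[OF p]])
      also have "(\<lambda>s. ennreal (p (f s \<ominus> f s))) = (\<lambda>s. 0)"
        using car seminorm_zero[OF P[OF p]] by (simp add: M.minus_eq M.r_neg)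
      finally have "p (d \<ominus> e) \<le> 0" by (simp add: ess_upper_integral_zero ennreal_eq_0_iff)
      moreover have "0 \<le> p (d \<ominus> e)"
        using P[OF p] \<open>d \<in> carrier M\<close> \<open>e \<in> carrier M\<close> by (simp add: seminorm_on_def)
      ultimately show "p (d \<ominus> e) = 0" by simp
    qed
  qed (rule P)
  with e show ?thesis unfolding weak_integral_def by (metis theI)
qed

end

section \<open>Sections of bundles\<close>

lemma carrier_stalk_module [simp]: "carrier (stalk_module \<BB> z) = stalk \<BB> z"
  by (simp add: stalk_module_def)

lemma Gamma_in_stalk: "\<sigma> \<in> \<Gamma> \<BB> \<Longrightarrow> \<sigma> z \<in> stalk \<BB> z"
  by (auto simp: csections_def bounded_sections_def)

lemma Gamma_through_in_stalk: "\<sigma> \<in> \<Gamma>_through \<BB> S x \<Longrightarrow> \<sigma> z \<in> stalk \<BB> z"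
  by (auto simp: \<Gamma>_through_def csections_at_def bounded_sections_def)

locale obundle =
  fixes \<BB> :: "('e, 'x::topological_space, 'j) bundle_data"
  assumes omega_bundle: "omega_bundle \<BB>"
begin

lemma complex_space_stalk: "complex_space (stalk_module \<BB> z)"
  using omega_bundle by (simp add: omega_bundle_def complex_space_def)

lemma seminorm_stalk: "j \<in> bidx \<BB> \<Longrightarrow> seminorm_on (stalk_module \<BB> z) (bsem \<BB> j)"
  using omega_bundle by (simp add: omega_bundle_def)

lemma stalk_top_eq: "stalk_top \<BB> z = seminorm_topology (stalk_module \<BB> z) (bsem \<BB> ` bidx \<BB>)"
  using omega_bundle by (simp add: omega_bundle_def)

lemma Hausdorff_stalk_top: "Hausdorff_space (stalk_top \<BB> z)"
  using omega_bundle unfolding omega_bundle_def by (elim conjE) simp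

lemma openin_eq_tubes: "openin (btop \<BB>) = arbitrary union_of
    (\<lambda>W. \<exists>U \<sigma> \<epsilon> j. open U \<and> \<sigma> \<in> csections \<BB> U \<and> 0 < \<epsilon> \<and> j \<in> bidx \<BB> \<and> W = tube \<BB> U \<sigma> \<epsilon> j)"
  using omega_bundle unfolding omega_bundle_def by (elim conjE)

lemma openin_tube:
  assumes "open U" "\<sigma> \<in> csections \<BB> U" "0 < \<epsilon>" "j \<in> bidx \<BB>"
  shows "openin (btop \<BB>) (tube \<BB> U \<sigma> \<epsilon> j)"
  unfolding openin_eq_tubes using assms by (intro arbitrary_union_of_inc) blast

lemma open_contains_tube:
  assumes "openin (btop \<BB>) W" "e \<in> W"
  obtains U \<sigma> \<epsilon> j where "open U" "\<sigma> \<in> csections \<BB> U" "0 < \<epsilon>" "j \<in> bidx \<BB>"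
    "e \<in> tube \<BB> U \<sigma> \<epsilon> j" "tube \<BB> U \<sigma> \<epsilon> j \<subseteq> W"
proof -
  obtain \<W> where \<W>: "\<forall>V\<in>\<W>. \<exists>U \<sigma> \<epsilon> j. open U \<and> \<sigma> \<in> csections \<BB> U \<and> 0 < \<epsilon> \<and> j \<in> bidx \<BB> \<and> V = tube \<BB> U \<sigma> \<epsilon> j"
      and W: "\<Union>\<W> = W"
    using assms(1) unfolding openin_eq_tubes union_of_def by (auto simp only: subset_eq mem_Collect_eq)
  obtain V where V: "V \<in> \<W>" "e \<in> V" using W assms(2) by auto
  show ?thesis using bspec[OF \<W> V(1)] V W that by (metis Union_upper)
qed

text \<open>Subtraction in \<open>stalk_module\<close> is formed with additive inverses, whereas
  bundles of maps have only addition and scaling prescribed pointwise; scaling by -1 links the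
  two.\<close>

lemma stalk_minus:
  assumes "a \<in> stalk \<BB> z" "b \<in> stalk \<BB> z"
  shows "a \<ominus>\<^bsub>stalk_module \<BB> z\<^esub> b = badd \<BB> a (bscale \<BB> (-1) b)"
  using complex_space.minus_eq_scale[OF complex_space_stalk, of b z a] assms
  by (simp add: stalk_module_def)

lemma scale_in_stalk: "a \<in> stalk \<BB> z \<Longrightarrow> bscale \<BB> c a \<in> stalk \<BB> z"
  using complex_space.scale_closed[OF complex_space_stalk, of a z c] by (simp add: stalk_module_def)

lemma minus_in_stalk: "a \<in> stalk \<BB> z \<Longrightarrow> b \<in> stalk \<BB> z \<Longrightarrow> a \<ominus>\<^bsub>stalk_module \<BB> z\<^esub> b \<in> stalk \<BB> z"
  using abelian_group.minus_closed[OF Module.module.axioms(2)[OF complex_space.axioms[OF complex_space_stalk]], of a z b]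
  by simp

lemma sem_nonneg: "j \<in> bidx \<BB> \<Longrightarrow> a \<in> stalk \<BB> z \<Longrightarrow> 0 \<le> bsem \<BB> j a"
  using seminorm_stalk[of j z] by (simp add: seminorm_on_def)

lemma sem_triangle:
  assumes "j \<in> bidx \<BB>" "a \<in> stalk \<BB> z" "b \<in> stalk \<BB> z" "c \<in> stalk \<BB> z"
  shows "bsem \<BB> j (a \<ominus>\<^bsub>stalk_module \<BB> z\<^esub> c) \<le>
    bsem \<BB> j (a \<ominus>\<^bsub>stalk_module \<BB> z\<^esub> b) + bsem \<BB> j (b \<ominus>\<^bsub>stalk_module \<BB> z\<^esub> c)"
  using complex_space.seminorm_triangle_minus[OF complex_space_stalk seminorm_stalk[OF assms(1)]] assms(2-)
  by simp

lemma sem_minus_le: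
  assumes "j \<in> bidx \<BB>" "a \<in> stalk \<BB> z" "b \<in> stalk \<BB> z"
  shows "bsem \<BB> j (a \<ominus>\<^bsub>stalk_module \<BB> z\<^esub> b) \<le> bsem \<BB> j a + bsem \<BB> j b"
proof -
  have "bsem \<BB> j (a \<oplus>\<^bsub>stalk_module \<BB> z\<^esub> (-1) \<odot>\<^bsub>stalk_module \<BB> z\<^esub> b)
      \<le> bsem \<BB> j a + bsem \<BB> j ((-1) \<odot>\<^bsub>stalk_module \<BB> z\<^esub> b)"
    using seminorm_stalk[OF assms(1), of z] assms complex_space.scale_closed[OF complex_space_stalk, of b z "-1"]
    unfolding seminorm_on_def carrier_stalk_module by blast
  also have "bsem \<BB> j ((-1) \<odot>\<^bsub>stalk_module \<BB> z\<^esub> b) = bsem \<BB> j b"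
    using seminorm_stalk[OF assms(1), of z] assms by (simp add: seminorm_on_def)
  finally show ?thesis
    using complex_space.minus_eq_scale[OF complex_space_stalk, of b z a] assms by simp
qed

lemma sem_minus_self:
  assumes "j \<in> bidx \<BB>" "a \<in> stalk \<BB> z"
  shows "bsem \<BB> j (a \<ominus>\<^bsub>stalk_module \<BB> z\<^esub> a) = 0"
proof -
  interpret complex_space "stalk_module \<BB> z" by (rule complex_space_stalk)
  show ?thesis using assms seminorm_zero[OF seminorm_stalk[OF assms(1)]] by (simp add: M.minus_eq M.r_neg)
qed

lemma continuous_sem:
  assumes "j \<in> bidx \<BB>"
  shows "continuous_map (stalk_top \<BB> z) euclidean (bsem \<BB> j)"
  unfolding stalk_top_eq using assms complex_space.seminorm_dist_le[OF complex_space_stalk seminorm_stalk[OF assms]]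
  by (intro complex_space.continuous_map_seminorm_topology[OF complex_space_stalk, where p = "bsem \<BB> j"] seminorm_stalk) auto

text \<open>The tube around the global section \<open>F\<close> is an open neighbourhood of
  \<open>H x\<close>.\<close>

lemma csections_at_close:
  assumes H: "H \<in> csections_at \<BB> UNIV x" and F: "F \<in> \<Gamma> \<BB>" and eq: "H x = F x"
    and j: "j \<in> bidx \<BB>" and \<epsilon>: "0 < \<epsilon>"
  shows "eventually (\<lambda>z. bsem \<BB> j (H z \<ominus>\<^bsub>stalk_module \<BB> z\<^esub> F z) < \<epsilon>) (nhds x)"
proof -
  have st: "H z \<in> stalk \<BB> z" for z using H by (auto simp: csections_at_def bounded_sections_def)
  have "H x \<in> tube \<BB> UNIV F \<epsilon> j"
    using st[of x] sem_minus_self[OF j st[of x]] eq \<epsilon> by (simp add: tube_def stalk_def)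
  moreover have "openin (btop \<BB>) (tube \<BB> UNIV F \<epsilon> j)"
    using F \<epsilon> j by (intro openin_tube) auto
  ultimately obtain U where U: "open U" "x \<in> U" "\<And>z. z \<in> U \<Longrightarrow> H z \<in> tube \<BB> UNIV F \<epsilon> j"
    using H unfolding csections_at_def topcontinuous_at_def by auto
  then show ?thesis
    unfolding eventually_nhds using st by (intro exI[of _ U]) (auto simp: tube_def stalk_def)
qed

text \<open>A basic neighbourhood of \<open>H x\<close> is a tube around some local section
  \<open>\<sigma>\<close> that need not pass through \<open>G x\<close>. Continuity of
  \<open>G\<close> keeps it in a thinner tube around \<open>\<sigma>\<close>, and closeness of
  \<open>H\<close> to \<open>G\<close> does the rest.\<close>

lemma csections_atI:
  assumes H: "H \<in> bounded_sections \<BB> UNIV" and G: "G \<in> \<Gamma> \<BB>" and eq: "H x = G x"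
    and close: "\<And>j \<epsilon>. j \<in> bidx \<BB> \<Longrightarrow> 0 < \<epsilon> \<Longrightarrow>
      eventually (\<lambda>z. bsem \<BB> j (H z \<ominus>\<^bsub>stalk_module \<BB> z\<^esub> G z) < \<epsilon>) (nhds x)"
  shows "H \<in> csections_at \<BB> UNIV x"
proof -
  have st: "H z \<in> stalk \<BB> z" "G z \<in> stalk \<BB> z" for z
    using H G Gamma_in_stalk by (auto simp: bounded_sections_def)
  have "\<exists>U. openin euclidean U \<and> x \<in> U \<and> (\<forall>z\<in>U. H z \<in> W)" if W: "openin (btop \<BB>) W" "H x \<in> W" for W
  proof -
    obtain U \<sigma> \<epsilon> j where t: "open U" "\<sigma> \<in> csections \<BB> U" "0 < \<epsilon>" "j \<in> bidx \<BB>"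
        "H x \<in> tube \<BB> U \<sigma> \<epsilon> j" "tube \<BB> U \<sigma> \<epsilon> j \<subseteq> W"
      using open_contains_tube[OF W] by metis
    have \<sigma>: "\<sigma> z \<in> stalk \<BB> z" if "z \<in> U" for z
      using t(2) that by (auto simp: csections_def bounded_sections_def)
    have xU: "x \<in> U" and lt: "bsem \<BB> j (G x \<ominus>\<^bsub>stalk_module \<BB> x\<^esub> \<sigma> x) < \<epsilon>"
      using t(5) st(1)[of x] eq by (auto simp: tube_def stalk_def)
    \<comment> \<open>The margin \<open>\<epsilon> - \<delta>\<close> is reserved for the distance
      between \<open>H\<close> and \<open>G\<close>.\<close>
    then obtain \<delta> where \<delta>: "bsem \<BB> j (G x \<ominus>\<^bsub>stalk_module \<BB> x\<^esub> \<sigma> x) < \<delta>" "\<delta> < \<epsilon>" using dense by blast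
    moreover have "0 \<le> bsem \<BB> j (G x \<ominus>\<^bsub>stalk_module \<BB> x\<^esub> \<sigma> x)"
      using sem_nonneg[OF t(4) minus_in_stalk[OF st(2) \<sigma>[OF xU]]] .
    ultimately have "0 < \<delta>" by linarith
    then have "openin (btop \<BB>) (tube \<BB> U \<sigma> \<delta> j)" using t by (intro openin_tube) auto
    then have "openin euclidean {z \<in> topspace euclidean. G z \<in> tube \<BB> U \<sigma> \<delta> j}"
      using G by (intro openin_continuous_map_preimage[of euclidean "btop \<BB>" G]) (simp_all add: csections_def)
    then have "open {z. G z \<in> tube \<BB> U \<sigma> \<delta> j}" by simp
    moreover have "G x \<in> tube \<BB> U \<sigma> \<delta> j"
      using st(2)[of x] xU \<delta>(1) by (auto simp: tube_def stalk_def)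
    ultimately have "eventually (\<lambda>z. G z \<in> tube \<BB> U \<sigma> \<delta> j) (nhds x)"
      unfolding eventually_nhds by (intro exI[of _ "{z. G z \<in> tube \<BB> U \<sigma> \<delta> j}"]) auto
    moreover have "eventually (\<lambda>z. bsem \<BB> j (H z \<ominus>\<^bsub>stalk_module \<BB> z\<^esub> G z) < \<epsilon> - \<delta>) (nhds x)"
      using close[OF t(4)] \<delta>(2) by simp
    ultimately have "eventually (\<lambda>z. H z \<in> W) (nhds x)"
    proof eventually_elim
      case (elim z)
      have z: "z \<in> U" "bsem \<BB> j (G z \<ominus>\<^bsub>stalk_module \<BB> z\<^esub> \<sigma> z) < \<delta>"
        using elim(1) st(2)[of z] by (auto simp: tube_def stalk_def)
      have "bsem \<BB> j (H z \<ominus>\<^bsub>stalk_module \<BB> z\<^esub> \<sigma> z) < \<epsilon>"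
        using sem_triangle[OF t(4) st \<sigma>[OF z(1)]] z(2) elim(2) by linarith
      then have "H z \<in> tube \<BB> U \<sigma> \<epsilon> j" using z(1) st(1)[of z] by (auto simp: tube_def stalk_def)
      then show ?case using t(6) by blast
    qed
    then show ?thesis unfolding eventually_nhds by auto
  qed
  then show ?thesis
    using H st unfolding csections_at_def topcontinuous_at_def by (auto simp: stalk_def)
qed

end

text \<open>The \<open>n\<close>-th point is a counterexample lying in the members 0 to
  \<open>n\<close> of an enumerated basis; a finite basis is enumerated with repetitions.\<close>

lemma countable_nhds_basis_sequence:
  fixes x :: "'x::topological_space"
  assumes "countable_nhds_basis x" "\<not> eventually P (nhds x)"
  obtains z :: "nat \<Rightarrow> 'x" where "\<And>n. \<not> P (z n)" "filterlim z (nhds x) sequentially"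
proof -
  obtain \<N> where \<N>: "countable \<N>" "\<And>N. N \<in> \<N> \<Longrightarrow> eventually (\<lambda>y. y \<in> N) (nhds x)"
      "\<And>P. eventually P (nhds x) \<Longrightarrow> \<exists>N\<in>\<N>. \<forall>y\<in>N. P y"
    using assms(1) unfolding countable_nhds_basis_def by blast
  have ne: "\<N> \<noteq> {}" using \<N>(3)[of "\<lambda>_. True"] by auto
  have "\<exists>z. \<not> P z \<and> (\<forall>k\<le>n. z \<in> from_nat_into \<N> k)" for n
  proof -
    have "eventually (\<lambda>y. \<forall>k\<in>{..n}. y \<in> from_nat_into \<N> k) (nhds x)"
      using \<N>(2) from_nat_into[OF ne] by (intro eventually_ball_finite) auto
    then show ?thesis using assms(2) by (smt (verit) atMost_iff eventually_mono)
  qed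
  then obtain z where z: "\<And>n. \<not> P (z n)" "\<And>n k. k \<le> n \<Longrightarrow> z n \<in> from_nat_into \<N> k" by metis
  have "eventually (\<lambda>n. Q (z n)) sequentially" if ev: "eventually Q (nhds x)" for Q
  proof -
    obtain N where N: "N \<in> \<N>" "\<forall>y\<in>N. Q y" using \<N>(3)[OF ev] by blast
    then obtain k where "from_nat_into \<N> k = N" using from_nat_into_surj[OF \<N>(1)] by blast
    then show ?thesis using z(2) N(2) unfolding eventually_sequentially by blast
  qed
  then have "filterlim z (nhds x) sequentially" by (simp add: filterlim_iff)
  with z(1) show ?thesis by (rule that)
qed

text \<open>\<open>B\<close> is absorbed by the neighbourhood of zero on which
  \<open>p \<circ> D\<close> is below 1. This makes the real suprema in the seminorms of \<QQ>
  meaningful.\<close>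

lemma endo_bounded_on_bounded:
  assumes M: "complex_space M" and p: "seminorm_on M p" "continuous_map T euclidean p"
    and T: "topspace T = carrier M" and D: "D \<in> endos M T" and B: "bounded_in M T B"
  shows "bdd_above ((\<lambda>b. p (D b)) ` B)"
proof -
  interpret complex_space M by fact
  have lin: "linear_between M M D" and cont: "continuous_map T T D" using D by (auto simp: endos_def)
  have closed: "D u \<in> carrier M" if "u \<in> carrier M" for u
    using lin that by (auto simp: linear_between_def)
  have scale: "D (c \<odot>\<^bsub>M\<^esub> u) = c \<odot>\<^bsub>M\<^esub> D u" if "u \<in> carrier M" for c u
    using lin that by (auto simp: linear_between_def)
  have D0: "D \<zero>\<^bsub>M\<^esub> = \<zero>\<^bsub>M\<^esub>"
    using scale[of "\<zero>\<^bsub>M\<^esub>" 0] closed[of "\<zero>\<^bsub>M\<^esub>"] by simp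
  have cpD: "continuous_map T euclidean (\<lambda>b. p (D b))"
    using continuous_map_compose[OF cont p(2)] by (simp add: comp_def)
  define U where "U = {u \<in> topspace T. p (D u) \<in> {..<1}}"
  have "openin T U"
    unfolding U_def by (rule openin_continuous_map_preimage[OF cpD]) auto
  moreover have "\<zero>\<^bsub>M\<^esub> \<in> U" using D0 seminorm_zero[OF p(1)] by (simp add: U_def T)
  ultimately obtain r where r: "0 < r" "\<And>c. r \<le> norm c \<Longrightarrow> B \<subseteq> (\<lambda>u. c \<odot>\<^bsub>M\<^esub> u) ` U"
    using B unfolding bounded_in_def by blast
  show ?thesis
  proof (rule bdd_aboveI2)
    fix b assume "b \<in> B"
    then obtain u where u: "u \<in> U" "b = of_real r \<odot>\<^bsub>M\<^esub> u"
      using r(1) r(2)[of "of_real r"] by auto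
    then have "p (D b) = r * p (D u)"
      using p(1) r(1) closed[of u] by (simp add: scale U_def T seminorm_on_def)
    also have "\<dots> \<le> r * 1" using u(1) r(1) by (intro mult_left_mono) (auto simp: U_def)
    finally show "p (D b) \<le> r" by simp
  qed
qed

lemma (in obundle) topspace_stalk_top: "topspace (stalk_top \<BB> z) = stalk \<BB> z"
  by (auto simp: stalk_top_def stalk_def)

text \<open>The values \<open>v z\<close> for \<open>v \<in> DD B \<E>\<close> lie in the bounded
  set \<open>B z\<close>, so the supremum is over a bounded set and dominates its member at
  \<open>w\<close>. The inserted 0 merely takes the maximum with 0.\<close>

lemma eval_le_theta_seminorm:
  assumes theta: "theta_structure \<VV> \<QQ> \<Theta> \<E> \<mu>"
    and endo: "\<And>t. D t \<in> stalk_endos \<VV> z"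
    and D: "D \<in> stalk \<QQ> z" and B: "B \<in> \<Theta>" and w: "w \<in> DD B \<E>" and j: "j \<in> bidx \<VV>"
  shows "bsem \<VV> j (D t (w z)) \<le> bsem \<QQ> {(t, j, B)} D"
proof -
  interpret V: obundle \<VV> using theta by (simp add: obundle_def theta_structure_def)
  have "bounded_in (stalk_module \<VV> z) (stalk_top \<VV> z) (B z)"
    using theta B by (simp add: theta_structure_def)
  then have "bdd_above ((\<lambda>b. bsem \<VV> j (D t b)) ` B z)"
    using V.complex_space_stalk V.seminorm_stalk[OF j] V.continuous_sem[OF j] V.topspace_stalk_top endo
    by (intro endo_bounded_on_bounded[of "stalk_module \<VV> z" _ "stalk_top \<VV> z"]) auto
  then have "bdd_above ((\<lambda>v. bsem \<VV> j (D t (v z))) ` DD B \<E>)"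
    by (rule bdd_above_mono) (auto simp: DD_def)
  then have "bsem \<VV> j (D t (w z)) \<le> (SUP v\<in>DD B \<E>. bsem \<VV> j (D t (v z)))"
    using w by (intro cSUP_upper)
  moreover have "bidx \<QQ> = {Q. finite Q \<and> Q \<subseteq> UNIV \<times> bidx \<VV> \<times> \<Theta>}"
    "\<And>Q. Q \<in> bidx \<QQ> \<Longrightarrow> bsem \<QQ> Q D = Max (insert 0 ((\<lambda>(t, j, B). SUP v\<in>DD B \<E>. bsem \<VV> j (D t (v z))) ` Q))"
    using theta D unfolding theta_structure_def by blast+
  then have "bsem \<QQ> {(t, j, B)} D = max 0 (SUP v\<in>DD B \<E>. bsem \<VV> j (D t (v z)))"
    using j B by simp
  ultimately show ?thesis by simp
qed

section \<open>Continuity of the integral\<close>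

theorem corollary3p3p14:
  fixes \<mu> :: "('y::t2_space \<Rightarrow> complex) \<Rightarrow> complex"
    and \<VV> :: "('e, 'x::topological_space, 'j) bundle_data"
    and \<QQ> :: "('y \<Rightarrow> 'e \<Rightarrow> 'e, 'x, ('y \<times> 'j \<times> ('x \<Rightarrow> 'e set)) set) bundle_data"
    and \<ZZ> :: "('y \<Rightarrow> 'e, 'x, ('y \<times> 'j) set) bundle_data"
    and \<Theta> :: "('x \<Rightarrow> 'e set) set"
    and \<E> :: "('x \<Rightarrow> 'e) set"
    and \<H> :: "'x \<Rightarrow> ('y \<Rightarrow> 'e \<Rightarrow> 'e) set"
    and x :: 'x
  assumes "locally_compact_space (euclidean :: 'y topology)"
    and "radon_measure \<mu>"
    and "theta_structure \<VV> \<QQ> \<Theta> \<E> \<mu>"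
    and "mu_related3 \<VV> \<ZZ> \<H> \<mu>"
    and "\<forall>z. \<H> z = stalk \<QQ> z"
    and "countable_nhds_basis x"
    and "\<Gamma> \<QQ> \<bigstar> sections_of \<E> \<Theta> \<subseteq> \<Gamma> \<ZZ>"
  shows "I_mu \<VV> \<mu> ` ui \<VV> \<mu> (peq \<VV> (\<Gamma>_diamond \<QQ> x) \<bigstar> \<Gamma>_through \<VV> (sections_of \<E> \<Theta>) x)
         \<subseteq> \<Gamma>_diamond \<VV> x"
proof (rule image_subsetI)
  fix H assume H: "H \<in> ui \<VV> \<mu> (peq \<VV> (\<Gamma>_diamond \<QQ> x) \<bigstar> \<Gamma>_through \<VV> (sections_of \<E> \<Theta>) x)"
  have rad: "radon \<mu>" using assms(1,2) by (simp add: radon_def)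
  interpret radon \<mu> by (rule rad)
  have rel: "mu_related \<VV> \<ZZ> \<mu>" using assms(4) by (simp add: mu_related3_def)
  interpret V: obundle \<VV> using assms(3) by (simp add: obundle_def theta_structure_def)
  interpret Q: obundle \<QQ> using assms(3) by (simp add: obundle_def theta_structure_def)
  interpret Z: obundle \<ZZ> using rel by (simp add: obundle_def mu_related_def)
  obtain F v where F: "F \<in> peq \<VV> (\<Gamma>_diamond \<QQ> x)" and v: "v \<in> \<Gamma>_through \<VV> (sections_of \<E> \<Theta>) x"
      and H_eq: "H = star F v"
    using H by (auto simp: ui_def star_set_def)
  have F_diamond: "F \<in> \<Gamma>_diamond \<QQ> x" using F by (simp add: peq_def)
  then obtain F0 where F0: "F0 \<in> \<Gamma> \<QQ>" "F x = F0 x" by (auto simp: \<Gamma>_through_def)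
  obtain w B where w: "B \<in> \<Theta>" "w \<in> DD B \<E>" "v x = w x"
    using v by (auto simp: \<Gamma>_through_def sections_of_def)
  have w_Gamma: "w \<in> \<Gamma> \<VV>" using w(2) assms(3) by (auto simp: DD_def theta_structure_def)
  \<comment> \<open>As a section in \<open>\<Gamma> \<ZZ>\<close> this product has a continuous
    integral and an integrable majorant of its own.\<close>
  define K where "K = star F0 w"
  have K: "K \<in> \<Gamma> \<ZZ>"
    using assms(7) F0(1) w(1,2) by (auto simp: K_def star_set_def sections_of_def)
  define G where "G = I_mu \<VV> \<mu> K"
  have G: "G \<in> \<Gamma> \<VV>" using K rel by (auto simp: G_def mu_related_def)
  have Fz: "F z \<in> stalk \<QQ> z" "F0 z \<in> stalk \<QQ> z" for z
    using F_diamond F0(1) by (auto intro: Gamma_through_in_stalk Gamma_in_stalk)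
  have vz: "v z \<in> stalk \<VV> z" "w z \<in> stalk \<VV> z" for z
    using v w_Gamma by (auto intro: Gamma_through_in_stalk Gamma_in_stalk)
  have endo: "D t \<in> stalk_endos \<VV> z" if "D \<in> stalk \<QQ> z" for D t z
    using assms(4,5) that by (auto simp: mu_related3_def)
  \<comment> \<open>\<open>H\<close> is not assumed to be in \<open>\<Gamma> \<ZZ>\<close>; its
    values lie in the stalks by the inclusion in \<open>mu_related3\<close>, since
    \<open>\<H>\<close> consists of the stalks of \<QQ>.\<close>
  have "star F v \<in> Pi UNIV \<H> \<bigstar> Pi UNIV (stalk \<VV>)"
    unfolding star_set_def using Fz(1) vz(1) assms(5)
    by (intro CollectI exI[of _ F] exI[of _ v]) auto
  then have HZ: "H z \<in> stalk \<ZZ> z" for z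
    using assms(4) unfolding H_eq mu_related3_def by blast
  have KZ: "K z \<in> stalk \<ZZ> z" for z using K by (rule Gamma_in_stalk)
  have Z_sub: "stalk \<ZZ> z \<subseteq> Meas (stalk_top \<VV> z) \<mu>"
      "stalk \<ZZ> z \<subseteq> L1 (stalk_module \<VV> z) (stalk_top \<VV> z) \<mu>" for z
    using rel by (auto simp: mu_related_def)
  have Zs: "f s \<in> stalk \<VV> z" if "f \<in> stalk \<ZZ> z" for f s z
    using Z_sub(2)[of z] that by (auto simp: L1_def)
  have weak: "has_weak_integral (stalk_module \<VV> z) (stalk_top \<VV> z) \<mu> (f z) (I_mu \<VV> \<mu> f z)"
    if "f z \<in> stalk \<ZZ> z" for f z
    unfolding I_mu_def using that Z_sub(2) V.seminorm_stalk V.Hausdorff_stalk_top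
    by (intro complex_space.has_weak_integral_weak_integral[OF V.complex_space_stalk rad V.stalk_top_eq]) auto
  note weakH = weak[of H, OF HZ] and weakK = weak[of K, OF KZ]
  have I_stalk: "I_mu \<VV> \<mu> H z \<in> stalk \<VV> z" for z
    using weakH by (simp add: has_weak_integral_def)
  have bound: "ennreal (bsem \<VV> j (I_mu \<VV> \<mu> H z)) \<le> ess_upper_integral \<mu> (\<lambda>s. SUP x. ennreal (bsem \<VV> j (H x s)))"
    if j: "j \<in> bidx \<VV>" for j z
  proof -
    have "ennreal (bsem \<VV> j (I_mu \<VV> \<mu> H z)) \<le> ess_upper_integral \<mu> (\<lambda>s. ennreal (bsem \<VV> j (H z s)))"
      using HZ[of z] Z_sub(2)[of z] j weakH[of z] V.seminorm_stalk[OF j]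
      by (intro complex_space.seminorm_weak_integral_le[OF V.complex_space_stalk rad V.stalk_top_eq]) auto
    also have "\<dots> \<le> ess_upper_integral \<mu> (\<lambda>s. SUP x. ennreal (bsem \<VV> j (H x s)))"
      by (intro ess_upper_integral_mono SUP_upper) auto
    finally show ?thesis .
  qed
  have diff_le: "ennreal (bsem \<VV> j (I_mu \<VV> \<mu> H z \<ominus>\<^bsub>stalk_module \<VV> z\<^esub> G z))
      \<le> ess_upper_integral \<mu> (\<lambda>s. ennreal (bsem \<VV> j (H z s \<ominus>\<^bsub>stalk_module \<VV> z\<^esub> K z s)))"
    if j: "j \<in> bidx \<VV>" for j z
  proof -
    have "H z \<in> L1 (stalk_module \<VV> z) (stalk_top \<VV> z) \<mu>" "K z \<in> L1 (stalk_module \<VV> z) (stalk_top \<VV> z) \<mu>"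
      using HZ KZ Z_sub(2) by auto
    from complex_space.L1_minus[OF V.complex_space_stalk rad this weakH weakK]
    show ?thesis
      unfolding G_def using j
      by (intro complex_space.seminorm_weak_integral_le[OF V.complex_space_stalk rad V.stalk_top_eq _ V.seminorm_stalk[OF j]]) auto
  qed
  have fin: "ess_upper_integral \<mu> (\<lambda>s. SUP x. ennreal (bsem \<VV> j (H x s))) < \<infinity>"
      "ess_upper_integral \<mu> (\<lambda>s. SUP x. ennreal (bsem \<VV> j (K x s))) < \<infinity>" if j: "j \<in> bidx \<VV>" for j
    using H K rel j by (auto simp: ui_def mu_related_def)
  have meas: "(\<lambda>s. bsem \<VV> j (H z s \<ominus>\<^bsub>stalk_module \<VV> z\<^esub> K z s)) \<in> Meas euclidean \<mu>"
    if j: "j \<in> bidx \<VV>" for j z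
  proof -
    \<comment> \<open>Measurability of the difference is read off from the stalk of \<ZZ>, which is
      closed under subtraction and consists of measurable maps.\<close>
    have "H z \<ominus>\<^bsub>stalk_module \<ZZ> z\<^esub> K z = (\<lambda>s. H z s \<ominus>\<^bsub>stalk_module \<VV> z\<^esub> K z s)"
      using rel HZ[of z] KZ[of z] Z.scale_in_stalk[OF KZ, of "-1" z] Zs
      by (simp add: Z.stalk_minus V.stalk_minus mu_related_def)
    then have "(\<lambda>s. H z s \<ominus>\<^bsub>stalk_module \<VV> z\<^esub> K z s) \<in> Meas (stalk_top \<VV> z) \<mu>"
      using Z.minus_in_stalk[OF HZ KZ, of z] Z_sub(1) by auto
    then show ?thesis using V.continuous_sem[OF j] by (rule Meas_compose)
  qed
  have pointwise: "eventually (\<lambda>z. bsem \<VV> j (H z s \<ominus>\<^bsub>stalk_module \<VV> z\<^esub> K z s) < \<epsilon>) (nhds x)"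
    if j: "j \<in> bidx \<VV>" and \<epsilon>: "0 < \<epsilon>" for j s \<epsilon>
  proof -
    obtain a j1 where a: "0 < a" "j1 \<in> bidx \<VV>"
        "\<And>z u. u \<in> stalk \<VV> z \<Longrightarrow> bsem \<VV> j (F z s u) \<le> a * bsem \<VV> j1 u"
      using F j unfolding peq_def by blast
    \<comment> \<open>The set \<open>B\<close> is the one that belongs to \<open>w\<close>, so the
      supremum defining this seminorm includes \<open>w\<close>.\<close>
    have idx: "{(s, j, B)} \<in> bidx \<QQ>" using assms(3) j w(1) by (auto simp: theta_structure_def)
    \<comment> \<open>Applying \<open>F\<close> costs the factor \<open>a\<close>, leaving
      \<open>\<epsilon> / 2\<close>; the same \<open>a\<close> and \<open>j1\<close> serve all
      stalks.\<close>
    have "eventually (\<lambda>z. bsem \<VV> j1 (v z \<ominus>\<^bsub>stalk_module \<VV> z\<^esub> w z) < \<epsilon> / (2 * a)) (nhds x)"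
      using v w(3) a \<epsilon> by (intro V.csections_at_close w_Gamma) (auto simp: \<Gamma>_through_def)
    moreover have "eventually (\<lambda>z. bsem \<QQ> {(s, j, B)} (F z \<ominus>\<^bsub>stalk_module \<QQ> z\<^esub> F0 z) < \<epsilon> / 2) (nhds x)"
      using F_diamond F0 \<epsilon> idx by (intro Q.csections_at_close) (auto simp: \<Gamma>_through_def)
    ultimately show ?thesis
    proof eventually_elim
      case (elim z)
      interpret S: complex_space "stalk_module \<VV> z" by (rule V.complex_space_stalk)
      have lin: "linear_between (stalk_module \<VV> z) (stalk_module \<VV> z) (F z s)"
        using endo[OF Fz(1)] by (auto simp: endos_def)
      have Fs: "F z s u \<in> stalk \<VV> z" "F0 z s u \<in> stalk \<VV> z" if "u \<in> stalk \<VV> z" for u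
        using endo[OF Fz(1), of z s] endo[OF Fz(2), of z s] that by (auto simp: endos_def linear_between_def)
      have "F z s (v z \<ominus>\<^bsub>stalk_module \<VV> z\<^esub> w z) = F z s (v z) \<ominus>\<^bsub>stalk_module \<VV> z\<^esub> F z s (w z)"
        using lin vz[of z] Fs S.scale_closed[of "w z" "-1"]
        by (simp add: S.minus_eq_scale linear_between_def)
      then have "bsem \<VV> j (F z s (v z) \<ominus>\<^bsub>stalk_module \<VV> z\<^esub> F z s (w z)) \<le> a * bsem \<VV> j1 (v z \<ominus>\<^bsub>stalk_module \<VV> z\<^esub> w z)"
        using a(3)[OF V.minus_in_stalk[OF vz]] by metis
      also have "\<dots> < a * (\<epsilon> / (2 * a))" using elim(1) a(1) by (intro mult_strict_left_mono)
      finally have 1: "bsem \<VV> j (F z s (v z) \<ominus>\<^bsub>stalk_module \<VV> z\<^esub> F z s (w z)) < \<epsilon> / 2"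
        using a(1) by simp
      have D: "F z \<ominus>\<^bsub>stalk_module \<QQ> z\<^esub> F0 z \<in> stalk \<QQ> z" by (rule Q.minus_in_stalk[OF Fz])
      \<comment> \<open>The pointwise operations of \<QQ> are restricted to the stalk, so they are
        evaluated using that \<open>w z\<close> lies in it.\<close>
      have "(F z \<ominus>\<^bsub>stalk_module \<QQ> z\<^esub> F0 z) s (w z) = F z s (w z) \<ominus>\<^bsub>stalk_module \<VV> z\<^esub> F0 z s (w z)"
        using assms(3) Fz[of z] Q.scale_in_stalk[OF Fz(2), of "-1" z] Fs[OF vz(2)] vz(2)[of z]
        by (simp add: Q.stalk_minus V.stalk_minus theta_structure_def)
      then have "bsem \<VV> j (F z s (w z) \<ominus>\<^bsub>stalk_module \<VV> z\<^esub> F0 z s (w z))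
          \<le> bsem \<QQ> {(s, j, B)} (F z \<ominus>\<^bsub>stalk_module \<QQ> z\<^esub> F0 z)"
        using eval_le_theta_seminorm[where D = "F z \<ominus>\<^bsub>stalk_module \<QQ> z\<^esub> F0 z" and t = s,
            OF assms(3) endo[OF D] D w(1,2) j] by simp
      then have 2: "bsem \<VV> j (F z s (w z) \<ominus>\<^bsub>stalk_module \<VV> z\<^esub> F0 z s (w z)) < \<epsilon> / 2"
        using elim(2) by simp
      have "bsem \<VV> j (F z s (v z) \<ominus>\<^bsub>stalk_module \<VV> z\<^esub> F0 z s (w z)) < \<epsilon>"
        using V.sem_triangle[OF j Fs(1)[OF vz(1)] Fs(1)[OF vz(2)] Fs(2)[OF vz(2)]] 1 2 by linarith
      then show ?case by (simp add: H_eq K_def star_def)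
    qed
  qed
  have close: "eventually (\<lambda>z. bsem \<VV> j (I_mu \<VV> \<mu> H z \<ominus>\<^bsub>stalk_module \<VV> z\<^esub> G z) < \<epsilon>) (nhds x)"
    if j: "j \<in> bidx \<VV>" and \<epsilon>: "0 < \<epsilon>" for j \<epsilon>
  proof (rule ccontr)
    assume neg: "\<not> ?thesis"
    obtain z where z: "\<And>n::nat. \<not> bsem \<VV> j (I_mu \<VV> \<mu> H (z n) \<ominus>\<^bsub>stalk_module \<VV> (z n)\<^esub> G (z n)) < \<epsilon>"
        "filterlim z (nhds x) sequentially"
      using countable_nhds_basis_sequence[OF assms(6) neg] by blast
    define f where "f n s = bsem \<VV> j (H (z n) s \<ominus>\<^bsub>stalk_module \<VV> (z n)\<^esub> K (z n) s)" for n s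
    \<comment> \<open>The first supremum has finite integral because \<open>H\<close> is in
      \<open>ui\<close>, the second because \<open>K \<in> \<Gamma> \<ZZ>\<close>; neither depends
      on \<open>n\<close>.\<close>
    let ?g = "\<lambda>s. (SUP x. ennreal (bsem \<VV> j (H x s))) + (SUP x. ennreal (bsem \<VV> j (K x s)))"
    have f0: "0 \<le> f n s" for n s
      unfolding f_def by (rule V.sem_nonneg[OF j V.minus_in_stalk[OF Zs[OF HZ] Zs[OF KZ]]])
    have "eventually (\<lambda>n. ess_upper_integral \<mu> (\<lambda>s. ennreal (f n s)) < ennreal \<epsilon>) sequentially"
    proof (rule ess_upper_integral_dominated_convergence)
      show "f n \<in> Meas euclidean \<mu>" for n unfolding f_def by (rule meas[OF j])
      show "ennreal (f n s) \<le> ?g s" for n s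
      proof -
        have st: "H (z n) s \<in> stalk \<VV> (z n)" "K (z n) s \<in> stalk \<VV> (z n)" using Zs HZ KZ by auto
        have "ennreal (f n s) \<le> ennreal (bsem \<VV> j (H (z n) s) + bsem \<VV> j (K (z n) s))"
          unfolding f_def by (intro ennreal_leI V.sem_minus_le[OF j st])
        also have "\<dots> = ennreal (bsem \<VV> j (H (z n) s)) + ennreal (bsem \<VV> j (K (z n) s))"
          using V.sem_nonneg[OF j st(1)] V.sem_nonneg[OF j st(2)] by simp
        also have "\<dots> \<le> ?g s" by (intro add_mono SUP_upper) auto
        finally show ?thesis .
      qed
      show "ess_upper_integral \<mu> ?g < \<infinity>"
        using fin[OF j] by (intro order_le_less_trans[OF ess_upper_integral_add]) simp
      show "(\<lambda>n. f n s) \<longlonglongrightarrow> 0" for s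
      proof (rule order_tendstoI)
        show "eventually (\<lambda>n. f n s < e) sequentially" if "0 < e" for e
          using filterlim_iff[THEN iffD1, OF z(2)] pointwise[OF j that, of s] unfolding f_def by blast
        show "eventually (\<lambda>n. e < f n s) sequentially" if "e < 0" for e
          using less_le_trans[OF that f0] by simp
      qed
    qed (rule \<epsilon>)
    then obtain n where "ess_upper_integral \<mu> (\<lambda>s. ennreal (f n s)) < ennreal \<epsilon>"
      by (auto simp: eventually_sequentially)
    with diff_le[OF j, of "z n"] have "ennreal (bsem \<VV> j (I_mu \<VV> \<mu> H (z n) \<ominus>\<^bsub>stalk_module \<VV> (z n)\<^esub> G (z n))) < ennreal \<epsilon>"
      unfolding f_def by (rule order_le_less_trans)
    then show False using z(1)[of n] by (simp add: ennreal_less_iff not_less ennreal_leI leD)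
  qed
  have "I_mu \<VV> \<mu> H \<in> bounded_sections \<VV> UNIV"
  proof -
    have "bdd_above (range (\<lambda>z. bsem \<VV> j (I_mu \<VV> \<mu> H z)))" if j: "j \<in> bidx \<VV>" for j
    proof -
      \<comment> \<open>The majorant is the same for every \<open>z\<close>, so one real number
        bounds the integrals in all stalks.\<close>
      obtain r where r: "0 \<le> r" "ess_upper_integral \<mu> (\<lambda>s. SUP x. ennreal (bsem \<VV> j (H x s))) = ennreal r"
        using fin(1)[OF j] by (cases "ess_upper_integral \<mu> (\<lambda>s. SUP x. ennreal (bsem \<VV> j (H x s)))") auto
      show ?thesis
        using bound[OF j] r by (intro bdd_aboveI2[of _ _ r]) (simp add: ennreal_le_iff)
    qed
    then show ?thesis using I_stalk by (simp add: bounded_sections_def PiE_iff)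
  qed
  \<comment> \<open>Only the values at \<open>x\<close> enter, and there the two integrands coincide
    as maps.\<close>
  moreover have eq: "I_mu \<VV> \<mu> H x = G x"
    using F0(2) w(3) by (simp add: G_def I_mu_def H_eq K_def star_def)
  ultimately have "I_mu \<VV> \<mu> H \<in> csections_at \<VV> UNIV x"
    using close by (intro V.csections_atI[OF _ G])
  then show "I_mu \<VV> \<mu> H \<in> \<Gamma>_diamond \<VV> x"
    using G eq by (auto simp: \<Gamma>_through_def)
qed

end
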